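(* Let $\mathfrak X$ be a connective encoding structure on a poset $\mathcal P$. Then the category $\mathrm{PerM}_{\mathfrak X}(\mathcal P)$ of $\mathfrak X$-encodable persistence modules over $\mathcal P$ is a full abelian subcategory of $\mathrm{Vect}^{\mathcal P}$.
   Context: $\mathrm{Vect}$ is the category of vector spaces over a fixed field $\mathbb{F}$. For a poset $\mathcal P$, viewed as a category, $\mathrm{Vect}^{\mathcal P}$ is the category of functors $\mathcal P\to\mathrm{Vect}$ (persistence modules over $\mathcal P$); for a poset map $e$, $e^*$ denotes precomposition with $e$. An interval in $\mathcal P$ is a subset $I$ such that $q\le p\le q'$ and $q,q'\in I$ imply $p\in I$. An encoding structure on $\mathcal P$ is a subset $\mathfrak X$ of the powerset of $\mathcal P$ such that: (1) $\mathfrak X$ is closed under finite unions and complements and contains $\mathcal P$; (2) if $I\in\mathfrak X$ is an interval, there are upsets $U,V\in\mathfrak X$ with $I=U\cap V^c$; (3) every element of $\mathfrak X$ is a finite union of intervals which are themselves in $\mathfrak X$. A poset is $\leq$-connected if any two elements are joined by a finite zigzag of comparable elements; the $\leq$-connected components of a poset are its maximal $\leq$-connected subsets (the equivalence classes of the relation "joined by a finite zigzag"). For a subset of a poset these notions refer to the induced order. $\mathfrak X$ is connective if every interval $I\in\mathfrak X$ has only finitely many $\leq$-connected components and these are also elements of $\mathfrak X$. $M\in\mathrm{Vect}^{\mathcal P}$ is $\mathfrak X$-encodable if there are a finite poset $\mathcal P'$, a poset map $e\colon\mathcal P\to\mathcal P'$ all of whose fibers lie in $\mathfrak X$, a pointwise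 finite dimensional $M'\in\mathrm{Vect}^{\mathcal P'}$ and an isomorphism $M\cong e^*M'$. $\mathrm{PerM}_{\mathfrak X}(\mathcal P)$ is the full subcategory of $\mathrm{Vect}^{\mathcal P}$ on the $\mathfrak X$-encodable modules. Full abelian subcategory: a full additive subcategory $\mathcal B$ of an abelian category $\mathcal A$ such that the kernel and cokernel, taken in $\mathcal A$, of every morphism of $\mathcal B$ are (up to isomorphism) in $\mathcal B$; equivalently $\mathcal B$ is abelian and the inclusion is exact. *)

theory Defs
  imports "Jordan_Normal_Form.Missing_VectorSpace"
begin

section \<open>Preadditive, additive and abelian categories\<close>

text \<open>
  Hom-sets are indexed by their source and target, so the hom-sets of different pairs of objects
  need not be disjoint. Accordingly \<open>cmp C a b c g f\<close>, the composite of
  \<open>f : a \<rightarrow> b\<close> and \<open>g : b \<rightarrow> c\<close>, takes the objects as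
  arguments; \<open>zarr C a b\<close> and \<open>plus_arr C a b\<close> are the zero and the addition
  of the hom-set of \<open>a\<close> and \<open>b\<close>.
\<close>

record ('o, 'm) precat =
  objs :: "'o set"
  arrs :: "'o \<Rightarrow> 'o \<Rightarrow> 'm set"
  ident :: "'o \<Rightarrow> 'm"
  cmp :: "'o \<Rightarrow> 'o \<Rightarrow> 'o \<Rightarrow> 'm \<Rightarrow> 'm \<Rightarrow> 'm"
  zarr :: "'o \<Rightarrow> 'o \<Rightarrow> 'm"
  plus_arr :: "'o \<Rightarrow> 'o \<Rightarrow> 'm \<Rightarrow> 'm \<Rightarrow> 'm"

locale cat =
  fixes C :: "('o, 'm) precat"
  assumes ident_arr: "a \<in> objs C \<Longrightarrow> ident C a \<in> arrs C a a"
    and cmp_arr: "\<lbrakk>a \<in> objs C; b \<in> objs C; c \<in> objs C; f \<in> arrs C a b; g \<in> arrs C b c\<rbrakk>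
      \<Longrightarrow> cmp C a b c g f \<in> arrs C a c"
    and cmp_ident_right: "\<lbrakk>a \<in> objs C; b \<in> objs C; f \<in> arrs C a b\<rbrakk>
      \<Longrightarrow> cmp C a a b f (ident C a) = f"
    and cmp_ident_left: "\<lbrakk>a \<in> objs C; b \<in> objs C; f \<in> arrs C a b\<rbrakk>
      \<Longrightarrow> cmp C a b b (ident C b) f = f"
    and cmp_assoc: "\<lbrakk>a \<in> objs C; b \<in> objs C; c \<in> objs C; d \<in> objs C;
        f \<in> arrs C a b; g \<in> arrs C b c; h \<in> arrs C c d\<rbrakk>
      \<Longrightarrow> cmp C a c d h (cmp C a b c g f) = cmp C a b d (cmp C b c d h g) f"

locale preadditive_category = cat +
  assumes arrs_comm_group: "\<lbrakk>a \<in> objs C; b \<in> objs C\<rbrakk>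
      \<Longrightarrow> comm_group \<lparr>carrier = arrs C a b, mult = plus_arr C a b, one = zarr C a b\<rparr>"
    and cmp_plus_right: "\<lbrakk>a \<in> objs C; b \<in> objs C; c \<in> objs C;
        f \<in> arrs C a b; f' \<in> arrs C a b; g \<in> arrs C b c\<rbrakk>
      \<Longrightarrow> cmp C a b c g (plus_arr C a b f f')
        = plus_arr C a c (cmp C a b c g f) (cmp C a b c g f')"
    and cmp_plus_left: "\<lbrakk>a \<in> objs C; b \<in> objs C; c \<in> objs C;
        f \<in> arrs C a b; g \<in> arrs C b c; g' \<in> arrs C b c\<rbrakk>
      \<Longrightarrow> cmp C a b c (plus_arr C b c g g') f
        = plus_arr C a c (cmp C a b c g f) (cmp C a b c g' f)"

definition isomorphic :: "('o, 'm) precat \<Rightarrow> 'o \<Rightarrow> 'o \<Rightarrow> bool" where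
  "isomorphic C a b \<longleftrightarrow> a \<in> objs C \<and> b \<in> objs C \<and>
    (\<exists>f \<in> arrs C a b. \<exists>g \<in> arrs C b a.
      cmp C a b a g f = ident C a \<and> cmp C b a b f g = ident C b)"

definition zero_object :: "('o, 'm) precat \<Rightarrow> 'o \<Rightarrow> bool" where
  "zero_object C z \<longleftrightarrow> z \<in> objs C \<and>
    (\<forall>a \<in> objs C. (\<exists>!f. f \<in> arrs C a z) \<and> (\<exists>!f. f \<in> arrs C z a))"

definition is_biproduct ::
  "('o, 'm) precat \<Rightarrow> 'o \<Rightarrow> 'o \<Rightarrow> 'o \<Rightarrow> 'm \<Rightarrow> 'm \<Rightarrow> 'm \<Rightarrow> 'm \<Rightarrow> bool" where
  "is_biproduct C a b s i j p q \<longleftrightarrow> s \<in> objs C \<and>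
    i \<in> arrs C a s \<and> j \<in> arrs C b s \<and> p \<in> arrs C s a \<and> q \<in> arrs C s b \<and>
    cmp C a s a p i = ident C a \<and> cmp C b s b q j = ident C b \<and>
    cmp C b s a p j = zarr C b a \<and> cmp C a s b q i = zarr C a b \<and>
    plus_arr C s s (cmp C s a s i p) (cmp C s b s j q) = ident C s"

definition is_kernel :: "('o, 'm) precat \<Rightarrow> 'o \<Rightarrow> 'o \<Rightarrow> 'm \<Rightarrow> 'o \<Rightarrow> 'm \<Rightarrow> bool" where
  "is_kernel C a b f k m \<longleftrightarrow> k \<in> objs C \<and> m \<in> arrs C k a \<and> cmp C k a b f m = zarr C k b \<and>
    (\<forall>c \<in> objs C. \<forall>g \<in> arrs C c a. cmp C c a b f g = zarr C c b \<longrightarrow>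
      (\<exists>!h. h \<in> arrs C c k \<and> cmp C c k a m h = g))"

definition is_cokernel :: "('o, 'm) precat \<Rightarrow> 'o \<Rightarrow> 'o \<Rightarrow> 'm \<Rightarrow> 'o \<Rightarrow> 'm \<Rightarrow> bool" where
  "is_cokernel C a b f k m \<longleftrightarrow> k \<in> objs C \<and> m \<in> arrs C b k \<and> cmp C a b k m f = zarr C a k \<and>
    (\<forall>c \<in> objs C. \<forall>g \<in> arrs C b c. cmp C a b c g f = zarr C a c \<longrightarrow>
      (\<exists>!h. h \<in> arrs C k c \<and> cmp C b k c h m = g))"

definition is_mono :: "('o, 'm) precat \<Rightarrow> 'o \<Rightarrow> 'o \<Rightarrow> 'm \<Rightarrow> bool" where
  "is_mono C a b f \<longleftrightarrow> f \<in> arrs C a b \<and>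
    (\<forall>c \<in> objs C. \<forall>g \<in> arrs C c a. \<forall>h \<in> arrs C c a. cmp C c a b f g = cmp C c a b f h \<longrightarrow> g = h)"

definition is_epi :: "('o, 'm) precat \<Rightarrow> 'o \<Rightarrow> 'o \<Rightarrow> 'm \<Rightarrow> bool" where
  "is_epi C a b f \<longleftrightarrow> f \<in> arrs C a b \<and>
    (\<forall>c \<in> objs C. \<forall>g \<in> arrs C b c. \<forall>h \<in> arrs C b c. cmp C a b c g f = cmp C a b c h f \<longrightarrow> g = h)"

locale additive_category = preadditive_category +
  assumes ex_zero_object: "\<exists>z. zero_object C z"
    and ex_biproduct: "\<lbrakk>a \<in> objs C; b \<in> objs C\<rbrakk> \<Longrightarrow> \<exists>s i j p q. is_biproduct C a b s i j p q"

locale abelian_category = additive_category +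
  assumes ex_kernel: "\<lbrakk>a \<in> objs C; b \<in> objs C; f \<in> arrs C a b\<rbrakk> \<Longrightarrow> \<exists>k m. is_kernel C a b f k m"
    and ex_cokernel: "\<lbrakk>a \<in> objs C; b \<in> objs C; f \<in> arrs C a b\<rbrakk> \<Longrightarrow> \<exists>k m. is_cokernel C a b f k m"
    and mono_is_kernel: "\<lbrakk>a \<in> objs C; b \<in> objs C; is_mono C a b f\<rbrakk>
      \<Longrightarrow> \<exists>c \<in> objs C. \<exists>g \<in> arrs C b c. is_kernel C b c g a f"
    and epi_is_cokernel: "\<lbrakk>a \<in> objs C; b \<in> objs C; is_epi C a b f\<rbrakk>
      \<Longrightarrow> \<exists>c \<in> objs C. \<exists>g \<in> arrs C c a. is_cokernel C c a g b f"

definition full_subcategory :: "('o, 'm) precat \<Rightarrow> 'o set \<Rightarrow> ('o, 'm) precat" where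
  "full_subcategory A S = A\<lparr>objs := S\<rparr>"

definition full_abelian_subcategory :: "('o, 'm) precat \<Rightarrow> ('o, 'm) precat \<Rightarrow> bool" where
  "full_abelian_subcategory B A \<longleftrightarrow>
    abelian_category A \<and>
    objs B \<subseteq> objs A \<and> B = full_subcategory A (objs B) \<and>
    additive_category B \<and>
    (\<forall>a \<in> objs B. \<forall>b \<in> objs B. \<forall>f \<in> arrs B a b.
      (\<forall>k m. is_kernel A a b f k m \<longrightarrow> (\<exists>k' \<in> objs B. isomorphic A k k')) \<and>
      (\<forall>k m. is_cokernel A a b f k m \<longrightarrow> (\<exists>k' \<in> objs B. isomorphic A k k')))"


section \<open>Vector spaces and persistence modules\<close>

text \<open>
  The vector spaces whose carrier is a set of elements of the type \<open>'v\<close>, which plays the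
  role of the universe in the definition of the category of vector spaces. Linear maps are taken to
  be extensional so that equality of morphisms is equality on the carrier. An arbitrary
  set-indexed family of vector spaces can be realised in a suitable \<open>'v\<close>; if \<open>'v\<close>
  is infinite, the universe is closed under finite direct sums up to isomorphism.
\<close>

definition Vect :: "('f, 'k) ring_scheme \<Rightarrow> (('f, 'v) module, 'v \<Rightarrow> 'v) precat" where
  "Vect K = \<lparr>
    objs = {V. vectorspace K V},
    arrs = (\<lambda>V W. {T \<in> carrier V \<rightarrow>\<^sub>E carrier W. linear_map K V W T}),
    ident = (\<lambda>V. \<lambda>x \<in> carrier V. x),
    cmp = (\<lambda>U V W g f. compose (carrier U) g f),
    zarr = (\<lambda>V W. \<lambda>x \<in> carrier V. \<zero>\<^bsub>W\<^esub>),
    plus_arr = (\<lambda>V W f g. \<lambda>x \<in> carrier V. f x \<oplus>\<^bsub>W\<^esub> g x)\<rparr>"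

text \<open>
  A poset is a carrier set \<open>P\<close> with a relation \<open>r\<close> satisfying
  \<open>partial_order_on P r\<close>; here \<open>(p, q) \<in> r\<close> means \<open>p \<le> q\<close>.
  The values of a diagram outside \<open>P\<close> and \<open>r\<close> are irrelevant: diagrams that
  agree on \<open>P\<close> and \<open>r\<close> are isomorphic objects of \<open>functor_category P r C\<close>.
\<close>

record ('p, 'o, 'm) diagram =
  dobj :: "'p \<Rightarrow> 'o"
  dmap :: "'p \<Rightarrow> 'p \<Rightarrow> 'm"

definition is_functor ::
  "'p set \<Rightarrow> 'p rel \<Rightarrow> ('o, 'm) precat \<Rightarrow> ('p, 'o, 'm) diagram \<Rightarrow> bool" where
  "is_functor P r C M \<longleftrightarrow>
    (\<forall>p \<in> P. dobj M p \<in> objs C) \<and>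
    (\<forall>p q. (p, q) \<in> r \<longrightarrow> dmap M p q \<in> arrs C (dobj M p) (dobj M q)) \<and>
    (\<forall>p \<in> P. dmap M p p = ident C (dobj M p)) \<and>
    (\<forall>p q s. (p, q) \<in> r \<longrightarrow> (q, s) \<in> r \<longrightarrow>
      dmap M p s = cmp C (dobj M p) (dobj M q) (dobj M s) (dmap M q s) (dmap M p q))"

definition functor_category ::
  "'p set \<Rightarrow> 'p rel \<Rightarrow> ('o, 'm) precat \<Rightarrow> (('p, 'o, 'm) diagram, 'p \<Rightarrow> 'm) precat" where
  "functor_category P r C = \<lparr>
    objs = {M. is_functor P r C M},
    arrs = (\<lambda>M N. {\<eta> \<in> (\<Pi>\<^sub>E p \<in> P. arrs C (dobj M p) (dobj N p)).
      \<forall>p q. (p, q) \<in> r \<longrightarrow>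
        cmp C (dobj M p) (dobj N p) (dobj N q) (dmap N p q) (\<eta> p)
        = cmp C (dobj M p) (dobj M q) (dobj N q) (\<eta> q) (dmap M p q)}),
    ident = (\<lambda>M. \<lambda>p \<in> P. ident C (dobj M p)),
    cmp = (\<lambda>L M N g f. \<lambda>p \<in> P. cmp C (dobj L p) (dobj M p) (dobj N p) (g p) (f p)),
    zarr = (\<lambda>M N. \<lambda>p \<in> P. zarr C (dobj M p) (dobj N p)),
    plus_arr = (\<lambda>M N f g. \<lambda>p \<in> P. plus_arr C (dobj M p) (dobj N p) (f p) (g p))\<rparr>"

type_synonym ('p, 'f, 'v) persistence_module = "('p, ('f, 'v) module, 'v \<Rightarrow> 'v) diagram"

definition Vect_pow ::
  "('f, 'k) ring_scheme \<Rightarrow> 'p set \<Rightarrow> 'p rel \<Rightarrow>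
    (('p, 'f, 'v) persistence_module, 'p \<Rightarrow> 'v \<Rightarrow> 'v) precat" where
  "Vect_pow K P r = functor_category P r (Vect K)"

definition pullback :: "('p \<Rightarrow> 'q) \<Rightarrow> ('q, 'o, 'm) diagram \<Rightarrow> ('p, 'o, 'm) diagram" where
  "pullback e M = \<lparr>dobj = (\<lambda>p. dobj M (e p)), dmap = (\<lambda>p q. dmap M (e p) (e q))\<rparr>"

definition poset_map :: "'p set \<Rightarrow> 'p rel \<Rightarrow> 'q set \<Rightarrow> 'q rel \<Rightarrow> ('p \<Rightarrow> 'q) \<Rightarrow> bool" where
  "poset_map P r Q s e \<longleftrightarrow> e \<in> P \<rightarrow> Q \<and> monotone_on P (\<lambda>x y. (x, y) \<in> r) (\<lambda>x y. (x, y) \<in> s) e"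


section \<open>Encoding structures\<close>

definition is_interval :: "'p set \<Rightarrow> 'p rel \<Rightarrow> 'p set \<Rightarrow> bool" where
  "is_interval P r I \<longleftrightarrow> I \<subseteq> P \<and>
    (\<forall>q \<in> I. \<forall>q' \<in> I. \<forall>p \<in> P. (q, p) \<in> r \<longrightarrow> (p, q') \<in> r \<longrightarrow> p \<in> I)"

definition is_upset :: "'p set \<Rightarrow> 'p rel \<Rightarrow> 'p set \<Rightarrow> bool" where
  "is_upset P r U \<longleftrightarrow> U \<subseteq> P \<and> (\<forall>p \<in> U. \<forall>q \<in> P. (p, q) \<in> r \<longrightarrow> q \<in> U)"

definition encoding_structure :: "'p set \<Rightarrow> 'p rel \<Rightarrow> 'p set set \<Rightarrow> bool" where
  "encoding_structure P r X \<longleftrightarrow>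
    X \<subseteq> Pow P \<and>
    (\<forall>F. finite F \<longrightarrow> F \<subseteq> X \<longrightarrow> \<Union>F \<in> X) \<and> (\<forall>A \<in> X. P - A \<in> X) \<and> P \<in> X \<and>
    (\<forall>I \<in> X. is_interval P r I \<longrightarrow>
      (\<exists>U \<in> X. \<exists>V \<in> X. is_upset P r U \<and> is_upset P r V \<and> I = U \<inter> (P - V))) \<and>
    (\<forall>A \<in> X. \<exists>F. finite F \<and> F \<subseteq> X \<and> (\<forall>I \<in> F. is_interval P r I) \<and> A = \<Union>F)"

text \<open>The relation on \<open>S\<close> of being joined by a finite zigzag of comparable elements of
  \<open>S\<close>, and its equivalence classes.\<close>

definition zigzag :: "'p rel \<Rightarrow> 'p set \<Rightarrow> 'p rel" where
  "zigzag r S = {(x, y) \<in> S \<times> S. (x, y) \<in> ((r \<union> r\<inverse>) \<inter> S \<times> S)\<^sup>*}"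

definition le_components :: "'p rel \<Rightarrow> 'p set \<Rightarrow> 'p set set" where
  "le_components r S = S // zigzag r S"

definition connective :: "'p set \<Rightarrow> 'p rel \<Rightarrow> 'p set set \<Rightarrow> bool" where
  "connective P r X \<longleftrightarrow>
    (\<forall>I \<in> X. is_interval P r I \<longrightarrow> finite (le_components r I) \<and> le_components r I \<subseteq> X)"

text \<open>Every finite poset is isomorphic to one whose carrier is a set of natural numbers, so the
  encoding poset may be chosen of this form.\<close>

definition encodable ::
  "('f, 'k) ring_scheme \<Rightarrow> 'p set \<Rightarrow> 'p rel \<Rightarrow> 'p set set \<Rightarrow> ('p, 'f, 'v) persistence_module \<Rightarrow> bool"
where
  "encodable K P r X M \<longleftrightarrow>
    (\<exists>(Q :: nat set) s e (M' :: (nat, 'f, 'v) persistence_module).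
      finite Q \<and> partial_order_on Q s \<and> poset_map P r Q s e \<and>
      (\<forall>q \<in> Q. {p \<in> P. e p = q} \<in> X) \<and>
      M' \<in> objs (Vect_pow K Q s) \<and> (\<forall>q \<in> Q. vectorspace.fin_dim K (dobj M' q)) \<and>
      isomorphic (Vect_pow K P r) M (pullback e M'))"

definition PerM ::
  "('f, 'k) ring_scheme \<Rightarrow> 'p set \<Rightarrow> 'p rel \<Rightarrow> 'p set set \<Rightarrow>
    (('p, 'f, 'v) persistence_module, 'p \<Rightarrow> 'v \<Rightarrow> 'v) precat" where
  "PerM K P r X =
    full_subcategory (Vect_pow K P r) {M \<in> objs (Vect_pow K P r). encodable K P r X M}"

end

theory Submission
  imports Defs
begin

text \<open>
  The category of diagrams in an abelian category is abelian, with kernels and cokernels computed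
  pointwise. Two encodable modules \<open>M\<close>, \<open>N\<close> are encoded simultaneously by
  \<open>(e1, e2)\<close>, but a morphism \<open>f : M \<rightarrow> N\<close> need not be constant on the
  fibres of that map. The transition maps inside a fibre are identities, so naturality makes
  \<open>f\<close> constant along every comparable pair in a fibre, hence on its connected components.
  Connectivity says that replacing the fibres by their components is again a finite encoding. After
  this refinement \<open>f\<close> descends to the finite encoding poset, where its kernel and cokernel
  are pointwise finite dimensional, and pulling back is exact.
\<close>

section \<open>Kernels and cokernels in preadditive categories\<close>

text \<open>Transition maps inside a fibre are identities only after \<open>f\<close> is conjugated
  by the chosen isomorphisms into a morphism of pulled-back diagrams. Connectivity is stated for
  intervals; it applies because fibres of monotone maps into posets are intervals. The main obstacle
  is the order on the components: "some point of A lies below some point of B" need not be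
  transitive. Its transitive closure is a partial order because \<open>(e1, e2)\<close> is monotone
  along it, but naturality of the descended morphism must then be proved along chains. The
  categorical part works over an arbitrary abelian \<open>C\<close> with a class \<open>S\<close> of
  objects standing for the finite-dimensional spaces. This generality makes duality available: the
  opposite of \<open>Vect K\<close> is not again a category of this form, yet cokernels and
  epimorphisms of diagrams are obtained from kernels and monomorphisms in the opposite category over
  the reversed poset. Infinitude of the element type enters through biproducts, where pairs of
  vectors have to be coded as single elements.\<close>

definition op_cat :: "('o, 'm) precat \<Rightarrow> ('o, 'm) precat" where
  "op_cat C = \<lparr>objs = objs C, arrs = (\<lambda>a b. arrs C b a), ident = ident C,
    cmp = (\<lambda>a b c g f. cmp C c b a f g),
    zarr = (\<lambda>a b. zarr C b a), plus_arr = (\<lambda>a b. plus_arr C b a)\<rparr>"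

lemma op_cat_simps [simp]:
  "objs (op_cat C) = objs C" "arrs (op_cat C) a b = arrs C b a" "ident (op_cat C) = ident C"
  "cmp (op_cat C) a b c g f = cmp C c b a f g"
  "zarr (op_cat C) a b = zarr C b a" "plus_arr (op_cat C) a b = plus_arr C b a"
  by (simp_all add: op_cat_def)

lemma is_kernel_op [simp]: "is_kernel (op_cat C) b a f k m = is_cokernel C a b f k m"
  by (simp add: is_kernel_def is_cokernel_def)

lemma is_cokernel_op [simp]: "is_cokernel (op_cat C) b a f k m = is_kernel C a b f k m"
  by (simp add: is_kernel_def is_cokernel_def)

lemma is_mono_op [simp]: "is_mono (op_cat C) b a f = is_epi C a b f"
  by (simp add: is_mono_def is_epi_def)

lemma is_epi_op [simp]: "is_epi (op_cat C) b a f = is_mono C a b f"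
  by (simp add: is_mono_def is_epi_def)

lemma zero_object_op [simp]: "zero_object (op_cat C) z = zero_object C z"
  by (auto simp add: zero_object_def)

lemma is_biproduct_op: "is_biproduct C a b s i j p q \<Longrightarrow> is_biproduct (op_cat C) a b s p q i j"
  by (simp add: is_biproduct_def)

lemma isomorphic_op [simp]: "isomorphic (op_cat C) a b = isomorphic C a b"
  unfolding isomorphic_def by auto

lemma is_kernelD:
  assumes "is_kernel C a b f k m"
  shows "k \<in> objs C" "m \<in> arrs C k a" "cmp C k a b f m = zarr C k b"
  using assms unfolding is_kernel_def by auto

lemma is_kernel_lift:
  assumes "is_kernel C a b f k m" "c \<in> objs C" "g \<in> arrs C c a" "cmp C c a b f g = zarr C c b"
  obtains h where "h \<in> arrs C c k" "cmp C c k a m h = g"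
  using assms unfolding is_kernel_def by (metis (full_types))

lemma is_cokernelD:
  assumes "is_cokernel C a b f k m"
  shows "k \<in> objs C" "m \<in> arrs C b k" "cmp C a b k m f = zarr C a k"
  using assms unfolding is_cokernel_def by auto

lemma is_cokernel_desc:
  assumes "is_cokernel C a b f k m" "c \<in> objs C" "g \<in> arrs C b c" "cmp C a b c g f = zarr C a c"
  obtains h where "h \<in> arrs C k c" "cmp C b k c h m = g"
  using assms unfolding is_cokernel_def by (metis (full_types))

lemma is_monoD:
  assumes "is_mono C a b f" "c \<in> objs C" "g \<in> arrs C c a" "h \<in> arrs C c a"
    "cmp C c a b f g = cmp C c a b f h"
  shows "g = h"
  using assms unfolding is_mono_def by auto

context cat
begin

lemma cat_op: "cat (op_cat C)"
  by unfold_locales (simp_all add: ident_arr cmp_arr cmp_ident_right cmp_ident_left cmp_assoc)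

lemma isomorphic_refl: "a \<in> objs C \<Longrightarrow> isomorphic C a a"
  unfolding isomorphic_def using ident_arr cmp_ident_right by blast

text \<open>Reassociation brings \<open>g'\<close> next to \<open>g\<close>. The cases needed are
  the two composites in \<open>isomorphic_trans\<close> and the two summands of a transported
  biproduct.\<close>

lemma cmp_cancel_mid:
  assumes "a \<in> objs C" "b \<in> objs C" "c \<in> objs C" "d \<in> objs C" "f \<in> arrs C a b" "g \<in> arrs C b c"
    "g' \<in> arrs C c b" "cmp C b c b g' g = ident C b" "h \<in> arrs C b d"
  shows "cmp C a c d (cmp C c b d h g') (cmp C a b c g f) = cmp C a b d h f"
proof -
  have "cmp C b c d (cmp C c b d h g') g = h"
    using assms cmp_assoc[of b c b d g g' h] by (simp add: cmp_ident_right)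
  then show ?thesis using assms by (simp add: cmp_assoc cmp_arr)
qed

lemma isomorphic_trans:
  assumes "isomorphic C a b" "isomorphic C b c"
  shows "isomorphic C a c"
proof -
  obtain f f' where f: "f \<in> arrs C a b" "f' \<in> arrs C b a"
    "cmp C a b a f' f = ident C a" "cmp C b a b f f' = ident C b"
    using assms(1) unfolding isomorphic_def by blast
  obtain g g' where g: "g \<in> arrs C b c" "g' \<in> arrs C c b"
    "cmp C b c b g' g = ident C b" "cmp C c b c g g' = ident C c"
    using assms(2) unfolding isomorphic_def by blast
  have o: "a \<in> objs C" "b \<in> objs C" "c \<in> objs C" using assms unfolding isomorphic_def by auto
  have "cmp C a c a (cmp C c b a f' g') (cmp C a b c g f) = ident C a"
    using cmp_cancel_mid[of a b c a f g g' f'] f g o by simp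
  moreover have "cmp C c a c (cmp C a b c g f) (cmp C c b a f' g') = ident C c"
    using cmp_cancel_mid[of c b a c g' f' f g] f g o by simp
  ultimately show ?thesis unfolding isomorphic_def using f g o cmp_arr by blast
qed

end

context preadditive_category
begin

lemma hom_group: "\<lbrakk>a \<in> objs C; b \<in> objs C\<rbrakk>
    \<Longrightarrow> group \<lparr>carrier = arrs C a b, mult = plus_arr C a b, one = zarr C a b\<rparr>"
  using arrs_comm_group by (simp add: comm_group_def)

lemma zarr_arr: "\<lbrakk>a \<in> objs C; b \<in> objs C\<rbrakk> \<Longrightarrow> zarr C a b \<in> arrs C a b"
  using group.is_monoid[OF hom_group, of a b] monoid.one_closed by fastforce

lemma plus_arr_closed: "\<lbrakk>a \<in> objs C; b \<in> objs C; f \<in> arrs C a b; g \<in> arrs C a b\<rbrakk>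
    \<Longrightarrow> plus_arr C a b f g \<in> arrs C a b"
  using monoid.m_closed[OF group.is_monoid[OF hom_group, of a b]] by fastforce

lemma plus_arr_zero_left: "\<lbrakk>a \<in> objs C; b \<in> objs C; f \<in> arrs C a b\<rbrakk>
    \<Longrightarrow> plus_arr C a b (zarr C a b) f = f"
  using monoid.l_one[OF group.is_monoid[OF hom_group, of a b]] by fastforce

lemma plus_arr_zero_right: "\<lbrakk>a \<in> objs C; b \<in> objs C; f \<in> arrs C a b\<rbrakk>
    \<Longrightarrow> plus_arr C a b f (zarr C a b) = f"
  using monoid.r_one[OF group.is_monoid[OF hom_group, of a b]] by fastforce

lemma plus_arr_neg: "\<lbrakk>a \<in> objs C; b \<in> objs C; f \<in> arrs C a b\<rbrakk>
    \<Longrightarrow> \<exists>g \<in> arrs C a b. plus_arr C a b f g = zarr C a b"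
  using group.r_inv[OF hom_group, of a b f] group.inv_closed[OF hom_group, of a b f] by auto

lemma plus_arr_right_cancel: "\<lbrakk>a \<in> objs C; b \<in> objs C; f \<in> arrs C a b; g \<in> arrs C a b;
    h \<in> arrs C a b\<rbrakk> \<Longrightarrow> plus_arr C a b f h = plus_arr C a b g h \<longleftrightarrow> f = g"
  using group.right_cancel[OF hom_group, of a b h f g] by auto

lemma plus_arr_assoc: "\<lbrakk>a \<in> objs C; b \<in> objs C; f \<in> arrs C a b; g \<in> arrs C a b;
    h \<in> arrs C a b\<rbrakk> \<Longrightarrow> plus_arr C a b (plus_arr C a b f g) h = plus_arr C a b f (plus_arr C a b g h)"
  using monoid.m_assoc[OF group.is_monoid[OF hom_group, of a b], of f g h] by auto

lemma plus_arr_comm: "\<lbrakk>a \<in> objs C; b \<in> objs C; f \<in> arrs C a b; g \<in> arrs C a b\<rbrakk>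
    \<Longrightarrow> plus_arr C a b f g = plus_arr C a b g f"
  using comm_monoid.m_comm[OF comm_group.axioms(1)[OF arrs_comm_group], of a b f g] by auto

lemma preadditive_op: "preadditive_category (op_cat C)"
  unfolding preadditive_category_def preadditive_category_axioms_def
  using arrs_comm_group cmp_plus_left cmp_plus_right cat_op by auto

lemma cmp_zero_right:
  assumes "a \<in> objs C" "b \<in> objs C" "c \<in> objs C" "g \<in> arrs C b c"
  shows "cmp C a b c g (zarr C a b) = zarr C a c"
proof -
  let ?z = "cmp C a b c g (zarr C a b)"
  \<comment> \<open>Bilinearity gives \<open>?z + ?z = 0 + ?z\<close>, and one copy of
    \<open>?z\<close> can be cancelled.\<close>
  have "plus_arr C a c ?z ?z = cmp C a b c g (plus_arr C a b (zarr C a b) (zarr C a b))"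
    using assms by (simp add: cmp_plus_right zarr_arr)
  also have "\<dots> = plus_arr C a c (zarr C a c) ?z"
    using assms by (simp add: plus_arr_zero_left zarr_arr cmp_arr)
  finally show ?thesis
    using plus_arr_right_cancel[of a c ?z "zarr C a c" ?z] assms by (simp add: zarr_arr cmp_arr)
qed

lemma cmp_zero_left:
  "\<lbrakk>a \<in> objs C; b \<in> objs C; c \<in> objs C; f \<in> arrs C a b\<rbrakk>
    \<Longrightarrow> cmp C a b c (zarr C b c) f = zarr C a c"
  using preadditive_category.cmp_zero_right[OF preadditive_op, of c b a f] by simp

text \<open>Kernels are monic, as \<open>u\<close> and \<open>v\<close> solve the same lifting
  problem. Identities between maps induced on kernels are checked below by composing with
  \<open>m\<close> and cancelling.\<close>

lemma is_kernel_cancel: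
  assumes "is_kernel C a b f k m" "a \<in> objs C" "b \<in> objs C" "c \<in> objs C" "f \<in> arrs C a b"
    "u \<in> arrs C c k" "v \<in> arrs C c k" "cmp C c k a m u = cmp C c k a m v"
  shows "u = v"
proof -
  have k: "k \<in> objs C" "m \<in> arrs C k a" "cmp C k a b f m = zarr C k b"
    using is_kernelD[OF assms(1)] by auto
  have "cmp C c a b f (cmp C c k a m u) = zarr C c b"
    using assms k by (simp add: cmp_assoc cmp_zero_left)
  then have "\<exists>!h. h \<in> arrs C c k \<and> cmp C c k a m h = cmp C c k a m u"
    using assms(1,4,6) k cmp_arr assms(2) unfolding is_kernel_def by blast
  then show ?thesis using assms by metis
qed

text \<open>Additivity reduces testing pairs of arrows to testing one: \<open>n\<close> below is a
  negative of \<open>h\<close>, and the assumption is applied to \<open>g + n\<close>.\<close>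

lemma is_monoI:
  assumes o: "a \<in> objs C" "b \<in> objs C" "f \<in> arrs C a b"
    and f: "\<And>c g. \<lbrakk>c \<in> objs C; g \<in> arrs C c a; cmp C c a b f g = zarr C c b\<rbrakk> \<Longrightarrow> g = zarr C c a"
  shows "is_mono C a b f"
  unfolding is_mono_def
proof (intro conjI ballI impI)
  fix c g h
  assume a: "c \<in> objs C" "g \<in> arrs C c a" "h \<in> arrs C c a" "cmp C c a b f g = cmp C c a b f h"
  obtain n where n: "n \<in> arrs C c a" "plus_arr C c a h n = zarr C c a"
    using plus_arr_neg a o by metis
  have "cmp C c a b f (plus_arr C c a g n) = cmp C c a b f (plus_arr C c a h n)"
    using a o n(1) by (simp add: cmp_plus_right)
  then have "plus_arr C c a g n = plus_arr C c a h n"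
    using f[of c "plus_arr C c a g n"] a o n by (simp add: plus_arr_closed cmp_zero_right)
  then show "g = h" using plus_arr_right_cancel[of c a g h n] a o n by simp
qed (use o in simp)

lemma zero_kernel_is_mono:
  assumes "is_kernel C a b f k (zarr C k a)" "a \<in> objs C" "b \<in> objs C" "f \<in> arrs C a b"
  shows "is_mono C a b f"
proof (rule is_monoI)
  fix c g assume g: "c \<in> objs C" "g \<in> arrs C c a" "cmp C c a b f g = zarr C c b"
  then obtain h where "h \<in> arrs C c k" "cmp C c k a (zarr C k a) h = g"
    using is_kernel_lift[OF assms(1)] by blast
  moreover have "k \<in> objs C" using is_kernelD[OF assms(1)] by auto
  ultimately show "g = zarr C c a" using cmp_zero_left[of c k a h] g assms by simp
qed (use assms in auto)

text \<open>Compare \<open>g\<close> with the zero arrow. Applied to the arrow of a kernel, or in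
  the opposite category to that of a cokernel, this makes that arrow vanish; monomorphisms and
  epimorphisms are exploited in this way below.\<close>

lemma mono_zero:
  assumes "is_mono C a b f" "a \<in> objs C" "b \<in> objs C" "c \<in> objs C" "g \<in> arrs C c a"
    "cmp C c a b f g = zarr C c b"
  shows "g = zarr C c a"
proof -
  have "f \<in> arrs C a b" using assms unfolding is_mono_def by auto
  then have "cmp C c a b f g = cmp C c a b f (zarr C c a)" using assms cmp_zero_right by simp
  then show ?thesis using is_monoD[OF assms(1,4,5) zarr_arr] assms by simp
qed

text \<open>Since \<open>g\<close> factors as \<open>u e\<close>, an arrow killed by
  \<open>e\<close> is killed by \<open>g\<close> and therefore lifts. The gain is canonicity: the
  \<open>g\<close> offered by \<open>mono_is_kernel\<close> is unrelated from one point of a poset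
  to the next, while cokernels assemble into a diagram.\<close>

lemma kernel_is_kernel_of_cokernel:
  assumes "is_kernel C b c g a f" "is_cokernel C a b f q e"
    "a \<in> objs C" "b \<in> objs C" "c \<in> objs C" "f \<in> arrs C a b" "g \<in> arrs C b c"
  shows "is_kernel C b q e a f"
proof -
  have q: "q \<in> objs C" "e \<in> arrs C b q" "cmp C a b q e f = zarr C a q"
    using is_cokernelD[OF assms(2)] by auto
  have gf: "cmp C a b c g f = zarr C a c" using assms(1) unfolding is_kernel_def by auto
  obtain u where u: "u \<in> arrs C q c" "cmp C b q c u e = g"
    using is_cokernel_desc[OF assms(2,5,7) gf] by blast
  show ?thesis unfolding is_kernel_def
  proof (intro conjI ballI impI)
    fix d t assume t: "d \<in> objs C" "t \<in> arrs C d b" "cmp C d b q e t = zarr C d q"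
    have "cmp C d b c g t = cmp C d q c u (cmp C d b q e t)"
      using cmp_assoc[of d b q c t e u] t(1,2) u q assms by simp
    also have "\<dots> = zarr C d c" using t u q assms by (simp add: cmp_zero_right)
    finally show "\<exists>!h. h \<in> arrs C d a \<and> cmp C d a b f h = t"
      using assms(1) t unfolding is_kernel_def by blast
  qed (use assms q in auto)
qed

lemma is_kernel_unique:
  assumes "is_kernel C a b f k m" "is_kernel C a b f k' m'" "a \<in> objs C" "b \<in> objs C" "f \<in> arrs C a b"
  shows "isomorphic C k k'"
proof -
  have k: "k \<in> objs C" "m \<in> arrs C k a" "cmp C k a b f m = zarr C k b"
    using is_kernelD[OF assms(1)] by auto
  have k': "k' \<in> objs C" "m' \<in> arrs C k' a" "cmp C k' a b f m' = zarr C k' b"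
    using is_kernelD[OF assms(2)] by auto
  obtain h where h: "h \<in> arrs C k k'" "cmp C k k' a m' h = m"
    using is_kernel_lift[OF assms(2) k] by blast
  obtain h' where h': "h' \<in> arrs C k' k" "cmp C k' k a m h' = m'"
    using is_kernel_lift[OF assms(1) k'] by blast
  have "cmp C k k' k h' h = ident C k"
  proof (rule is_kernel_cancel[OF assms(1,3,4) k(1) assms(5)])
    show "cmp C k k a m (cmp C k k' k h' h) = cmp C k k a m (ident C k)"
      using h h' k k' assms by (simp add: cmp_assoc cmp_ident_right)
  qed (use h h' k k' cmp_arr ident_arr in auto)
  moreover have "cmp C k' k k' h h' = ident C k'"
  proof (rule is_kernel_cancel[OF assms(2,3,4) k'(1) assms(5)])
    show "cmp C k' k' a m' (cmp C k' k k' h h') = cmp C k' k' a m' (ident C k')"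
      using h h' k k' assms by (simp add: cmp_assoc cmp_ident_right)
  qed (use h h' k k' cmp_arr ident_arr in auto)
  ultimately show ?thesis unfolding isomorphic_def using h h' k k' by blast
qed

text \<open>The kernel object stays put and only its arrow is composed with \<open>u\<close>. A test
  arrow \<open>g\<close> into \<open>a'\<close> is brought back to \<open>u' g\<close>; composing
  with \<open>v\<close> reflects zero because \<open>v'\<close> is a left inverse.\<close>

lemma is_kernel_transport:
  assumes "is_kernel C a b f k m"
    and o: "a \<in> objs C" "b \<in> objs C" "a' \<in> objs C" "b' \<in> objs C" "f \<in> arrs C a b" "f' \<in> arrs C a' b'"
    and u: "u \<in> arrs C a a'" "u' \<in> arrs C a' a" "cmp C a a' a u' u = ident C a"
      "cmp C a' a a' u u' = ident C a'"
    and v: "v \<in> arrs C b b'" "v' \<in> arrs C b' b" "cmp C b b' b v' v = ident C b"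
    and sq: "cmp C a b b' v f = cmp C a a' b' f' u"
  shows "is_kernel C a' b' f' k (cmp C k a a' u m)"
proof -
  have k: "k \<in> objs C" "m \<in> arrs C k a" "cmp C k a b f m = zarr C k b"
    using is_kernelD[OF assms(1)] by auto
  note arrs = o u(1,2) v(1,2) k(1,2)
  show ?thesis unfolding is_kernel_def
  proof (intro conjI ballI impI)
    have "cmp C k a' b' f' (cmp C k a a' u m) = cmp C k b b' v (cmp C k a b f m)"
      using arrs by (simp add: cmp_assoc sq)
    then show "cmp C k a' b' f' (cmp C k a a' u m) = zarr C k b'"
      using arrs by (simp add: k(3) cmp_zero_right)
  next
    fix c g assume g: "c \<in> objs C" "g \<in> arrs C c a'" "cmp C c a' b' f' g = zarr C c b'"
    let ?g = "cmp C c a' a u' g"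
    have ug: "cmp C c a a' u ?g = g" using g arrs by (simp add: cmp_assoc u(4) cmp_ident_left)
    have "cmp C c b b' v (cmp C c a b f ?g) = cmp C c a' b' f' (cmp C c a a' u ?g)"
      using g(1,2) arrs sq by (simp add: cmp_assoc cmp_arr)
    then have "cmp C c b b' v (cmp C c a b f ?g) = zarr C c b'" unfolding ug using g by simp
    then have "cmp C c b' b v' (cmp C c b b' v (cmp C c a b f ?g)) = zarr C c b"
      using g(1,2) arrs by (simp add: cmp_zero_right)
    moreover have "cmp C c b' b v' (cmp C c b b' v (cmp C c a b f ?g)) = cmp C c a b f ?g"
      using g(1,2) arrs v(3) cmp_assoc[of c b b' b "cmp C c a b f ?g" v v']
      by (simp add: cmp_arr cmp_ident_left)
    ultimately have "cmp C c a b f ?g = zarr C c b" by simp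
    then obtain h where h: "h \<in> arrs C c k" "cmp C c k a m h = ?g"
      using is_kernel_lift[OF assms(1) g(1), of ?g] g(1,2) arrs by (auto simp add: cmp_arr)
    show "\<exists>!h. h \<in> arrs C c k \<and> cmp C c k a' (cmp C k a a' u m) h = g"
    proof (intro ex1I conjI)
      show "h \<in> arrs C c k" by fact
      show "cmp C c k a' (cmp C k a a' u m) h = g"
        using h g(1,2) arrs cmp_assoc[of c k a a' h m u] ug by simp
    next
      fix h' assume h': "h' \<in> arrs C c k \<and> cmp C c k a' (cmp C k a a' u m) h' = g"
      have "cmp C c k a m h' = cmp C c a' a u' (cmp C c a a' u (cmp C c k a m h'))"
        using h' g(1,2) arrs cmp_assoc[of c a a' a "cmp C c k a m h'" u u'] u(3)
        by (simp add: cmp_arr cmp_ident_left)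
      also have "cmp C c a a' u (cmp C c k a m h') = g"
        using h' g(1,2) arrs cmp_assoc[of c k a a' h' m u] by simp
      finally have "cmp C c k a m h' = cmp C c k a m h" using h by simp
      then show "h' = h" using is_kernel_cancel[OF assms(1)] arrs g h h' by blast
    qed
  qed (use arrs cmp_arr in auto)
qed

lemma is_cokernel_unique:
  assumes "is_cokernel C a b f k m" "is_cokernel C a b f k' m'" "a \<in> objs C" "b \<in> objs C"
    "f \<in> arrs C a b"
  shows "isomorphic C k k'"
  using preadditive_category.is_kernel_unique[OF preadditive_op, of b a f k m k' m'] assms by simp

lemma is_cokernel_transport:
  assumes "is_cokernel C a b f k m"
    and "a \<in> objs C" "b \<in> objs C" "a' \<in> objs C" "b' \<in> objs C" "f \<in> arrs C a b" "f' \<in> arrs C a' b'"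
    and "u \<in> arrs C a a'" "u' \<in> arrs C a' a" "cmp C a a' a u' u = ident C a"
    and "v \<in> arrs C b b'" "v' \<in> arrs C b' b" "cmp C b b' b v' v = ident C b"
      "cmp C b' b b' v v' = ident C b'"
    and "cmp C a' a b f u' = cmp C a' b' b v' f'"
  shows "is_cokernel C a' b' f' k (cmp C b' b k m v')"
  using preadditive_category.is_kernel_transport[OF preadditive_op, of b a f k m b' a' f' v' v u' u]
    assms by simp

lemma is_biproduct_transport:
  assumes "is_biproduct C a b s i j p q"
    and o: "a \<in> objs C" "b \<in> objs C" "a' \<in> objs C" "b' \<in> objs C"
    and u: "u \<in> arrs C a a'" "u' \<in> arrs C a' a" "cmp C a a' a u' u = ident C a"
      "cmp C a' a a' u u' = ident C a'"
    and v: "v \<in> arrs C b b'" "v' \<in> arrs C b' b" "cmp C b b' b v' v = ident C b"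
      "cmp C b' b b' v v' = ident C b'"
  shows "is_biproduct C a' b' s (cmp C a' a s i u') (cmp C b' b s j v')
    (cmp C s a a' u p) (cmp C s b b' v q)"
proof -
  have s: "s \<in> objs C" "i \<in> arrs C a s" "j \<in> arrs C b s" "p \<in> arrs C s a" "q \<in> arrs C s b"
    and e: "cmp C a s a p i = ident C a" "cmp C b s b q j = ident C b"
    "cmp C b s a p j = zarr C b a" "cmp C a s b q i = zarr C a b"
    "plus_arr C s s (cmp C s a s i p) (cmp C s b s j q) = ident C s"
    using assms(1) unfolding is_biproduct_def by auto
  note arrs = o u(1,2) v(1,2) s
  \<comment> \<open>Apart from the sum, every equation of the transported biproduct has this
    sandwiched shape.\<close>
  have conj: "cmp C x' s y' (cmp C s y y' w pr) (cmp C x' x s inj w')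
      = cmp C x' y y' w (cmp C x' x y (cmp C x s y pr inj) w')"
    if "x \<in> objs C" "x' \<in> objs C" "y \<in> objs C" "y' \<in> objs C" "inj \<in> arrs C x s" "pr \<in> arrs C s y"
      "w \<in> arrs C y y'" "w' \<in> arrs C x' x" for x x' y y' inj pr w w'
    using that arrs by (simp add: cmp_assoc cmp_arr)
  show ?thesis unfolding is_biproduct_def
    using arrs by (simp add: cmp_arr conj e u v cmp_ident_left cmp_ident_right
        cmp_zero_left cmp_zero_right cmp_cancel_mid)
qed

end

context abelian_category
begin

lemma abelian_op: "abelian_category (op_cat C)"
proof -
  interpret op: preadditive_category "op_cat C" by (rule preadditive_op)
  show ?thesis
  proof
    fix a b assume "a \<in> objs (op_cat C)" "b \<in> objs (op_cat C)"
    then show "\<exists>s i j p q. is_biproduct (op_cat C) a b s i j p q"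
      using ex_biproduct[of a b] is_biproduct_op by (metis op_cat_simps(1))
  qed (use ex_zero_object ex_kernel ex_cokernel mono_is_kernel epi_is_cokernel in auto)
qed

lemma mono_is_kernel_of_cokernel:
  assumes "is_mono C a b f" "is_cokernel C a b f q e" "a \<in> objs C" "b \<in> objs C"
  shows "is_kernel C b q e a f"
proof -
  obtain c g where c: "c \<in> objs C" "g \<in> arrs C b c" "is_kernel C b c g a f"
    using mono_is_kernel assms by blast
  moreover have "f \<in> arrs C a b" using assms unfolding is_mono_def by auto
  ultimately show ?thesis using kernel_is_kernel_of_cokernel assms by blast
qed

end

lemma full_subcategory_simps [simp]:
  "objs (full_subcategory A T) = T" "arrs (full_subcategory A T) = arrs A"
  "ident (full_subcategory A T) = ident A" "cmp (full_subcategory A T) = cmp A"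
  "zarr (full_subcategory A T) = zarr A" "plus_arr (full_subcategory A T) = plus_arr A"
  by (simp_all add: full_subcategory_def)

text \<open>Group laws and composition laws are inherited, and the condition on a zero object only
  weakens when fewer objects are tested. What remains to be supplied is that a zero object and
  biproducts can be found inside \<open>T\<close>.\<close>

lemma (in preadditive_category) additive_full_subcategory:
  assumes T: "T \<subseteq> objs C" and z: "z \<in> T" "zero_object C z"
    and bi: "\<And>a b. \<lbrakk>a \<in> T; b \<in> T\<rbrakk> \<Longrightarrow> \<exists>s \<in> T. \<exists>i j p q. is_biproduct C a b s i j p q"
  shows "additive_category (full_subcategory C T)"
proof -
  have T': "a \<in> objs C" if "a \<in> T" for a using T that by blast
  have "preadditive_category (full_subcategory C T)"
    by (intro preadditive_category.intro preadditive_category_axioms.intro cat.intro)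
      (simp_all add: T' ident_arr cmp_arr cmp_ident_right cmp_ident_left cmp_assoc
        arrs_comm_group cmp_plus_left cmp_plus_right)
  moreover have "zero_object (full_subcategory C T) z"
    using z T' unfolding zero_object_def by simp
  moreover have "\<exists>s i j p q. is_biproduct (full_subcategory C T) a b s i j p q"
    if ab: "a \<in> T" "b \<in> T" for a b
  proof -
    obtain s i j p q where s: "s \<in> T" "is_biproduct C a b s i j p q" using bi[OF ab] by blast
    then have "is_biproduct (full_subcategory C T) a b s i j p q"
      unfolding is_biproduct_def by simp
    then show ?thesis by blast
  qed
  ultimately show ?thesis
    unfolding additive_category_def additive_category_axioms_def by (auto simp del: full_subcategory_simps(2-))
qed


section \<open>Diagrams in an abelian category\<close>

lemma partial_order_onD:
  assumes "partial_order_on P r"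
  shows "(p, q) \<in> r \<Longrightarrow> p \<in> P" "(p, q) \<in> r \<Longrightarrow> q \<in> P" "p \<in> P \<Longrightarrow> (p, p) \<in> r"
    "\<lbrakk>(p, q) \<in> r; (q, t) \<in> r\<rbrakk> \<Longrightarrow> (p, t) \<in> r"
    "\<lbrakk>(p, q) \<in> r; (q, p) \<in> r\<rbrakk> \<Longrightarrow> p = q"
  using assms
  by (auto simp: partial_order_on_def preorder_on_def refl_on_def antisym_def dest: transD)

lemma functor_category_objs [simp]: "M \<in> objs (functor_category P r C) \<longleftrightarrow> is_functor P r C M"
  by (simp add: functor_category_def)

lemma functor_category_arrs: "\<eta> \<in> arrs (functor_category P r C) M N \<longleftrightarrow>
    \<eta> \<in> (\<Pi>\<^sub>E p \<in> P. arrs C (dobj M p) (dobj N p)) \<and>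
    (\<forall>p q. (p, q) \<in> r \<longrightarrow>
        cmp C (dobj M p) (dobj N p) (dobj N q) (dmap N p q) (\<eta> p)
        = cmp C (dobj M p) (dobj M q) (dobj N q) (\<eta> q) (dmap M p q))"
  by (simp add: functor_category_def)

lemma functor_category_simps [simp]:
  "ident (functor_category P r C) M = (\<lambda>p \<in> P. ident C (dobj M p))"
  "cmp (functor_category P r C) L M N g f
    = (\<lambda>p \<in> P. cmp C (dobj L p) (dobj M p) (dobj N p) (g p) (f p))"
  "zarr (functor_category P r C) M N = (\<lambda>p \<in> P. zarr C (dobj M p) (dobj N p))"
  "plus_arr (functor_category P r C) M N f g
    = (\<lambda>p \<in> P. plus_arr C (dobj M p) (dobj N p) (f p) (g p))"
  by (simp_all add: functor_category_def)

lemma functor_category_arr_at: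
  "\<lbrakk>\<eta> \<in> arrs (functor_category P r C) M N; p \<in> P\<rbrakk> \<Longrightarrow> \<eta> p \<in> arrs C (dobj M p) (dobj N p)"
  by (auto simp: functor_category_arrs)

lemma functor_category_arr_natural:
  "\<lbrakk>\<eta> \<in> arrs (functor_category P r C) M N; (p, q) \<in> r\<rbrakk> \<Longrightarrow>
    cmp C (dobj M p) (dobj N p) (dobj N q) (dmap N p q) (\<eta> p)
    = cmp C (dobj M p) (dobj M q) (dobj N q) (\<eta> q) (dmap M p q)"
  by (simp add: functor_category_arrs)

lemma functor_category_arr_eqI:
  "\<lbrakk>\<eta> \<in> arrs (functor_category P r C) M N; \<theta> \<in> arrs (functor_category P r C) M' N';
    \<And>p. p \<in> P \<Longrightarrow> \<eta> p = \<theta> p\<rbrakk> \<Longrightarrow> \<eta> = \<theta>"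
  by (auto simp: functor_category_arrs PiE_def intro: extensionalityI)

lemma is_functorD:
  assumes "is_functor P r C M"
  shows "p \<in> P \<Longrightarrow> dobj M p \<in> objs C"
    "(p, q) \<in> r \<Longrightarrow> dmap M p q \<in> arrs C (dobj M p) (dobj M q)"
    "p \<in> P \<Longrightarrow> dmap M p p = ident C (dobj M p)"
    "\<lbrakk>(p, q) \<in> r; (q, s) \<in> r\<rbrakk> \<Longrightarrow>
      cmp C (dobj M p) (dobj M q) (dobj M s) (dmap M q s) (dmap M p q) = dmap M p s"
  using assms unfolding is_functor_def by auto

text \<open>A functor from \<open>P\<close> to \<open>C\<close> is the same data as a functor from
  the reversed poset to the opposite category, with natural transformations running backwards. Under
  this identification statements on kernels of diagrams become statements on cokernels.\<close>

definition op_diagram :: "('p, 'o, 'm) diagram \<Rightarrow> ('p, 'o, 'm) diagram" where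
  "op_diagram M = \<lparr>dobj = dobj M, dmap = (\<lambda>p q. dmap M q p)\<rparr>"

lemma op_diagram_simps [simp]:
  "dobj (op_diagram M) = dobj M" "dmap (op_diagram M) p q = dmap M q p"
  "op_diagram (op_diagram M) = M"
  by (simp_all add: op_diagram_def)

lemma is_functor_op [simp]:
  "is_functor P (r\<inverse>) (op_cat C) (op_diagram M) \<longleftrightarrow> is_functor P r C M"
  unfolding is_functor_def by (simp; blast)

lemma functor_category_arrs_op [simp]:
  "\<eta> \<in> arrs (functor_category P (r\<inverse>) (op_cat C)) (op_diagram N) (op_diagram M)
    \<longleftrightarrow> \<eta> \<in> arrs (functor_category P r C) M N"
  by (auto simp: functor_category_arrs)

text \<open>\<open>op_diagram\<close> is an involution, hence surjective. Rewriting with it brings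
  the test objects of a universal property in the dual category into the form
  \<open>op_diagram M\<close>.\<close>

lemma all_op_diagram: "(\<forall>M. \<Phi> M) \<longleftrightarrow> (\<forall>M. \<Phi> (op_diagram M))"
  by (metis op_diagram_simps(3))

lemma is_cokernel_functor_category_op:
  "is_cokernel (functor_category P r C) a b f k m \<longleftrightarrow>
   is_kernel (functor_category P (r\<inverse>) (op_cat C)) (op_diagram b) (op_diagram a) f (op_diagram k) m"
  unfolding is_kernel_def is_cokernel_def Ball_def
  by (subst (2) all_op_diagram) simp

lemma is_epi_functor_category_op:
  "is_epi (functor_category P r C) a b f \<longleftrightarrow>
   is_mono (functor_category P (r\<inverse>) (op_cat C)) (op_diagram b) (op_diagram a) f"
  unfolding is_mono_def is_epi_def Ball_def
  by (subst (2) all_op_diagram) simp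

lemma (in cat) is_functor_const:
  "z \<in> objs C \<Longrightarrow> is_functor Q s C \<lparr>dobj = (\<lambda>p. z), dmap = (\<lambda>p q. ident C z)\<rparr>"
  unfolding is_functor_def by (simp add: ident_arr cmp_ident_left)

locale abelian_diagrams = abelian_category C for C :: "('o, 'm) precat" +
  fixes P :: "'p set" and r :: "'p rel"
  assumes po: "partial_order_on P r"
begin

abbreviation "D \<equiv> functor_category P r C"

lemmas poD = partial_order_onD[OF po]

lemma diagrams_op: "abelian_diagrams (op_cat C) P (r\<inverse>)"
  by (simp add: abelian_diagrams_def abelian_diagrams_axioms_def abelian_op po)

section \<open>Preadditive structure on diagrams\<close>

lemma D_cat: "cat D"
proof
  fix M assume M: "M \<in> objs D"
  then have M: "is_functor P r C M" by simp
  show "ident D M \<in> arrs D M M"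
    using is_functorD[OF M] poD(1,2)
    by (auto simp: functor_category_arrs ident_arr cmp_ident_left cmp_ident_right)
next
  fix L M N f g
  assume o: "L \<in> objs D" "M \<in> objs D" "N \<in> objs D" and f: "f \<in> arrs D L M" and g: "g \<in> arrs D M N"
  then have L: "is_functor P r C L" and M: "is_functor P r C M" and N: "is_functor P r C N" by auto
  note F = is_functorD[OF L] is_functorD[OF M] is_functorD[OF N]
    functor_category_arr_at[OF f] functor_category_arr_at[OF g]
  show "cmp D L M N g f \<in> arrs D L N"
    unfolding functor_category_arrs
  proof (intro conjI allI impI)
    fix p q assume pq: "(p, q) \<in> r"
    then have p: "p \<in> P" "q \<in> P" using poD by auto
    have "cmp C (dobj L p) (dobj N p) (dobj N q) (dmap N p q)
        (cmp C (dobj L p) (dobj M p) (dobj N p) (g p) (f p))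
      = cmp C (dobj L p) (dobj M p) (dobj N q)
        (cmp C (dobj M p) (dobj N p) (dobj N q) (dmap N p q) (g p)) (f p)"
      using F p pq by (simp add: cmp_assoc)
    also have "\<dots> = cmp C (dobj L p) (dobj M q) (dobj N q) (g q)
        (cmp C (dobj L p) (dobj M p) (dobj M q) (dmap M p q) (f p))"
      using F p pq functor_category_arr_natural[OF g pq] by (simp add: cmp_assoc)
    also have "\<dots> = cmp C (dobj L p) (dobj L q) (dobj N q)
        (cmp C (dobj L q) (dobj M q) (dobj N q) (g q) (f q)) (dmap L p q)"
      unfolding functor_category_arr_natural[OF f pq] using F p pq by (simp add: cmp_assoc)
    finally show "cmp C (dobj L p) (dobj N p) (dobj N q) (dmap N p q) (cmp D L M N g f p) =
       cmp C (dobj L p) (dobj L q) (dobj N q) (cmp D L M N g f q) (dmap L p q)"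
      using p by simp
  qed (use F cmp_arr in auto)
next
  fix M N f assume o: "M \<in> objs D" "N \<in> objs D" and f: "f \<in> arrs D M N"
  then have M: "is_functor P r C M" and N: "is_functor P r C N" by auto
  note F = is_functorD[OF M] is_functorD[OF N] functor_category_arr_at[OF f]
  have e: "f \<in> extensional P" using f by (auto simp: functor_category_arrs PiE_def)
  show "cmp D M M N f (ident D M) = f"
    using F e by (intro extensionalityI[of _ P]) (auto simp: cmp_ident_right)
  show "cmp D M N N (ident D N) f = f"
    using F e by (intro extensionalityI[of _ P]) (auto simp: cmp_ident_left)
next
  fix K L M N f g h
  assume o: "K \<in> objs D" "L \<in> objs D" "M \<in> objs D" "N \<in> objs D"
    and f: "f \<in> arrs D K L" and g: "g \<in> arrs D L M" and h: "h \<in> arrs D M N"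
  then show "cmp D K M N h (cmp D K L M g f) = cmp D K L N (cmp D L M N h g) f"
    using functor_category_arr_at[OF f] functor_category_arr_at[OF g] functor_category_arr_at[OF h]
    by (auto simp: is_functorD(1) cmp_assoc intro!: restrict_ext)
qed

lemma D_zarr: "\<lbrakk>is_functor P r C M; is_functor P r C N\<rbrakk> \<Longrightarrow> zarr D M N \<in> arrs D M N"
  by (auto simp: functor_category_arrs poD zarr_arr cmp_zero_left cmp_zero_right is_functorD)

lemma D_plus:
  assumes M: "is_functor P r C M" and N: "is_functor P r C N"
    and f: "f \<in> arrs D M N" and g: "g \<in> arrs D M N"
  shows "plus_arr D M N f g \<in> arrs D M N"
proof -
  note F = is_functorD[OF M] is_functorD[OF N] functor_category_arr_at[OF f]
    functor_category_arr_at[OF g] functor_category_arr_natural[OF f] functor_category_arr_natural[OF g]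
  show ?thesis unfolding functor_category_arrs
    using F poD(1,2) by (auto simp: plus_arr_closed cmp_plus_left cmp_plus_right)
qed

lemma D_neg:
  assumes M: "is_functor P r C M" and N: "is_functor P r C N" and f: "f \<in> arrs D M N"
  shows "\<exists>g \<in> arrs D M N. plus_arr D M N g f = zarr D M N"
proof -
  note F = is_functorD[OF M] is_functorD[OF N] functor_category_arr_at[OF f]
  \<comment> \<open>The record stores no negation, so negatives are chosen point by point and their
    naturality has to be derived.\<close>
  define \<nu> where "\<nu> p = (SOME g. g \<in> arrs C (dobj M p) (dobj N p) \<and>
    plus_arr C (dobj M p) (dobj N p) (f p) g = zarr C (dobj M p) (dobj N p))" for p
  have \<nu>: "\<nu> p \<in> arrs C (dobj M p) (dobj N p)"
    "plus_arr C (dobj M p) (dobj N p) (f p) (\<nu> p) = zarr C (dobj M p) (dobj N p)" if "p \<in> P" for p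
    using someI_ex[of "\<lambda>g. g \<in> arrs C (dobj M p) (dobj N p) \<and>
      plus_arr C (dobj M p) (dobj N p) (f p) g = zarr C (dobj M p) (dobj N p)"]
      plus_arr_neg[of "dobj M p" "dobj N p" "f p"] F that unfolding \<nu>_def by auto
  have "restrict \<nu> P \<in> arrs D M N"
    unfolding functor_category_arrs
  proof (intro conjI allI impI)
    fix p q assume pq: "(p, q) \<in> r"
    then have p: "p \<in> P" "q \<in> P" using poD by auto
    let ?l = "cmp C (dobj M p) (dobj N p) (dobj N q) (dmap N p q)"
    let ?r = "\<lambda>h. cmp C (dobj M p) (dobj M q) (dobj N q) h (dmap M p q)"
    \<comment> \<open>Both \<open>?l (\<nu> p)\<close> and \<open>?r (\<nu> q)\<close> are negatives
      of the same arrow \<open>?l (f p) = ?r (f q)\<close>, so cancellation identifies them.\<close>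
    have "plus_arr C (dobj M p) (dobj N q) (?l (\<nu> p)) (?l (f p))
      = ?l (plus_arr C (dobj M p) (dobj N p) (f p) (\<nu> p))"
      using F p pq \<nu>(1) by (simp add: cmp_plus_right cmp_arr plus_arr_comm)
    also have "\<dots> = ?r (plus_arr C (dobj M q) (dobj N q) (f q) (\<nu> q))"
      using F p pq \<nu> by (simp add: cmp_zero_left cmp_zero_right)
    also have "\<dots> = plus_arr C (dobj M p) (dobj N q) (?r (\<nu> q)) (?l (f p))"
      unfolding functor_category_arr_natural[OF f pq]
      using F p pq \<nu>(1) by (simp add: cmp_plus_left cmp_arr plus_arr_comm)
    finally have "?l (\<nu> p) = ?r (\<nu> q)"
      using plus_arr_right_cancel[of "dobj M p" "dobj N q" "?l (\<nu> p)" "?r (\<nu> q)" "?l (f p)"]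
        F p pq \<nu>(1) cmp_arr by simp
    then show "?l (restrict \<nu> P p) = ?r (restrict \<nu> P q)" using p by simp
  qed (use \<nu> in auto)
  moreover have "plus_arr D M N (restrict \<nu> P) f = zarr D M N"
    using \<nu> F by (auto simp: plus_arr_comm intro!: restrict_ext)
  ultimately show ?thesis by blast
qed

lemma D_preadditive: "preadditive_category D"
proof -
  show ?thesis
  proof (intro preadditive_category.intro preadditive_category_axioms.intro D_cat)
    fix M N assume "M \<in> objs D" "N \<in> objs D"
    then have M: "is_functor P r C M" and N: "is_functor P r C N" by auto
    have e: "f \<in> extensional P" if "f \<in> arrs D M N" for f
      using that by (auto simp: functor_category_arrs PiE_def)
    show "comm_group \<lparr>carrier = arrs D M N, mult = plus_arr D M N, one = zarr D M N\<rparr>"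
    proof (rule comm_groupI, goal_cases)
      case (1 f g) then show ?case using D_plus M N by (simp del: functor_category_simps)
    next
      case 2 then show ?case using D_zarr M N by (simp del: functor_category_simps)
    next
      case (3 f g h)
      then show ?case
        using is_functorD(1)[OF M] is_functorD(1)[OF N] functor_category_arr_at[of _ P r C M N]
        by (auto simp: plus_arr_assoc intro!: restrict_ext)
    next
      case (4 f g)
      then show ?case
        using is_functorD(1)[OF M] is_functorD(1)[OF N] functor_category_arr_at[of _ P r C M N]
        by (auto simp: plus_arr_comm intro!: restrict_ext)
    next
      case (5 f)
      then show ?case
        using is_functorD(1)[OF M] is_functorD(1)[OF N] functor_category_arr_at[of _ P r C M N] e
        by (auto simp: plus_arr_zero_left intro!: extensionalityI[of _ P])
    next
      case (6 f) then show ?case using D_neg[OF M N] by (simp del: functor_category_simps)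
    qed
  next
    fix L M N f f' g
    assume "L \<in> objs D" "M \<in> objs D" "N \<in> objs D" and f: "f \<in> arrs D L M" and f': "f' \<in> arrs D L M"
      and g: "g \<in> arrs D M N"
    then show "cmp D L M N g (plus_arr D L M f f') = plus_arr D L N (cmp D L M N g f) (cmp D L M N g f')"
      using functor_category_arr_at[OF f] functor_category_arr_at[OF f'] functor_category_arr_at[OF g]
      by (auto simp: cmp_plus_right is_functorD(1) intro!: restrict_ext)
  next
    fix L M N f g g'
    assume "L \<in> objs D" "M \<in> objs D" "N \<in> objs D" and f: "f \<in> arrs D L M" and g: "g \<in> arrs D M N"
      and g': "g' \<in> arrs D M N"
    then show "cmp D L M N (plus_arr D M N g g') f = plus_arr D L N (cmp D L M N g f) (cmp D L M N g' f)"
      using functor_category_arr_at[OF f] functor_category_arr_at[OF g'] functor_category_arr_at[OF g]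
      by (auto simp: cmp_plus_left is_functorD(1) intro!: restrict_ext)
  qed
qed

section \<open>Kernels and cokernels of diagrams, computed pointwise\<close>

lemma kernel_pointwiseI:
  assumes a: "is_functor P r C a" and b: "is_functor P r C b" and f: "f \<in> arrs D a b"
    and k: "is_functor P r C k" and m: "m \<in> arrs D k a"
    and ker: "\<And>p. p \<in> P \<Longrightarrow> is_kernel C (dobj a p) (dobj b p) (f p) (dobj k p) (m p)"
  shows "is_kernel D a b f k m"
  unfolding is_kernel_def
proof (intro conjI ballI impI)
  show "cmp D k a b f m = zarr D k b" using is_kernelD(3)[OF ker] by (auto intro!: restrict_ext)
next
  note F = is_functorD[OF a] is_functorD[OF b] is_functorD[OF k] functor_category_arr_at[OF f]
    functor_category_arr_at[OF m]
  fix c g assume "c \<in> objs D" and g: "g \<in> arrs D c a" and z: "cmp D c a b f g = zarr D c b"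
  then have c: "is_functor P r C c" by simp
  have "\<exists>h. h \<in> arrs C (dobj c p) (dobj k p) \<and>
      cmp C (dobj c p) (dobj k p) (dobj a p) (m p) h = g p" if p: "p \<in> P" for p
    using is_kernel_lift[OF ker[OF p] is_functorD(1)[OF c p] functor_category_arr_at[OF g p]]
      p fun_cong[OF z, of p] by auto
  then obtain h where h: "\<And>p. p \<in> P \<Longrightarrow> h p \<in> arrs C (dobj c p) (dobj k p)"
    "\<And>p. p \<in> P \<Longrightarrow> cmp C (dobj c p) (dobj k p) (dobj a p) (m p) (h p) = g p"
    by metis
  note F = F is_functorD[OF c] functor_category_arr_at[OF g] h(1)
  have "restrict h P \<in> arrs D c k"
    unfolding functor_category_arrs
  proof (intro conjI allI impI)
    fix p q assume pq: "(p, q) \<in> r"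
    then have p: "p \<in> P" "q \<in> P" using poD by auto
    \<comment> \<open>Naturality of the lifts is forced: both sides agree after composition with the
      monic \<open>m q\<close>, by naturality of \<open>m\<close> and of \<open>g\<close>.\<close>
    have "cmp C (dobj c p) (dobj k p) (dobj k q) (dmap k p q) (h p)
        = cmp C (dobj c p) (dobj c q) (dobj k q) (h q) (dmap c p q)"
    proof (rule is_kernel_cancel[OF ker[OF p(2)]])
      have "cmp C (dobj c p) (dobj k q) (dobj a q) (m q)
          (cmp C (dobj c p) (dobj k p) (dobj k q) (dmap k p q) (h p))
        = cmp C (dobj c p) (dobj a p) (dobj a q) (dmap a p q)
          (cmp C (dobj c p) (dobj k p) (dobj a p) (m p) (h p))"
        using F p pq functor_category_arr_natural[OF m pq] by (simp add: cmp_assoc)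
      also have "\<dots> = cmp C (dobj c p) (dobj c q) (dobj a q) 
          (cmp C (dobj c q) (dobj k q) (dobj a q) (m q) (h q)) (dmap c p q)"
        using functor_category_arr_natural[OF g pq] p by (simp add: h(2))
      also have "\<dots> = cmp C (dobj c p) (dobj k q) (dobj a q) (m q)
          (cmp C (dobj c p) (dobj c q) (dobj k q) (h q) (dmap c p q))"
        using F p pq by (simp add: cmp_assoc)
      finally show "cmp C (dobj c p) (dobj k q) (dobj a q) (m q)
          (cmp C (dobj c p) (dobj k p) (dobj k q) (dmap k p q) (h p)) =
        cmp C (dobj c p) (dobj k q) (dobj a q) (m q)
          (cmp C (dobj c p) (dobj c q) (dobj k q) (h q) (dmap c p q))" .
    qed (simp_all add: F p pq cmp_arr)
    then show "cmp C (dobj c p) (dobj k p) (dobj k q) (dmap k p q) (restrict h P p)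
        = cmp C (dobj c p) (dobj c q) (dobj k q) (restrict h P q) (dmap c p q)"
      using p by simp
  qed (use h in auto)
  moreover have "cmp D c k a m (restrict h P) = g"
    using g h by (intro extensionalityI[of _ P]) (auto simp: functor_category_arrs PiE_def)
  moreover have "h' = restrict h P" if h': "h' \<in> arrs D c k" "cmp D c k a m h' = g" for h'
  proof (rule extensionalityI[of _ P])
    fix p assume p: "p \<in> P"
    have "h' p = h p"
    proof (rule is_kernel_cancel[OF ker[OF p], of "dobj c p"])
      show "cmp C (dobj c p) (dobj k p) (dobj a p) (m p) (h' p)
          = cmp C (dobj c p) (dobj k p) (dobj a p) (m p) (h p)"
        using p h(2) fun_cong[OF h'(2), of p] by simp
    qed (simp_all add: F p functor_category_arr_at[OF h'(1)])
    then show "h' p = restrict h P p" using p by simp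
  qed (use h' in \<open>auto simp: functor_category_arrs PiE_def\<close>)
  ultimately show "\<exists>!h. h \<in> arrs D c k \<and> cmp D c k a m h = g" by blast
qed (use k m in auto)

lemma cokernel_pointwiseI:
  assumes "is_functor P r C a" "is_functor P r C b" "f \<in> arrs D a b"
    and "is_functor P r C k" "m \<in> arrs D b k"
    and "\<And>p. p \<in> P \<Longrightarrow> is_cokernel C (dobj a p) (dobj b p) (f p) (dobj k p) (m p)"
  shows "is_cokernel D a b f k m"
proof -
  interpret op: abelian_diagrams "op_cat C" P "r\<inverse>" by (rule diagrams_op)
  show ?thesis unfolding is_cokernel_functor_category_op
    by (rule op.kernel_pointwiseI) (simp_all add: assms)
qed

text \<open>The objects \<open>K\<close> are prescribed so that a caller can keep all values in a
  given class, such as the finite-dimensional spaces. The transition maps of \<open>a\<close>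
  restrict to the kernels since \<open>f\<close> is natural, and functoriality follows because each
  \<open>m q\<close> is monic.\<close>

lemma ex_pointwise_kernel:
  assumes a: "is_functor P r C a" and b: "is_functor P r C b" and f: "f \<in> arrs D a b"
    and ker: "\<And>p. p \<in> P \<Longrightarrow> is_kernel C (dobj a p) (dobj b p) (f p) (K p) (m p)"
  obtains k where "is_functor P r C k" "dobj k = K" "restrict m P \<in> arrs D k a"
proof -
  note F = is_functorD[OF a] is_functorD[OF b] functor_category_arr_at[OF f]
    is_kernelD(1,2)[OF ker]
  define \<kappa> where "\<kappa> p q = (SOME h. h \<in> arrs C (K p) (K q) \<and>
      cmp C (K p) (K q) (dobj a q) (m q) h = cmp C (K p) (dobj a p) (dobj a q) (dmap a p q) (m p))"
    for p q
  have \<kappa>: "\<kappa> p q \<in> arrs C (K p) (K q)" "cmp C (K p) (K q) (dobj a q) (m q) (\<kappa> p q)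
      = cmp C (K p) (dobj a p) (dobj a q) (dmap a p q) (m p)" if pq: "(p, q) \<in> r" for p q
  proof -
    have p: "p \<in> P" "q \<in> P" using pq poD by auto
    have "cmp C (K p) (dobj a q) (dobj b q) (f q)
        (cmp C (K p) (dobj a p) (dobj a q) (dmap a p q) (m p))
      = cmp C (K p) (dobj b p) (dobj b q) (dmap b p q)
        (cmp C (K p) (dobj a p) (dobj b p) (f p) (m p))"
      using F p pq functor_category_arr_natural[OF f pq] by (simp add: cmp_assoc)
    then have "cmp C (K p) (dobj a q) (dobj b q) (f q)
        (cmp C (K p) (dobj a p) (dobj a q) (dmap a p q) (m p)) = zarr C (K p) (dobj b q)"
      using F p pq is_kernelD(3)[OF ker[OF p(1)]] by (simp add: cmp_zero_right)
    then have "\<exists>h. h \<in> arrs C (K p) (K q) \<and>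
      cmp C (K p) (K q) (dobj a q) (m q) h = cmp C (K p) (dobj a p) (dobj a q) (dmap a p q) (m p)"
      using is_kernel_lift[OF ker[OF p(2)], of "K p"] F p pq cmp_arr by metis
    then show "\<kappa> p q \<in> arrs C (K p) (K q)" "cmp C (K p) (K q) (dobj a q) (m q) (\<kappa> p q)
      = cmp C (K p) (dobj a p) (dobj a q) (dmap a p q) (m p)"
      unfolding \<kappa>_def by (metis (mono_tags, lifting) someI_ex)+
  qed
  define k where "k = \<lparr>dobj = K, dmap = \<kappa>\<rparr>"
  have "is_functor P r C k"
    unfolding is_functor_def k_def diagram.simps
  proof (intro conjI ballI allI impI)
    fix p assume p: "p \<in> P"
    then have pp: "(p, p) \<in> r" using poD by auto
    show "\<kappa> p p = ident C (K p)"
    proof (rule is_kernel_cancel[OF ker[OF p], of "K p"])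
      show "cmp C (K p) (K p) (dobj a p) (m p) (\<kappa> p p)
          = cmp C (K p) (K p) (dobj a p) (m p) (ident C (K p))"
        using F p pp by (simp add: \<kappa> cmp_ident_left cmp_ident_right)
    qed (simp_all add: F p pp \<kappa> ident_arr)
  next
    fix p q s assume pq: "(p, q) \<in> r" and qs: "(q, s) \<in> r"
    then have p: "p \<in> P" "q \<in> P" "s \<in> P" and ps: "(p, s) \<in> r" using poD by blast+
    show "\<kappa> p s = cmp C (K p) (K q) (K s) (\<kappa> q s) (\<kappa> p q)"
    proof (rule is_kernel_cancel[OF ker[OF p(3)], of "K p"])
      have "cmp C (K p) (K s) (dobj a s) (m s) (cmp C (K p) (K q) (K s) (\<kappa> q s) (\<kappa> p q))
        = cmp C (K p) (dobj a q) (dobj a s) (dmap a q s)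
            (cmp C (K p) (K q) (dobj a q) (m q) (\<kappa> p q))"
        using F p pq qs \<kappa>(1)[OF pq] \<kappa>[OF qs] by (simp add: cmp_assoc)
      also have "\<dots> = cmp C (K p) (dobj a p) (dobj a s) (dmap a p s) (m p)"
        using F p pq qs \<kappa>[OF pq] by (simp add: cmp_assoc)
      finally show "cmp C (K p) (K s) (dobj a s) (m s) (\<kappa> p s)
        = cmp C (K p) (K s) (dobj a s) (m s) (cmp C (K p) (K q) (K s) (\<kappa> q s) (\<kappa> p q))"
        using \<kappa>[OF ps] by simp
    qed (simp_all add: F p \<kappa> pq qs ps cmp_arr)
  qed (use F \<kappa> in auto)
  moreover have "restrict m P \<in> arrs D k a"
    unfolding functor_category_arrs k_def using F \<kappa>(2) poD(1,2) by auto
  ultimately show ?thesis using that[of k] by (simp add: k_def)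
qed

lemma D_ex_kernel:
  assumes a: "is_functor P r C a" and b: "is_functor P r C b" and f: "f \<in> arrs D a b"
    and K: "\<And>p. p \<in> P \<Longrightarrow> \<exists>m. is_kernel C (dobj a p) (dobj b p) (f p) (K p) m"
  obtains k m where "is_kernel D a b f k m" "dobj k = K"
    "\<And>p. p \<in> P \<Longrightarrow> is_kernel C (dobj a p) (dobj b p) (f p) (dobj k p) (m p)"
proof -
  obtain m where m: "\<And>p. p \<in> P \<Longrightarrow> is_kernel C (dobj a p) (dobj b p) (f p) (K p) (m p)"
    using K by metis
  obtain k where k: "is_functor P r C k" "dobj k = K" "restrict m P \<in> arrs D k a"
    using ex_pointwise_kernel[OF a b f m] by blast
  have "is_kernel D a b f k (restrict m P)"
    using m k by (intro kernel_pointwiseI[OF a b f]) auto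
  then show ?thesis using that[of k "restrict m P"] k m by auto
qed

lemma D_ex_cokernel:
  assumes a: "is_functor P r C a" and b: "is_functor P r C b" and f: "f \<in> arrs D a b"
    and K: "\<And>p. p \<in> P \<Longrightarrow> \<exists>m. is_cokernel C (dobj a p) (dobj b p) (f p) (K p) m"
  obtains k m where "is_cokernel D a b f k m" "dobj k = K"
    "\<And>p. p \<in> P \<Longrightarrow> is_cokernel C (dobj a p) (dobj b p) (f p) (dobj k p) (m p)"
proof -
  interpret op: abelian_diagrams "op_cat C" P "r\<inverse>" by (rule diagrams_op)
  obtain k m where k: "is_kernel op.D (op_diagram b) (op_diagram a) f k m" "dobj k = K"
    "\<And>p. p \<in> P \<Longrightarrow> is_kernel (op_cat C) (dobj b p) (dobj a p) (f p) (dobj k p) (m p)"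
    using op.D_ex_kernel[of "op_diagram b" "op_diagram a" f K] assms by auto
  have "is_cokernel D a b f (op_diagram k) m"
    unfolding is_cokernel_functor_category_op by (simp add: k(1))
  then show ?thesis using that[of "op_diagram k" m] k by auto
qed

lemma D_kernel_exists:
  assumes "is_functor P r C a" "is_functor P r C b" "f \<in> arrs D a b"
  obtains k m where "is_kernel D a b f k m" 
    "\<And>p. p \<in> P \<Longrightarrow> is_kernel C (dobj a p) (dobj b p) (f p) (dobj k p) (m p)"
proof -
  have "\<forall>p\<in>P. \<exists>k m. is_kernel C (dobj a p) (dobj b p) (f p) k m"
    using ex_kernel is_functorD(1)[OF assms(1)] is_functorD(1)[OF assms(2)]
      functor_category_arr_at[OF assms(3)] by blast
  then obtain K where "\<And>p. p \<in> P \<Longrightarrow> \<exists>m. is_kernel C (dobj a p) (dobj b p) (f p) (K p) m"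
    by metis
  then show ?thesis using D_ex_kernel[OF assms] that by metis
qed

lemma D_cokernel_exists:
  assumes "is_functor P r C a" "is_functor P r C b" "f \<in> arrs D a b"
  obtains k m where "is_cokernel D a b f k m" 
    "\<And>p. p \<in> P \<Longrightarrow> is_cokernel C (dobj a p) (dobj b p) (f p) (dobj k p) (m p)"
proof -
  have "\<forall>p\<in>P. \<exists>k m. is_cokernel C (dobj a p) (dobj b p) (f p) k m"
    using ex_cokernel is_functorD(1)[OF assms(1)] is_functorD(1)[OF assms(2)]
      functor_category_arr_at[OF assms(3)] by blast
  then obtain K where "\<And>p. p \<in> P \<Longrightarrow> \<exists>m. is_cokernel C (dobj a p) (dobj b p) (f p) (K p) m"
    by metis
  then show ?thesis using D_ex_cokernel[OF assms] that by metis
qed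

text \<open>Arrows into \<open>dobj a p\<close> need not extend to diagrams, so
  \<open>is_mono D\<close> cannot be tested against them directly. It can be tested against the
  kernel diagram: the arrow \<open>m\<close> vanishes, and its value at \<open>p\<close> is a kernel
  of \<open>f p\<close>.\<close>

lemma D_mono_pointwise:
  assumes "is_mono D a b f" and a: "is_functor P r C a" and b: "is_functor P r C b" and p: "p \<in> P"
  shows "is_mono C (dobj a p) (dobj b p) (f p)"
proof -
  interpret D: preadditive_category D by (rule D_preadditive)
  have f: "f \<in> arrs D a b" using assms unfolding is_mono_def by auto
  obtain k m where k: "is_kernel D a b f k m"
    "\<And>p. p \<in> P \<Longrightarrow> is_kernel C (dobj a p) (dobj b p) (f p) (dobj k p) (m p)"
    using D_kernel_exists[OF a b f] by metis
  have "m = zarr D k a" using D.mono_zero[OF assms(1)] a b is_kernelD[OF k(1)] by simp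
  then have "is_kernel C (dobj a p) (dobj b p) (f p) (dobj k p) (zarr C (dobj k p) (dobj a p))"
    using k(2)[OF p] p by simp
  then show ?thesis
    using zero_kernel_is_mono is_functorD(1)[OF a p] is_functorD(1)[OF b p]
      functor_category_arr_at[OF f p] by blast
qed

text \<open>Monicity holds at each point, so at each point \<open>f\<close> is the kernel of its
  cokernel. The cokernels form a diagram, and pointwise kernels are kernels in
  \<open>D\<close>.\<close>

lemma D_mono_is_kernel:
  assumes "is_mono D a b f" and a: "is_functor P r C a" and b: "is_functor P r C b"
  shows "\<exists>c \<in> objs D. \<exists>g \<in> arrs D b c. is_kernel D b c g a f"
proof -
  have f: "f \<in> arrs D a b" using assms unfolding is_mono_def by auto
  obtain c g where c: "is_cokernel D a b f c g"
    "\<And>p. p \<in> P \<Longrightarrow> is_cokernel C (dobj a p) (dobj b p) (f p) (dobj c p) (g p)"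
    using D_cokernel_exists[OF a b f] by metis
  have "is_kernel C (dobj b p) (dobj c p) (g p) (dobj a p) (f p)" if p: "p \<in> P" for p
    using mono_is_kernel_of_cokernel[OF D_mono_pointwise[OF assms p] c(2)[OF p]]
      is_functorD(1)[OF a p] is_functorD(1)[OF b p] by blast
  then have "is_kernel D b c g a f"
    using is_cokernelD[OF c(1)] f a b by (intro kernel_pointwiseI) auto
  then show ?thesis using is_cokernelD[OF c(1)] by blast
qed

section \<open>Biproducts and zero objects of diagrams\<close>

lemma biproduct_pointwiseI:
  assumes M: "is_functor P r C M" and N: "is_functor P r C N"
    and bi: "\<And>p. p \<in> P \<Longrightarrow> is_biproduct C (dobj M p) (dobj N p) (S p) (i p) (j p) (u p) (v p)"
  obtains s where "dobj s = S"
    "is_biproduct D M N s (restrict i P) (restrict j P) (restrict u P) (restrict v P)"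
proof -
  have F: "S p \<in> objs C" "i p \<in> arrs C (dobj M p) (S p)" "j p \<in> arrs C (dobj N p) (S p)"
    "u p \<in> arrs C (S p) (dobj M p)" "v p \<in> arrs C (S p) (dobj N p)"
    "cmp C (dobj M p) (S p) (dobj M p) (u p) (i p) = ident C (dobj M p)"
    "cmp C (dobj N p) (S p) (dobj N p) (v p) (j p) = ident C (dobj N p)"
    "cmp C (dobj N p) (S p) (dobj M p) (u p) (j p) = zarr C (dobj N p) (dobj M p)"
    "cmp C (dobj M p) (S p) (dobj N p) (v p) (i p) = zarr C (dobj M p) (dobj N p)"
    "plus_arr C (S p) (S p) (cmp C (S p) (dobj M p) (S p) (i p) (u p))
      (cmp C (S p) (dobj N p) (S p) (j p) (v p)) = ident C (S p)" if "p \<in> P" for p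
    using bi[OF that] unfolding is_biproduct_def by auto
  note F = F is_functorD[OF M] is_functorD[OF N]
  \<comment> \<open>\<open>x\<close> and \<open>y\<close> are the diagonal blocks of the transition
    map of the sum: project, move inside \<open>M\<close> or \<open>N\<close>, include again. The
    transition map is \<open>x + y\<close>, and it is functorial because the mixed products of
    blocks vanish.\<close>
  define x where "x p q = cmp C (S p) (dobj M q) (S q) (i q)
    (cmp C (S p) (dobj M p) (dobj M q) (dmap M p q) (u p))" for p q
  define y where "y p q = cmp C (S p) (dobj N q) (S q) (j q)
    (cmp C (S p) (dobj N p) (dobj N q) (dmap N p q) (v p))" for p q
  have xy: "x p q \<in> arrs C (S p) (S q)" "y p q \<in> arrs C (S p) (S q)" if "(p, q) \<in> r" for p q
    using F that poD(1,2)[OF that] unfolding x_def y_def by (simp_all add: cmp_arr)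
  have ux: "cmp C (S p) (S q) (dobj M q) (u q) (x p q)
      = cmp C (S p) (dobj M p) (dobj M q) (dmap M p q) (u p)"
    and vx: "cmp C (S p) (S q) (dobj N q) (v q) (x p q) = zarr C (S p) (dobj N q)"
    and uy: "cmp C (S p) (S q) (dobj M q) (u q) (y p q) = zarr C (S p) (dobj M q)"
    and vy: "cmp C (S p) (S q) (dobj N q) (v q) (y p q)
      = cmp C (S p) (dobj N p) (dobj N q) (dmap N p q) (v p)"
    and xi: "cmp C (dobj M p) (S p) (S q) (x p q) (i p)
      = cmp C (dobj M p) (dobj M q) (S q) (i q) (dmap M p q)"
    and xj: "cmp C (dobj N p) (S p) (S q) (x p q) (j p) = zarr C (dobj N p) (S q)"
    and yi: "cmp C (dobj M p) (S p) (S q) (y p q) (i p) = zarr C (dobj M p) (S q)"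
    and yj: "cmp C (dobj N p) (S p) (S q) (y p q) (j p)
      = cmp C (dobj N p) (dobj N q) (S q) (j q) (dmap N p q)"
    if pq: "(p, q) \<in> r" for p q
  proof -
    have p: "p \<in> P" "q \<in> P" using pq poD by auto
    show "cmp C (S p) (S q) (dobj M q) (u q) (x p q)
        = cmp C (S p) (dobj M p) (dobj M q) (dmap M p q) (u p)"
      "cmp C (S p) (S q) (dobj N q) (v q) (x p q) = zarr C (S p) (dobj N q)"
      "cmp C (S p) (S q) (dobj M q) (u q) (y p q) = zarr C (S p) (dobj M q)"
      "cmp C (S p) (S q) (dobj N q) (v q) (y p q)
        = cmp C (S p) (dobj N p) (dobj N q) (dmap N p q) (v p)"
      unfolding x_def y_def
      using F p pq by (simp_all add: cmp_assoc cmp_arr cmp_ident_left cmp_zero_left)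
    show "cmp C (dobj M p) (S p) (S q) (x p q) (i p)
        = cmp C (dobj M p) (dobj M q) (S q) (i q) (dmap M p q)"
      "cmp C (dobj N p) (S p) (S q) (x p q) (j p) = zarr C (dobj N p) (S q)"
      "cmp C (dobj M p) (S p) (S q) (y p q) (i p) = zarr C (dobj M p) (S q)"
      "cmp C (dobj N p) (S p) (S q) (y p q) (j p)
        = cmp C (dobj N p) (dobj N q) (S q) (j q) (dmap N p q)"
      unfolding x_def y_def
      using F p pq
      by (simp_all add: cmp_assoc[symmetric] cmp_arr cmp_ident_right cmp_zero_right)
  qed
  define s where "s = \<lparr>dobj = S, dmap = (\<lambda>p q. plus_arr C (S p) (S q) (x p q) (y p q))\<rparr>"
  have "is_functor P r C s"
    unfolding is_functor_def s_def diagram.simps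
  proof (intro conjI ballI allI impI)
    fix p assume p: "p \<in> P"
    then show "plus_arr C (S p) (S p) (x p p) (y p p) = ident C (S p)"
      unfolding x_def y_def using F by (simp add: cmp_ident_left cmp_ident_right)
  next
    fix p q t assume pq: "(p, q) \<in> r" and qt: "(q, t) \<in> r"
    then have p: "p \<in> P" "q \<in> P" "t \<in> P" and pt: "(p, t) \<in> r" using poD by blast+
    have *: "cmp C (S p) (S q) (S t) (x q t) (x p q) = x p t"
      "cmp C (S p) (S q) (S t) (y q t) (y p q) = y p t"
      "cmp C (S p) (S q) (S t) (x q t) (y p q) = zarr C (S p) (S t)"
      "cmp C (S p) (S q) (S t) (y q t) (x p q) = zarr C (S p) (S t)"
    proof -
      have MN: "cmp C (S p) (dobj M q) (dobj M t) (dmap M q t)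
          (cmp C (S p) (dobj M p) (dobj M q) (dmap M p q) (u p))
        = cmp C (S p) (dobj M p) (dobj M t) (dmap M p t) (u p)"
        "cmp C (S p) (dobj N q) (dobj N t) (dmap N q t)
          (cmp C (S p) (dobj N p) (dobj N q) (dmap N p q) (v p))
        = cmp C (S p) (dobj N p) (dobj N t) (dmap N p t) (v p)"
        using F p pq qt by (simp_all add: cmp_assoc)
      show "cmp C (S p) (S q) (S t) (x q t) (x p q) = x p t"
        "cmp C (S p) (S q) (S t) (y q t) (y p q) = y p t"
        "cmp C (S p) (S q) (S t) (x q t) (y p q) = zarr C (S p) (S t)"
        "cmp C (S p) (S q) (S t) (y q t) (x p q) = zarr C (S p) (S t)"
        unfolding x_def[of q t] y_def[of q t] x_def[of p t] y_def[of p t]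
        using F p qt xy[OF pq]
        by (simp_all add: cmp_assoc[symmetric] cmp_arr ux[OF pq] vx[OF pq] uy[OF pq] vy[OF pq]
            MN cmp_zero_right)
    qed
    show "plus_arr C (S p) (S t) (x p t) (y p t)
        = cmp C (S p) (S q) (S t) (plus_arr C (S q) (S t) (x q t) (y q t))
          (plus_arr C (S p) (S q) (x p q) (y p q))"
      using F p xy[OF pq] xy[OF qt] xy[OF pt] *
      by (simp add: cmp_plus_left cmp_plus_right plus_arr_closed plus_arr_zero_left plus_arr_zero_right)
  qed (use F xy plus_arr_closed poD(1,2) in auto)
  moreover have "restrict i P \<in> arrs D M s" "restrict j P \<in> arrs D N s"
    "restrict u P \<in> arrs D s M" "restrict v P \<in> arrs D s N"
    unfolding functor_category_arrs s_def using F poD(1,2) xy ux vx uy vy xi xj yi yj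
    by (auto simp: cmp_plus_left cmp_plus_right plus_arr_zero_left plus_arr_zero_right cmp_arr)
  ultimately have "is_biproduct D M N s (restrict i P) (restrict j P) (restrict u P) (restrict v P)"
    unfolding is_biproduct_def using F by (auto simp: s_def intro!: restrict_ext)
  then show ?thesis using that[of s] by (simp add: s_def)
qed

lemma zero_object_functor_category:
  assumes "zero_object C z"
  shows "zero_object D \<lparr>dobj = (\<lambda>p. z), dmap = (\<lambda>p q. ident C z)\<rparr>"
    (is "zero_object D ?z")
proof -
  have z: "z \<in> objs C" using assms unfolding zero_object_def by auto
  have u: "f = g" if "a \<in> objs C" "f \<in> arrs C a z" "g \<in> arrs C a z" for f g a
    using assms that unfolding zero_object_def by blast
  have u': "f = g" if "a \<in> objs C" "f \<in> arrs C z a" "g \<in> arrs C z a" for f g a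
    using assms that unfolding zero_object_def by blast
  have zf: "is_functor P r C ?z" by (rule is_functor_const[OF z])
  show ?thesis unfolding zero_object_def
  proof (intro conjI ballI)
    fix a assume "a \<in> objs D"
    then have a: "is_functor P r C a" by simp
    show "\<exists>!f. f \<in> arrs D a ?z"
    proof (rule ex1I[of _ "zarr D a ?z"])
      show "zarr D a ?z \<in> arrs D a ?z" by (rule D_zarr[OF a zf])
      fix f assume f: "f \<in> arrs D a ?z"
      show "f = zarr D a ?z"
        using functor_category_arr_at[OF f] is_functorD(1)[OF a] z zarr_arr
        by (intro functor_category_arr_eqI[OF f D_zarr[OF a zf]]) (auto intro!: u[OF is_functorD(1)[OF a]])
    qed
    show "\<exists>!f. f \<in> arrs D ?z a"
    proof (rule ex1I[of _ "zarr D ?z a"])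
      show "zarr D ?z a \<in> arrs D ?z a" by (rule D_zarr[OF zf a])
      fix f assume f: "f \<in> arrs D ?z a"
      show "f = zarr D ?z a"
        using functor_category_arr_at[OF f] is_functorD(1)[OF a] z zarr_arr
        by (intro functor_category_arr_eqI[OF f D_zarr[OF zf a]]) (auto intro!: u'[OF is_functorD(1)[OF a]])
    qed
  qed (use zf in simp)
qed

theorem D_abelian: "abelian_category D"
proof -
  interpret D: preadditive_category D by (rule D_preadditive)
  interpret op: abelian_diagrams "op_cat C" P "r\<inverse>" by (rule diagrams_op)
  show ?thesis
  proof
    show "\<exists>z. zero_object D z" using zero_object_functor_category ex_zero_object by blast
  next
    fix M N assume "M \<in> objs D" "N \<in> objs D"
    then have M: "is_functor P r C M" and N: "is_functor P r C N" by auto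
    have "\<forall>p\<in>P. \<exists>s i j u v. is_biproduct C (dobj M p) (dobj N p) s i j u v"
      using ex_biproduct is_functorD(1)[OF M] is_functorD(1)[OF N] by blast
    then obtain S i j u v where
      "\<And>p. p \<in> P \<Longrightarrow> is_biproduct C (dobj M p) (dobj N p) (S p) (i p) (j p) (u p) (v p)" by metis
    from biproduct_pointwiseI[OF M N this] show "\<exists>s i j u v. is_biproduct D M N s i j u v" by metis
  next
    fix a b f assume "a \<in> objs D" "b \<in> objs D" "f \<in> arrs D a b"
    then have ab: "is_functor P r C a" "is_functor P r C b" "f \<in> arrs D a b" by auto
    show "\<exists>k m. is_kernel D a b f k m" using D_kernel_exists[OF ab] by metis
    show "\<exists>k m. is_cokernel D a b f k m" using D_cokernel_exists[OF ab] by metis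
  next
    fix a b f assume "a \<in> objs D" "b \<in> objs D" "is_mono D a b f"
    then show "\<exists>c \<in> objs D. \<exists>g \<in> arrs D b c. is_kernel D b c g a f" by (intro D_mono_is_kernel) auto
  next
    fix a b f assume "a \<in> objs D" "b \<in> objs D" "is_epi D a b f"
    \<comment> \<open>An epimorphism of diagrams is a monomorphism in the opposite category over the
      reversed poset, which is again an instance of \<open>abelian_diagrams\<close>.\<close>
    then have "\<exists>c \<in> objs op.D. \<exists>g \<in> arrs op.D (op_diagram a) c.
        is_kernel op.D (op_diagram a) c g (op_diagram b) f"
      by (intro op.D_mono_is_kernel) (auto simp: is_epi_functor_category_op)
    then obtain c g where c: "c \<in> objs op.D" "g \<in> arrs op.D (op_diagram a) c"
        "is_kernel op.D (op_diagram a) c g (op_diagram b) f" by blast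
    define c' where "c' = op_diagram c"
    have c': "c = op_diagram c'" by (simp add: c'_def)
    show "\<exists>c \<in> objs D. \<exists>g \<in> arrs D c a. is_cokernel D c a g b f"
      using c unfolding c' by (auto simp: is_cokernel_functor_category_op)
  qed
qed

end

section \<open>Pullback of diagrams\<close>

lemma poset_mapD:
  assumes "poset_map P r Q s e"
  shows "p \<in> P \<Longrightarrow> e p \<in> Q" "\<lbrakk>p \<in> P; q \<in> P; (p, q) \<in> r\<rbrakk> \<Longrightarrow> (e p, e q) \<in> s"
  using assms by (auto simp: poset_map_def monotone_on_def)

lemma pullback_simps [simp]:
  "dobj (pullback e M) p = dobj M (e p)" "dmap (pullback e M) p q = dmap M (e p) (e q)"
  by (simp_all add: pullback_def)

lemma is_functor_pullback:
  assumes "is_functor Q s C M" "poset_map P r Q s e" "partial_order_on P r"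
  shows "is_functor P r C (pullback e M)"
  unfolding is_functor_def
  by (auto simp: is_functorD[OF assms(1)] poset_mapD[OF assms(2)] partial_order_onD(1,2)[OF assms(3)])

lemma pullback_arr:
  assumes "F \<in> arrs (functor_category Q s C) M N" "poset_map P r Q s e" "partial_order_on P r"
  shows "(\<lambda>p\<in>P. F (e p)) \<in> arrs (functor_category P r C) (pullback e M) (pullback e N)"
  unfolding functor_category_arrs
  using functor_category_arr_at[OF assms(1)] functor_category_arr_natural[OF assms(1)]
    poset_mapD[OF assms(2)] partial_order_onD(1,2)[OF assms(3)]
  by auto

text \<open>A biproduct consists of equations between arrows and survives precomposition as it
  stands. A kernel is tested against all diagrams over \<open>P\<close>, which need not be pulled
  back, so kernels are compared pointwise instead.\<close>

lemma pullback_biproduct: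
  assumes bi: "is_biproduct (functor_category Q s C) M N S i j u v"
    and e: "poset_map P r Q s e" and po: "partial_order_on P r"
  shows "is_biproduct (functor_category P r C) (pullback e M) (pullback e N) (pullback e S)
    (\<lambda>p\<in>P. i (e p)) (\<lambda>p\<in>P. j (e p)) (\<lambda>p\<in>P. u (e p)) (\<lambda>p\<in>P. v (e p))"
proof -
  have S: "is_functor Q s C S" and arr: "i \<in> arrs (functor_category Q s C) M S"
    "j \<in> arrs (functor_category Q s C) N S" "u \<in> arrs (functor_category Q s C) S M"
    "v \<in> arrs (functor_category Q s C) S N"
    using bi unfolding is_biproduct_def by auto
  have eq: "cmp C (dobj M q) (dobj S q) (dobj M q) (u q) (i q) = ident C (dobj M q)"
    "cmp C (dobj N q) (dobj S q) (dobj N q) (v q) (j q) = ident C (dobj N q)"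
    "cmp C (dobj N q) (dobj S q) (dobj M q) (u q) (j q) = zarr C (dobj N q) (dobj M q)"
    "cmp C (dobj M q) (dobj S q) (dobj N q) (v q) (i q) = zarr C (dobj M q) (dobj N q)"
    "plus_arr C (dobj S q) (dobj S q) (cmp C (dobj S q) (dobj M q) (dobj S q) (i q) (u q))
      (cmp C (dobj S q) (dobj N q) (dobj S q) (j q) (v q)) = ident C (dobj S q)" if "q \<in> Q" for q
    using bi that unfolding is_biproduct_def functor_category_simps
    by (auto dest!: fun_cong[of _ _ q])
  show ?thesis unfolding is_biproduct_def
    using is_functor_pullback[OF S e po] arr[THEN pullback_arr, OF e po] eq poset_mapD(1)[OF e]
    by (auto intro!: restrict_ext)
qed

text \<open>Diagrams are records of total functions, so pullbacks that coincide over
  \<open>P\<close> can still be unequal as records. The identity transformation is then an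
  isomorphism between them.\<close>

lemma (in abelian_diagrams) isomorphic_agree:
  assumes M: "is_functor P r C M" and "\<And>p. p \<in> P \<Longrightarrow> dobj M p = dobj N p"
    "\<And>p q. (p, q) \<in> r \<Longrightarrow> dmap M p q = dmap N p q"
  shows "isomorphic D M N"
proof -
  have N: "is_functor P r C N"
    unfolding is_functor_def
  proof (intro conjI ballI allI impI)
    fix p assume p: "p \<in> P"
    show "dobj N p \<in> objs C" "dmap N p p = ident C (dobj N p)"
      using is_functorD(1,3)[OF M p] assms(2)[OF p] assms(3)[OF poD(3)[OF p]] by simp_all
  next
    fix p q assume pq: "(p, q) \<in> r"
    show "dmap N p q \<in> arrs C (dobj N p) (dobj N q)"
      using is_functorD(2)[OF M pq] assms(3)[OF pq] assms(2)[OF poD(1)[OF pq]]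
        assms(2)[OF poD(2)[OF pq]] by simp
  next
    fix p q t assume pq: "(p, q) \<in> r" and qt: "(q, t) \<in> r"
    show "dmap N p t = cmp C (dobj N p) (dobj N q) (dobj N t) (dmap N q t) (dmap N p q)"
      using is_functorD(4)[OF M pq qt] assms(3)[OF pq] assms(3)[OF qt] assms(3)[OF poD(4)[OF pq qt]]
        assms(2)[OF poD(1)[OF pq]] assms(2)[OF poD(1)[OF qt]] assms(2)[OF poD(2)[OF qt]] by simp
  qed
  have "ident D M \<in> arrs D M N" "ident D M \<in> arrs D N M"
    unfolding functor_category_arrs
    using is_functorD[OF M] poD(1,2) assms(2,3)
    by (auto simp: ident_arr cmp_ident_left cmp_ident_right)
  moreover have "cmp D M N M (ident D M) (ident D M) = ident D M"
    "cmp D N M N (ident D M) (ident D M) = ident D N"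
    using is_functorD(1)[OF M] assms(2) by (auto simp: ident_arr cmp_ident_left intro!: restrict_ext)
  ultimately show ?thesis unfolding isomorphic_def functor_category_objs using M N by blast
qed

section \<open>Encodable diagrams\<close>

text \<open>\<open>S\<close> stands in for the finite-dimensional spaces, which separates the
  closure argument from linear algebra.\<close>

definition encodable_in ::
  "('o, 'm) precat \<Rightarrow> 'o set \<Rightarrow> 'p set \<Rightarrow> 'p rel \<Rightarrow> 'p set set \<Rightarrow> ('p, 'o, 'm) diagram \<Rightarrow> bool"
where
  "encodable_in C S P r X M \<longleftrightarrow>
    (\<exists>(Q :: nat set) s e M'.
      finite Q \<and> partial_order_on Q s \<and> poset_map P r Q s e \<and>
      (\<forall>q \<in> Q. {p \<in> P. e p = q} \<in> X) \<and>
      is_functor Q s C M' \<and> (\<forall>q \<in> Q. dobj M' q \<in> S) \<and>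
      isomorphic (functor_category P r C) M (pullback e M'))"

text \<open>Encoding posets arise below as sets of subsets of \<open>P\<close>, while the definition
  asks for natural numbers. The injection \<open>\<phi>\<close> renames the points, \<open>g\<close>
  undoes the renaming, and pulling \<open>M'\<close> back along \<open>g\<close> changes the encoded
  diagram only up to isomorphism.\<close>

lemma (in abelian_diagrams) encodable_inI:
  fixes Q :: "'q set"
  assumes Q: "finite Q" "partial_order_on Q s" and e: "poset_map P r Q s e"
    and fib: "\<And>q. q \<in> Q \<Longrightarrow> {p \<in> P. e p = q} \<in> X"
    and M': "is_functor Q s C M'" "\<And>q. q \<in> Q \<Longrightarrow> dobj M' q \<in> S"
    and iso: "isomorphic D M (pullback e M')"
  shows "encodable_in C S P r X M"
proof -
  interpret D: cat D by (rule D_cat)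
  obtain \<phi> :: "'q \<Rightarrow> nat" where \<phi>: "inj_on \<phi> Q" using finite_imp_inj_to_nat_seg[OF Q(1)] by blast
  define g where "g = the_inv_into Q \<phi>"
  have g: "g (\<phi> q) = q" if "q \<in> Q" for q using \<phi> that by (simp add: g_def the_inv_into_f_f)
  define s' where "s' = {(\<phi> a, \<phi> b) | a b. (a, b) \<in> s}"
  note poQ = partial_order_onD[OF Q(2)]
  have po': "partial_order_on (\<phi> ` Q) s'"
    unfolding partial_order_on_def preorder_on_def refl_on_def
  proof (intro conjI ballI)
    fix x assume "x \<in> \<phi> ` Q"
    then show "(x, x) \<in> s'" unfolding s'_def using poQ(3) by blast
  next
    show "trans s'"
      unfolding s'_def trans_def using poQ inj_onD[OF \<phi>] by (clarsimp; metis)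
    show "antisym s'"
      unfolding s'_def antisym_def using poQ inj_onD[OF \<phi>] by (clarsimp; metis)
  qed (use poQ in \<open>auto simp: s'_def\<close>)
  have g_map: "poset_map (\<phi> ` Q) s' Q s g"
    unfolding poset_map_def monotone_on_def
  proof (intro conjI ballI impI)
    fix x y assume "(x, y) \<in> s'"
    then obtain a b where "x = \<phi> a" "y = \<phi> b" "(a, b) \<in> s" by (auto simp: s'_def)
    then show "(g x, g y) \<in> s" using g poQ(1,2) by simp
  qed (use g in auto)
  have e_map: "poset_map P r (\<phi> ` Q) s' (\<phi> \<circ> e)"
    unfolding poset_map_def monotone_on_def s'_def using poset_mapD[OF e] by (auto; blast)
  have "{p \<in> P. (\<phi> \<circ> e) p = q'} \<in> X" if q': "q' \<in> \<phi> ` Q" for q'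
  proof -
    obtain q where q: "q \<in> Q" "q' = \<phi> q" using q' by auto
    have "{p \<in> P. (\<phi> \<circ> e) p = q'} = {p \<in> P. e p = q}"
      using q inj_onD[OF \<phi>] poset_mapD(1)[OF e] by auto
    then show ?thesis using fib q by simp
  qed
  moreover have "isomorphic D (pullback e M') (pullback (\<phi> \<circ> e) (pullback g M'))"
    using poset_mapD(1)[OF e] poD(1,2) g
    by (intro isomorphic_agree is_functor_pullback[OF M'(1) e po]) auto
  then have "isomorphic D M (pullback (\<phi> \<circ> e) (pullback g M'))"
    using iso D.isomorphic_trans by blast
  ultimately show ?thesis
    unfolding encodable_in_def using Q(1) po' e_map is_functor_pullback[OF M'(1) g_map po'] M'(2)
    by (intro exI[of _ "\<phi> ` Q"] exI[of _ s'] exI[of _ "\<phi> \<circ> e"] exI[of _ "pullback g M'"]) (auto simp: g)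
qed

section \<open>Zigzag classes and intersections in an encoding structure\<close>

lemma zigzag_equiv: "equiv S (zigzag r S)"
proof (rule equivI)
  show "refl_on S (zigzag r S)" by (auto simp: zigzag_def refl_on_def)
  show "sym (zigzag r S)"
  proof -
    have "sym (((r \<union> r\<inverse>) \<inter> S \<times> S)\<^sup>*)" by (intro sym_rtrancl) (auto simp: sym_def)
    then show ?thesis by (auto simp: zigzag_def sym_def)
  qed
  show "trans (zigzag r S)" by (auto simp: zigzag_def trans_def)
qed (auto simp: zigzag_def)

text \<open>De Morgan. The fibres of a pair of encodings are intersections of this kind.\<close>

lemma encoding_structure_Int:
  assumes "encoding_structure P r X" "A \<in> X" "B \<in> X"
  shows "A \<inter> B \<in> X"
proof -
  have un: "\<And>F. finite F \<Longrightarrow> F \<subseteq> X \<Longrightarrow> \<Union>F \<in> X" and co: "\<And>A. A \<in> X \<Longrightarrow> P - A \<in> X"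
    and sub: "X \<subseteq> Pow P" using assms(1) unfolding encoding_structure_def by auto
  have "P - \<Union>{P - A, P - B} \<in> X" using assms by (intro co un) (auto intro: co)
  moreover have "P - \<Union>{P - A, P - B} = A \<inter> B" using sub assms by auto
  ultimately show ?thesis by simp
qed

text \<open>It is enough that some kernel, cokernel or biproduct lies in \<open>S\<close>, without
  closure under isomorphism, because the pointwise construction over the encoding poset accepts
  prescribed objects.\<close>

locale finite_objects = abelian_category C for C :: "('o, 'm) precat" +
  fixes S :: "'o set"
  assumes S_objs: "S \<subseteq> objs C"
    and S_zero: "\<exists>z \<in> S. zero_object C z"
    and S_biproduct: "\<lbrakk>a \<in> S; b \<in> S\<rbrakk> \<Longrightarrow> \<exists>s \<in> S. \<exists>i j p q. is_biproduct C a b s i j p q"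
    and S_kernel: "\<lbrakk>a \<in> S; b \<in> S; f \<in> arrs C a b\<rbrakk> \<Longrightarrow> \<exists>k \<in> S. \<exists>m. is_kernel C a b f k m"
    and S_cokernel: "\<lbrakk>a \<in> S; b \<in> S; f \<in> arrs C a b\<rbrakk> \<Longrightarrow> \<exists>k \<in> S. \<exists>m. is_cokernel C a b f k m"

locale connective_encoding = finite_objects C S + abelian_diagrams C P r
  for C :: "('o, 'm) precat" and S and P :: "'p set" and r +
  fixes X :: "'p set set"
  assumes enc: "encoding_structure P r X" and conn: "connective P r X"
begin

sublocale D: preadditive_category D by (rule D_preadditive)

text \<open>The conclusion is shaped for its use: the first of the two final squares carries kernels
  from \<open>f\<close> to the descended \<open>F\<close>, the second carries cokernels. The points
  of the encoding poset are components of fibres of \<open>(e1, e2)\<close>, hence subsets of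
  \<open>P\<close>.\<close>

lemma common_encoding:
  assumes M: "is_functor P r C M" "encodable_in C S P r X M"
    and N: "is_functor P r C N" "encodable_in C S P r X N"
    and f: "f \<in> arrs D M N"
  obtains Q :: "'p set set" and s e M' N' F \<alpha> \<alpha>' \<beta> \<beta>'
    where "finite Q" "partial_order_on Q s" "poset_map P r Q s e"
      "\<And>q. q \<in> Q \<Longrightarrow> {p \<in> P. e p = q} \<in> X"
      "is_functor Q s C M'" "is_functor Q s C N'"
      "\<And>q. q \<in> Q \<Longrightarrow> dobj M' q \<in> S" "\<And>q. q \<in> Q \<Longrightarrow> dobj N' q \<in> S"
      "F \<in> arrs (functor_category Q s C) M' N'"
      "\<alpha> \<in> arrs D M (pullback e M')" "\<alpha>' \<in> arrs D (pullback e M') M"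
      "cmp D M (pullback e M') M \<alpha>' \<alpha> = ident D M"
      "cmp D (pullback e M') M (pullback e M') \<alpha> \<alpha>' = ident D (pullback e M')"
      "\<beta> \<in> arrs D N (pullback e N')" "\<beta>' \<in> arrs D (pullback e N') N"
      "cmp D N (pullback e N') N \<beta>' \<beta> = ident D N"
      "cmp D (pullback e N') N (pullback e N') \<beta> \<beta>' = ident D (pullback e N')"
      "cmp D M N (pullback e N') \<beta> f = cmp D M (pullback e M') (pullback e N') (\<lambda>p\<in>P. F (e p)) \<alpha>"
      "cmp D (pullback e M') M N f \<alpha>' = cmp D (pullback e M') (pullback e N') N \<beta>' (\<lambda>p\<in>P. F (e p))"
proof -
  obtain Q1 :: "nat set" and s1 e1 M1 where 1: "finite Q1" "partial_order_on Q1 s1"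
    "poset_map P r Q1 s1 e1" "\<And>q. q \<in> Q1 \<Longrightarrow> {p \<in> P. e1 p = q} \<in> X"
    "is_functor Q1 s1 C M1" "\<And>q. q \<in> Q1 \<Longrightarrow> dobj M1 q \<in> S" "isomorphic D M (pullback e1 M1)"
    using M(2) unfolding encodable_in_def by blast
  obtain Q2 :: "nat set" and s2 e2 N1 where 2: "finite Q2" "partial_order_on Q2 s2"
    "poset_map P r Q2 s2 e2" "\<And>q. q \<in> Q2 \<Longrightarrow> {p \<in> P. e2 p = q} \<in> X"
    "is_functor Q2 s2 C N1" "\<And>q. q \<in> Q2 \<Longrightarrow> dobj N1 q \<in> S" "isomorphic D N (pullback e2 N1)"
    using N(2) unfolding encodable_in_def by blast
  note e1 = poset_mapD[OF 1(3)] and e2 = poset_mapD[OF 2(3)]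
  define h where "h p = (e1 p, e2 p)" for p
  define fib where "fib q = {p \<in> P. h p = q}" for q
  \<comment> \<open>The refined encoding sends a point to its connected component in its fibre.\<close>
  define cls where "cls p = zigzag r (fib (h p)) `` {p}" for p
  have self: "p \<in> cls p" if "p \<in> P" for p
    unfolding cls_def by (rule equiv_class_self[OF zigzag_equiv]) (simp add: fib_def that)
  have clsD: "p' \<in> P" "h p' = h p" "cls p' = cls p" if "p \<in> P" "p' \<in> cls p" for p p'
  proof -
    have z: "(p, p') \<in> zigzag r (fib (h p))" using that unfolding cls_def by simp
    then show "p' \<in> P" and h: "h p' = h p" by (auto simp: zigzag_def fib_def)
    show "cls p' = cls p" unfolding cls_def h using equiv_class_eq[OF zigzag_equiv z] by simp
  qed
  have cls_le: "cls p = cls p'" if "(p, p') \<in> r" "h p = h p'" for p p'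
  proof -
    have "(p, p') \<in> zigzag r (fib (h p))" using that poD(1,2) by (auto simp: zigzag_def fib_def)
    then show ?thesis unfolding cls_def using equiv_class_eq[OF zigzag_equiv] that(2) by metis
  qed
  \<comment> \<open>Induction along a zigzag inside one fibre: \<open>g\<close> changes at no step.
    This is later applied to the components of the conjugated morphism.\<close>
  have const: "g p' = g p" if "p \<in> P" "p' \<in> cls p"
    and g: "\<And>x y. \<lbrakk>(x, y) \<in> r; h x = h y\<rbrakk> \<Longrightarrow> g x = g y" for g :: "'p \<Rightarrow> 'm" and p p'
  proof -
    have "(p, p') \<in> ((r \<union> r\<inverse>) \<inter> fib (h p) \<times> fib (h p))\<^sup>*"
      using that unfolding cls_def zigzag_def by auto
    then show ?thesis by induction (auto simp: fib_def dest: g)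
  qed
  have fib_X: "fib (q1, q2) \<in> X" if "q1 \<in> Q1" "q2 \<in> Q2" for q1 q2
  proof -
    have "fib (q1, q2) = {p \<in> P. e1 p = q1} \<inter> {p \<in> P. e2 p = q2}" by (auto simp: fib_def h_def)
    then show ?thesis using 1(4) 2(4) that encoding_structure_Int[OF enc] by simp
  qed
  \<comment> \<open>Connectivity is available for intervals. A point between two points of a fibre
    has its values under \<open>e1\<close> and \<open>e2\<close> squeezed, and antisymmetry of
    \<open>s1\<close> and \<open>s2\<close> makes them equal.\<close>
  have fib_int: "is_interval P r (fib q)" for q
    unfolding is_interval_def
  proof (intro conjI ballI impI)
    fix x y p assume *: "x \<in> fib q" "y \<in> fib q" "p \<in> P" "(x, p) \<in> r" "(p, y) \<in> r"
    have xy: "x \<in> P" "y \<in> P" "h x = q" "h y = q" using * by (auto simp: fib_def)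
    have "e1 p = e1 x"
      using partial_order_onD(5)[OF 1(2), of "e1 p" "e1 x"] e1(2)[OF xy(1) *(3,4)]
        e1(2)[OF *(3) xy(2) *(5)] xy by (auto simp: h_def)
    moreover have "e2 p = e2 x"
      using partial_order_onD(5)[OF 2(2), of "e2 p" "e2 x"] e2(2)[OF xy(1) *(3,4)]
        e2(2)[OF *(3) xy(2) *(5)] xy by (auto simp: h_def)
    ultimately show "p \<in> fib q" using * xy by (auto simp: fib_def h_def)
  qed (auto simp: fib_def)
  define Q where "Q = cls ` P"
  have comp: "cls p \<in> le_components r (fib (h p))" if "p \<in> P" for p
    unfolding le_components_def cls_def using that by (intro quotientI) (simp add: fib_def)
  have cls_X: "cls p \<in> X" if "p \<in> P" for p
    using comp[OF that] conn fib_int fib_X[of "e1 p" "e2 p"] e1(1) e2(1) that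
    unfolding connective_def h_def by blast
  \<comment> \<open>Finiteness of the refined poset: there are finitely many values of
    \<open>h\<close>, each with finitely many components.\<close>
  have "Q \<subseteq> (\<Union>q \<in> Q1 \<times> Q2. le_components r (fib q))"
  proof
    fix A assume "A \<in> Q"
    then obtain p where p: "p \<in> P" "A = cls p" by (auto simp: Q_def)
    then have "h p \<in> Q1 \<times> Q2" using e1(1) e2(1) by (simp add: h_def)
    from UN_I[of "h p" "Q1 \<times> Q2" "cls p" "\<lambda>q. le_components r (fib q)", OF this comp[OF p(1)]]
    show "A \<in> (\<Union>q \<in> Q1 \<times> Q2. le_components r (fib q))"
      unfolding p(2) .
  qed
  moreover have "finite (\<Union>q \<in> Q1 \<times> Q2. le_components r (fib q))"
    using 1(1) 2(1) conn fib_int fib_X unfolding connective_def by (intro finite_UN_I) auto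
  ultimately have Q_fin: "finite Q" by (rule finite_subset)
  have Q_fib: "{p \<in> P. cls p = A} \<in> X" if "A \<in> Q" for A
  proof -
    obtain p where p: "p \<in> P" "A = cls p" using \<open>A \<in> Q\<close> by (auto simp: Q_def)
    have "{p \<in> P. cls p = A} = cls p" using p self clsD by blast
    then show ?thesis using cls_X p by simp
  qed
  \<comment> \<open>\<open>h\<close> is constant on a class, so \<open>e1\<close> and
    \<open>e2\<close> can be evaluated at any chosen point of it.\<close>
  define rep where "rep A = (SOME p. p \<in> A)" for A :: "'p set"
  have rep: "rep (cls p) \<in> cls p" if "p \<in> P" for p
    unfolding rep_def using someI[of "\<lambda>x. x \<in> cls p"] self[OF that] by blast
  have h_rep: "h (rep (cls p)) = h p" if "p \<in> P" for p using clsD(2)[OF that rep[OF that]] .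
  \<comment> \<open>The transitive closure of \<open>R\<close> is antisymmetric because a cycle has constant
    \<open>h\<close>, so all its steps stay inside one component.\<close>
  define R where "R = {(cls p, cls p') | p p'. (p, p') \<in> r}"
  define s where "s = R\<^sup>+"
  have R_mono: "(e1 (rep A), e1 (rep B)) \<in> s1 \<and> (e2 (rep A), e2 (rep B)) \<in> s2"
    if AB: "(A, B) \<in> R" for A B
  proof -
    obtain p p' where p: "(p, p') \<in> r" "A = cls p" "B = cls p'" using AB by (auto simp: R_def)
    then have "p \<in> P" "p' \<in> P" using poD by auto
    then show ?thesis using p e1(2) e2(2) h_rep by (auto simp: h_def)
  qed
  have s_mono: "(e1 (rep A), e1 (rep B)) \<in> s1 \<and> (e2 (rep A), e2 (rep B)) \<in> s2"
    if "(A, B) \<in> s" for A B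
    using that unfolding s_def
    by (induction rule: trancl_induct)
      (use R_mono partial_order_onD(4)[OF 1(2)] partial_order_onD(4)[OF 2(2)] in blast)+
  have R_eq: "A = B" if AB: "(A, B) \<in> R" "h (rep A) = h (rep B)" for A B
  proof -
    obtain p p' where p: "(p, p') \<in> r" "A = cls p" "B = cls p'" using AB by (auto simp: R_def)
    then have "p \<in> P" "p' \<in> P" using poD by auto
    then show ?thesis using p AB(2) h_rep cls_le by simp
  qed
  have s_eq: "h (rep A) = h (rep B) \<longrightarrow> A = B" if "(A, B) \<in> s" for A B
    using that unfolding s_def
  proof (induction rule: trancl_induct)
    case (step B C)
    show ?case
    proof
      assume AC: "h (rep A) = h (rep C)"
      \<comment> \<open>In each coordinate the value at \<open>B\<close> lies between the equal
        values at \<open>A\<close> and \<open>C\<close>.\<close>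
      have "h (rep A) = h (rep B)"
        using AC R_mono[OF step(2)] s_mono[of A B] step(1) partial_order_onD(5)[OF 1(2)]
          partial_order_onD(5)[OF 2(2)] unfolding s_def h_def by auto
      then show "A = C" using step R_eq AC by simp
    qed
  qed (use R_eq in blast)
  have R_sub: "R \<subseteq> Q \<times> Q" unfolding R_def Q_def using poD by auto
  have s_sub: "s \<subseteq> Q \<times> Q" unfolding s_def using trancl_subset_Sigma[OF R_sub] .
  have Q_po: "partial_order_on Q s"
    unfolding partial_order_on_def preorder_on_def refl_on_def
  proof (intro conjI ballI)
    fix A assume "A \<in> Q"
    then show "(A, A) \<in> s" unfolding s_def R_def Q_def using poD(3) by blast
  next
    show "trans s" unfolding s_def by simp
    show "antisym s"
    proof (rule antisymI)
      fix A B assume AB: "(A, B) \<in> s" "(B, A) \<in> s"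
      have "h (rep A) = h (rep B)"
        using s_mono[OF AB(1)] s_mono[OF AB(2)] partial_order_onD(5)[OF 1(2)]
          partial_order_onD(5)[OF 2(2)] unfolding h_def by auto
      then show "A = B" using s_eq AB by blast
    qed
  qed (rule s_sub)
  have cls_map: "poset_map P r Q s cls"
    unfolding poset_map_def monotone_on_def Q_def s_def R_def by auto
  have rep_map: "poset_map Q s Q1 s1 (e1 \<circ> rep)" "poset_map Q s Q2 s2 (e2 \<circ> rep)"
    unfolding poset_map_def monotone_on_def using s_mono e1(1) e2(1) clsD(1) rep
    by (auto simp: Q_def)
  define M' where "M' = pullback (e1 \<circ> rep) M1"
  define N' where "N' = pullback (e2 \<circ> rep) N1"
  have M': "is_functor Q s C M'" and N': "is_functor Q s C N'"
    unfolding M'_def N'_def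
    using is_functor_pullback[OF 1(5) rep_map(1) Q_po] is_functor_pullback[OF 2(5) rep_map(2) Q_po]
    by simp_all
  have vals: "dobj M' q \<in> S" "dobj N' q \<in> S" if "q \<in> Q" for q
    unfolding M'_def N'_def using that poset_mapD(1)[OF rep_map(1)] poset_mapD(1)[OF rep_map(2)] 1(6) 2(6)
    by auto
  define M2 where "M2 = pullback cls M'"
  define N2 where "N2 = pullback cls N'"
  have M2: "is_functor P r C M2" and N2: "is_functor P r C N2"
    unfolding M2_def N2_def
    using is_functor_pullback[OF M' cls_map po] is_functor_pullback[OF N' cls_map po] by simp_all
  \<comment> \<open>Refining the encoding does not change the encoded modules:
    \<open>h (rep (cls p)) = h p\<close>, so the two pullbacks agree over \<open>P\<close>.\<close>
  have "isomorphic D (pullback e1 M1) M2" "isomorphic D (pullback e2 N1) N2"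
    using h_rep poD(1,2) is_functor_pullback[OF 1(5,3) po] is_functor_pullback[OF 2(5,3) po]
    by (auto intro!: isomorphic_agree simp: M2_def N2_def M'_def N'_def h_def)
  then have "isomorphic D M M2" "isomorphic D N N2" using 1(7) 2(7) D.isomorphic_trans by blast+
  then obtain \<alpha> \<alpha>' \<beta> \<beta>' where \<alpha>: "\<alpha> \<in> arrs D M M2" "\<alpha>' \<in> arrs D M2 M"
      "cmp D M M2 M \<alpha>' \<alpha> = ident D M" "cmp D M2 M M2 \<alpha> \<alpha>' = ident D M2"
    and \<beta>: "\<beta> \<in> arrs D N N2" "\<beta>' \<in> arrs D N2 N"
      "cmp D N N2 N \<beta>' \<beta> = ident D N" "cmp D N2 N N2 \<beta> \<beta>' = ident D N2"
    unfolding isomorphic_def by blast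
  \<comment> \<open>Conjugation by the isomorphisms turns \<open>f\<close> into a morphism between
    diagrams pulled back along \<open>cls\<close>, whose transition maps inside a class are
    identities on the nose.\<close>
  define g where "g = cmp D M2 N N2 \<beta> (cmp D M2 M N f \<alpha>')"
  have o: "M \<in> objs D" "N \<in> objs D" "M2 \<in> objs D" "N2 \<in> objs D" using M N M2 N2 by auto
  note functor_category_simps [simp del]
  have g: "g \<in> arrs D M2 N2" unfolding g_def using o f \<alpha> \<beta> by (simp add: D.cmp_arr)
  have sq1: "cmp D M N N2 \<beta> f = cmp D M M2 N2 g \<alpha>"
  proof -
    have "cmp D M M2 N2 g \<alpha> = cmp D M N N2 \<beta> (cmp D M M N f (cmp D M M2 M \<alpha>' \<alpha>))"
      unfolding g_def using o f \<alpha>(1,2) \<beta>(1,2) by (simp add: D.cmp_assoc D.cmp_arr)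
    then show ?thesis using o f \<alpha>(3) by (simp add: D.cmp_ident_right)
  qed
  have sq2: "cmp D M2 M N f \<alpha>' = cmp D M2 N2 N \<beta>' g"
    unfolding g_def using o f \<alpha>(1,2) \<beta>
    by (simp add: D.cmp_assoc D.cmp_arr D.cmp_ident_left)
  \<comment> \<open>Comparable points with the same \<open>h\<close> lie in one class, so both
    transition maps in the naturality square are identities and the square reads
    \<open>g x = g y\<close>.\<close>
  have g_const: "g x = g y" if xy: "(x, y) \<in> r" "h x = h y" for x y
  proof -
    have P: "x \<in> P" "y \<in> P" using xy poD by auto
    then show ?thesis
      using functor_category_arr_natural[OF g xy(1)] functor_category_arr_at[OF g P(1)]
        functor_category_arr_at[OF g P(2)] cls_le[OF xy]
        is_functorD(1,3)[OF M'] is_functorD(1,3)[OF N']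
      by (simp add: M2_def N2_def Q_def cmp_ident_left cmp_ident_right)
  qed
  define F where "F = (\<lambda>A\<in>Q. g (rep A))"
  have F_cls: "F (cls p) = g p" if "p \<in> P" for p
    using const[OF that rep[OF that], of g] g_const that by (simp add: F_def Q_def)
  have F_g: "(\<lambda>p\<in>P. F (cls p)) = g"
    using g F_cls by (intro extensionalityI[of _ P]) (auto simp: functor_category_arrs PiE_def)
  have F_at: "F q \<in> arrs C (dobj M' q) (dobj N' q)" if q: "q \<in> Q" for q
  proof -
    obtain p where p: "p \<in> P" "q = cls p" using q by (auto simp: Q_def)
    then show ?thesis using functor_category_arr_at[OF g p(1)] F_cls by (simp add: M2_def N2_def)
  qed
  \<comment> \<open>\<open>s\<close> is a transitive closure. A generating step comes from
    comparable points of \<open>P\<close>, where naturality of \<open>g\<close> applies; longer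
    chains are handled by pasting squares.\<close>
  have F_nat: "cmp C (dobj M' A) (dobj N' A) (dobj N' B) (dmap N' A B) (F A)
      = cmp C (dobj M' A) (dobj M' B) (dobj N' B) (F B) (dmap M' A B)" if "(A, B) \<in> s" for A B
    using that unfolding s_def
  proof (induction rule: trancl_induct)
    case (base B)
    then obtain p p' where p: "(p, p') \<in> r" "A = cls p" "B = cls p'" by (auto simp: R_def)
    then have "p \<in> P" "p' \<in> P" using poD by auto
    then show ?case
      using functor_category_arr_natural[OF g p(1)] p F_cls by (simp add: M2_def N2_def)
  next
    case (step B E)
    have AB: "(A, B) \<in> s" and BE: "(B, E) \<in> s" using step by (auto simp: s_def)
    then have q: "A \<in> Q" "B \<in> Q" "E \<in> Q" using s_sub by auto
    obtain p p' where p: "(p, p') \<in> r" "B = cls p" "E = cls p'" using step by (auto simp: R_def)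
    then have pP: "p \<in> P" "p' \<in> P" using poD by auto
    have nat: "cmp C (dobj M' B) (dobj N' B) (dobj N' E) (dmap N' B E) (F B)
      = cmp C (dobj M' B) (dobj M' E) (dobj N' E) (F E) (dmap M' B E)"
      using functor_category_arr_natural[OF g p(1)] p pP F_cls by (simp add: M2_def N2_def)
    note FF = q AB BE F_at is_functorD(1,2)[OF M'] is_functorD(1,2)[OF N']
    have "cmp C (dobj M' A) (dobj N' A) (dobj N' E) (dmap N' A E) (F A)
      = cmp C (dobj M' A) (dobj N' B) (dobj N' E) (dmap N' B E)
          (cmp C (dobj M' A) (dobj N' A) (dobj N' B) (dmap N' A B) (F A))"
      unfolding is_functorD(4)[OF N' AB BE, symmetric] using FF by (simp add: cmp_assoc)
    also have "\<dots> = cmp C (dobj M' A) (dobj M' B) (dobj N' E)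
        (cmp C (dobj M' B) (dobj N' B) (dobj N' E) (dmap N' B E) (F B)) (dmap M' A B)"
      unfolding step.IH using FF by (simp add: cmp_assoc)
    also have "\<dots> = cmp C (dobj M' A) (dobj M' E) (dobj N' E) (F E) (dmap M' A E)"
      unfolding nat is_functorD(4)[OF M' AB BE, symmetric] using FF by (simp add: cmp_assoc)
    finally show ?case .
  qed
  have F: "F \<in> arrs (functor_category Q s C) M' N'"
    unfolding functor_category_arrs using F_at F_nat by (auto simp: F_def)
  show ?thesis
    by (rule that[OF Q_fin Q_po cls_map Q_fib M' N' vals F, folded M2_def N2_def,
          OF _ _ _ \<alpha> \<beta>]) (simp_all add: F_g sq1 sq2)
qed

text \<open>All constructions are made over the finite poset \<open>Q\<close> with values in
  \<open>S\<close> and then pulled back. Uniqueness shows that every kernel and every cokernel of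
  \<open>f\<close>, not just a chosen one, is isomorphic to such a pullback.\<close>

lemma encodable_closed:
  assumes M: "is_functor P r C M" "encodable_in C S P r X M"
    and N: "is_functor P r C N" "encodable_in C S P r X N"
    and f: "f \<in> arrs D M N"
  shows "is_kernel D M N f k m \<Longrightarrow> encodable_in C S P r X k"
    and "is_cokernel D M N f k m \<Longrightarrow> encodable_in C S P r X k"
    and "\<exists>s i j u v. encodable_in C S P r X s \<and> is_biproduct D M N s i j u v"
proof -
  obtain Q :: "'p set set" and s e M' N' F \<alpha> \<alpha>' \<beta> \<beta>'
    where Q: "finite Q" "partial_order_on Q s" and e: "poset_map P r Q s e"
      and fib: "\<And>q. q \<in> Q \<Longrightarrow> {p \<in> P. e p = q} \<in> X"
      and M': "is_functor Q s C M'" and N': "is_functor Q s C N'"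
      and vals: "\<And>q. q \<in> Q \<Longrightarrow> dobj M' q \<in> S" "\<And>q. q \<in> Q \<Longrightarrow> dobj N' q \<in> S"
      and F: "F \<in> arrs (functor_category Q s C) M' N'"
      and \<alpha>: "\<alpha> \<in> arrs D M (pullback e M')" "\<alpha>' \<in> arrs D (pullback e M') M"
        "cmp D M (pullback e M') M \<alpha>' \<alpha> = ident D M"
        "cmp D (pullback e M') M (pullback e M') \<alpha> \<alpha>' = ident D (pullback e M')"
      and \<beta>: "\<beta> \<in> arrs D N (pullback e N')" "\<beta>' \<in> arrs D (pullback e N') N"
        "cmp D N (pullback e N') N \<beta>' \<beta> = ident D N"
        "cmp D (pullback e N') N (pullback e N') \<beta> \<beta>' = ident D (pullback e N')"
      and sq1: "cmp D M N (pullback e N') \<beta> f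
        = cmp D M (pullback e M') (pullback e N') (\<lambda>p\<in>P. F (e p)) \<alpha>"
      and sq2: "cmp D (pullback e M') M N f \<alpha>'
        = cmp D (pullback e M') (pullback e N') N \<beta>' (\<lambda>p\<in>P. F (e p))"
    using that by (rule common_encoding[OF M N f])
  interpret Q: abelian_diagrams C Q s
    by (intro abelian_diagrams.intro abelian_diagrams_axioms.intro abelian_category_axioms Q(2))
  have M2: "is_functor P r C (pullback e M')" and N2: "is_functor P r C (pullback e N')"
    using is_functor_pullback[OF M' e po] is_functor_pullback[OF N' e po] by auto
  have o: "M \<in> objs D" "N \<in> objs D" "pullback e M' \<in> objs D" "pullback e N' \<in> objs D"
    using M(1) N(1) M2 N2 by simp_all
  note F2 = pullback_arr[OF F e po]
  note eQ = poset_mapD(1)[OF e]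
  show "encodable_in C S P r X k" if ker: "is_kernel D M N f k m"
  proof -
    have "\<forall>q\<in>Q. \<exists>k. k \<in> S \<and> (\<exists>m. is_kernel C (dobj M' q) (dobj N' q) (F q) k m)"
      using S_kernel vals functor_category_arr_at[OF F] by blast
    then obtain K where K: "\<And>q. q \<in> Q \<Longrightarrow> K q \<in> S"
      "\<And>q. q \<in> Q \<Longrightarrow> \<exists>m. is_kernel C (dobj M' q) (dobj N' q) (F q) (K q) m" by metis
    obtain k' m' where k': "is_kernel Q.D M' N' F k' m'" "dobj k' = K"
      "\<And>q. q \<in> Q \<Longrightarrow> is_kernel C (dobj M' q) (dobj N' q) (F q) (dobj k' q) (m' q)"
      using Q.D_ex_kernel[OF M' N' F K(2)] by blast
    have k'_fun: "is_functor Q s C k'" and m': "m' \<in> arrs Q.D k' M'"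
      using is_kernelD(1,2)[OF k'(1)] by simp_all
    \<comment> \<open>The value at \<open>p\<close> is the kernel already known at
      \<open>e p\<close>, so the pointwise criterion applies.\<close>
    have "is_kernel D (pullback e M') (pullback e N') (\<lambda>p\<in>P. F (e p)) (pullback e k') (\<lambda>p\<in>P. m' (e p))"
      by (rule kernel_pointwiseI[OF M2 N2 F2 is_functor_pullback[OF k'_fun e po] pullback_arr[OF m' e po]])
        (simp add: k'(3) eQ)
    \<comment> \<open>Transport along \<open>sq1\<close> makes \<open>k\<close> a second kernel of
      the pulled-back \<open>F\<close>, so uniqueness compares it with
      \<open>pullback e k'\<close>.\<close>
    then have iso: "isomorphic D k (pullback e k')"
      using D.is_kernel_unique[OF D.is_kernel_transport[OF ker o f F2 \<alpha> \<beta>(1,2,3) sq1] _ o(3,4) F2]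
      by blast
    show ?thesis by (rule encodable_inI[OF Q e fib k'_fun _ iso]) (simp_all add: k'(2) K(1))
  qed
  show "encodable_in C S P r X k" if coker: "is_cokernel D M N f k m"
  proof -
    have "\<forall>q\<in>Q. \<exists>k. k \<in> S \<and> (\<exists>m. is_cokernel C (dobj M' q) (dobj N' q) (F q) k m)"
      using S_cokernel vals functor_category_arr_at[OF F] by blast
    then obtain K where K: "\<And>q. q \<in> Q \<Longrightarrow> K q \<in> S"
      "\<And>q. q \<in> Q \<Longrightarrow> \<exists>m. is_cokernel C (dobj M' q) (dobj N' q) (F q) (K q) m" by metis
    obtain k' m' where k': "is_cokernel Q.D M' N' F k' m'" "dobj k' = K"
      "\<And>q. q \<in> Q \<Longrightarrow> is_cokernel C (dobj M' q) (dobj N' q) (F q) (dobj k' q) (m' q)"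
      using Q.D_ex_cokernel[OF M' N' F K(2)] by blast
    have k'_fun: "is_functor Q s C k'" and m': "m' \<in> arrs Q.D N' k'"
      using is_cokernelD(1,2)[OF k'(1)] by simp_all
    have "is_cokernel D (pullback e M') (pullback e N') (\<lambda>p\<in>P. F (e p)) (pullback e k') (\<lambda>p\<in>P. m' (e p))"
      by (rule cokernel_pointwiseI[OF M2 N2 F2 is_functor_pullback[OF k'_fun e po] pullback_arr[OF m' e po]])
        (simp add: k'(3) eQ)
    then have iso: "isomorphic D k (pullback e k')"
      using D.is_cokernel_unique[OF D.is_cokernel_transport[OF coker o f F2 \<alpha>(1,2,3) \<beta> sq2] _ o(3,4) F2]
      by blast
    show ?thesis by (rule encodable_inI[OF Q e fib k'_fun _ iso]) (simp_all add: k'(2) K(1))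
  qed
  show "\<exists>s i j u v. encodable_in C S P r X s \<and> is_biproduct D M N s i j u v"
  proof -
    have "\<forall>q\<in>Q. \<exists>t i j u v. t \<in> S \<and> is_biproduct C (dobj M' q) (dobj N' q) t i j u v"
      using S_biproduct vals by blast
    then obtain T i j u v where T: "\<And>q. q \<in> Q \<Longrightarrow> T q \<in> S"
      "\<And>q. q \<in> Q \<Longrightarrow> is_biproduct C (dobj M' q) (dobj N' q) (T q) (i q) (j q) (u q) (v q)"
      by metis
    obtain t where t: "dobj t = T"
      "is_biproduct Q.D M' N' t (restrict i Q) (restrict j Q) (restrict u Q) (restrict v Q)"
      using Q.biproduct_pointwiseI[OF M' N' T(2)] by blast
    have t_fun: "is_functor Q s C t" using t(2) unfolding is_biproduct_def by simp
    have iso: "isomorphic D (pullback e t) (pullback e t)"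
      using D.isomorphic_refl is_functor_pullback[OF t_fun e po] by simp
    have "encodable_in C S P r X (pullback e t)"
      by (rule encodable_inI[OF Q e fib t_fun _ iso]) (simp_all add: t(1) T(1))
    \<comment> \<open>The transport runs from the pullbacks back to \<open>M\<close> and
      \<open>N\<close>, hence \<open>\<alpha>\<close> and \<open>\<beta>\<close> exchange roles with
      their inverses.\<close>
    moreover note D.is_biproduct_transport[OF pullback_biproduct[OF t(2) e po] o(3,4,1,2)
        \<alpha>(2,1,4,3) \<beta>(2,1,4,3)]
    ultimately show ?thesis by blast
  qed
qed

text \<open>A constant diagram is encoded by a one-point poset, whose only fibre is all of
  \<open>P\<close>, a member of \<open>X\<close>.\<close>

lemma encodable_zero:
  assumes z: "z \<in> S" "zero_object C z"
  shows "encodable_in C S P r X \<lparr>dobj = (\<lambda>p. z), dmap = (\<lambda>p q. ident C z)\<rparr>"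
    (is "encodable_in C S P r X ?z")
proof -
  have zC: "z \<in> objs C" using z unfolding zero_object_def by simp
  have PX: "P \<in> X" using enc unfolding encoding_structure_def by simp
  have e: "poset_map P r {0::nat} {(0, 0)} (\<lambda>_. 0)"
    by (simp add: poset_map_def monotone_on_def)
  have po0: "partial_order_on {0::nat} {(0, 0)}"
    by (auto simp: partial_order_on_def preorder_on_def refl_on_def trans_def antisym_def)
  have "pullback (\<lambda>_. 0::nat) \<lparr>dobj = (\<lambda>p. z), dmap = (\<lambda>p q. ident C z)\<rparr> = ?z"
    by (simp add: pullback_def)
  then have iso: "isomorphic D ?z (pullback (\<lambda>_. 0::nat) \<lparr>dobj = (\<lambda>p. z), dmap = (\<lambda>p q. ident C z)\<rparr>)"
    using D.isomorphic_refl[of ?z] is_functor_const[OF zC, of P r] by simp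
  show ?thesis
    by (rule encodable_inI[OF _ po0 e _ is_functor_const[OF zC] _ iso]) (simp_all add: PX z)
qed

theorem full_abelian_encodable:
  "full_abelian_subcategory (full_subcategory D {M \<in> objs D. encodable_in C S P r X M}) D"
proof -
  let ?T = "{M \<in> objs D. encodable_in C S P r X M}"
  obtain z where z: "z \<in> S" "zero_object C z" using S_zero by blast
  have add: "additive_category (full_subcategory D ?T)"
  proof (rule D.additive_full_subcategory)
    show "?T \<subseteq> objs D" by blast
    show zero: "zero_object D \<lparr>dobj = (\<lambda>p. z), dmap = (\<lambda>p q. ident C z)\<rparr>"
      by (rule zero_object_functor_category[OF z(2)])
    show "\<lparr>dobj = (\<lambda>p. z), dmap = (\<lambda>p q. ident C z)\<rparr> \<in> ?T"
      using zero encodable_zero[OF z] unfolding zero_object_def by blast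
  next
    fix M N assume "M \<in> ?T" "N \<in> ?T"
    then have M: "is_functor P r C M" "encodable_in C S P r X M"
      and N: "is_functor P r C N" "encodable_in C S P r X N" by simp_all
    \<comment> \<open>Common encodings are produced from a morphism, and the zero morphism is always
      available.\<close>
    obtain s i j u v where s: "encodable_in C S P r X s" "is_biproduct D M N s i j u v"
      using encodable_closed(3)[OF M N D_zarr[OF M(1) N(1)]] by blast
    moreover have "s \<in> objs D" using s(2) unfolding is_biproduct_def by blast
    ultimately show "\<exists>s\<in>?T. \<exists>i j p q. is_biproduct D M N s i j p q" by blast
  qed
  have iso: "\<exists>k' \<in> ?T. isomorphic D k k'"
    if "M \<in> ?T" "N \<in> ?T" "f \<in> arrs D M N" "is_kernel D M N f k m \<or> is_cokernel D M N f k m"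
    for M N f k m
  proof -
    have M: "is_functor P r C M" "encodable_in C S P r X M"
      and N: "is_functor P r C N" "encodable_in C S P r X N" using that by simp_all
    \<comment> \<open>Encodability is defined up to isomorphism, so the given \<open>k\<close> is
      itself encodable and serves as \<open>k'\<close>.\<close>
    have "encodable_in C S P r X k"
      using that(4) encodable_closed(1,2)[OF M N that(3)] by blast
    moreover have "k \<in> objs D" using that(4) is_kernelD(1) is_cokernelD(1) by metis
    ultimately show ?thesis using D.isomorphic_refl by blast
  qed
  show ?thesis
    unfolding full_abelian_subcategory_def full_subcategory_simps
    by (intro conjI ballI allI impI D_abelian add iso[OF _ _ _ disjI1] iso[OF _ _ _ disjI2])
      (auto simp del: functor_category_objs)
qed

end

section \<open>Vector spaces over a field\<close>

lemma Vect_objs [simp]: "V \<in> objs (Vect K) \<longleftrightarrow> vectorspace K V"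
  by (simp add: Vect_def)

lemma Vect_simps [simp]:
  "ident (Vect K) V = (\<lambda>x \<in> carrier V. x)"
  "cmp (Vect K) U V W g f = compose (carrier U) g f"
  "zarr (Vect K) V W = (\<lambda>x \<in> carrier V. \<zero>\<^bsub>W\<^esub>)"
  "plus_arr (Vect K) V W f g = (\<lambda>x \<in> carrier V. f x \<oplus>\<^bsub>W\<^esub> g x)"
  by (simp_all add: Vect_def)

lemma linear_map_iff: "linear_map K V W T \<longleftrightarrow>
    vectorspace K V \<and> vectorspace K W \<and> T \<in> module_hom K V W"
  by (auto simp: linear_map_def mod_hom_def mod_hom_axioms_def vectorspace_def)

lemma Vect_arrs_iff: "T \<in> arrs (Vect K) V W \<longleftrightarrow> vectorspace K V \<and> vectorspace K W \<and>
    T \<in> carrier V \<rightarrow>\<^sub>E carrier W \<and>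
    (\<forall>x\<in>carrier V. \<forall>y\<in>carrier V. T (x \<oplus>\<^bsub>V\<^esub> y) = T x \<oplus>\<^bsub>W\<^esub> T y) \<and>
    (\<forall>c\<in>carrier K. \<forall>x\<in>carrier V. T (c \<odot>\<^bsub>V\<^esub> x) = c \<odot>\<^bsub>W\<^esub> T x)"
  by (auto simp: Vect_def linear_map_iff module_hom_def)

lemma Vect_arrI:
  assumes "vectorspace K V" "vectorspace K W" "\<And>x. x \<in> carrier V \<Longrightarrow> T x \<in> carrier W"
    "\<And>x y. \<lbrakk>x \<in> carrier V; y \<in> carrier V\<rbrakk> \<Longrightarrow> T (x \<oplus>\<^bsub>V\<^esub> y) = T x \<oplus>\<^bsub>W\<^esub> T y"
    "\<And>c x. \<lbrakk>c \<in> carrier K; x \<in> carrier V\<rbrakk> \<Longrightarrow> T (c \<odot>\<^bsub>V\<^esub> x) = c \<odot>\<^bsub>W\<^esub> T x"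
  shows "restrict T (carrier V) \<in> arrs (Vect K) V W"
proof -
  interpret V: vectorspace K V by fact
  show ?thesis unfolding Vect_arrs_iff using assms by auto
qed

lemma Vect_arrD:
  assumes "T \<in> arrs (Vect K) V W"
  shows "vectorspace K V" "vectorspace K W" "linear_map K V W T"
    "x \<in> carrier V \<Longrightarrow> T x \<in> carrier W"
    "\<lbrakk>x \<in> carrier V; y \<in> carrier V\<rbrakk> \<Longrightarrow> T (x \<oplus>\<^bsub>V\<^esub> y) = T x \<oplus>\<^bsub>W\<^esub> T y"
    "\<lbrakk>x \<in> carrier V; y \<in> carrier V\<rbrakk> \<Longrightarrow> T (x \<ominus>\<^bsub>V\<^esub> y) = T x \<ominus>\<^bsub>W\<^esub> T y"
    "\<lbrakk>c \<in> carrier K; x \<in> carrier V\<rbrakk> \<Longrightarrow> T (c \<odot>\<^bsub>V\<^esub> x) = c \<odot>\<^bsub>W\<^esub> T x"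
    "T \<zero>\<^bsub>V\<^esub> = \<zero>\<^bsub>W\<^esub>" "T \<in> extensional (carrier V)"
proof -
  show l: "linear_map K V W T" using assms by (simp add: Vect_def)
  interpret linear_map K V W T by (rule l)
  show "x \<in> carrier V \<Longrightarrow> T x \<in> carrier W"
    "\<lbrakk>x \<in> carrier V; y \<in> carrier V\<rbrakk> \<Longrightarrow> T (x \<oplus>\<^bsub>V\<^esub> y) = T x \<oplus>\<^bsub>W\<^esub> T y"
    "\<lbrakk>x \<in> carrier V; y \<in> carrier V\<rbrakk> \<Longrightarrow> T (x \<ominus>\<^bsub>V\<^esub> y) = T x \<ominus>\<^bsub>W\<^esub> T y"
    "\<lbrakk>c \<in> carrier K; x \<in> carrier V\<rbrakk> \<Longrightarrow> T (c \<odot>\<^bsub>V\<^esub> x) = c \<odot>\<^bsub>W\<^esub> T x"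
    "T \<zero>\<^bsub>V\<^esub> = \<zero>\<^bsub>W\<^esub>" by simp_all
qed (use assms in \<open>auto simp: Vect_arrs_iff PiE_def\<close>)

lemma vectorspace_abelian_group: "vectorspace K V \<Longrightarrow> abelian_group V"
  by (simp add: vectorspace_def module_def)

lemma vectorspace_rules:
  assumes "vectorspace K V"
  shows "\<zero>\<^bsub>V\<^esub> \<in> carrier V" "\<lbrakk>x \<in> carrier V; y \<in> carrier V\<rbrakk> \<Longrightarrow> x \<oplus>\<^bsub>V\<^esub> y \<in> carrier V"
    "\<lbrakk>x \<in> carrier V; y \<in> carrier V\<rbrakk> \<Longrightarrow> x \<ominus>\<^bsub>V\<^esub> y \<in> carrier V"
    "\<lbrakk>c \<in> carrier K; x \<in> carrier V\<rbrakk> \<Longrightarrow> c \<odot>\<^bsub>V\<^esub> x \<in> carrier V"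
    "\<lbrakk>x \<in> carrier V; y \<in> carrier V\<rbrakk> \<Longrightarrow> x \<ominus>\<^bsub>V\<^esub> y = \<zero>\<^bsub>V\<^esub> \<longleftrightarrow> x = y"
    "x \<in> carrier V \<Longrightarrow> x \<ominus>\<^bsub>V\<^esub> \<zero>\<^bsub>V\<^esub> = x"
    "x \<in> carrier V \<Longrightarrow> \<zero>\<^bsub>V\<^esub> \<oplus>\<^bsub>V\<^esub> x = x" "x \<in> carrier V \<Longrightarrow> x \<oplus>\<^bsub>V\<^esub> \<zero>\<^bsub>V\<^esub> = x"
    "c \<in> carrier K \<Longrightarrow> c \<odot>\<^bsub>V\<^esub> \<zero>\<^bsub>V\<^esub> = \<zero>\<^bsub>V\<^esub>"
proof -
  interpret A: abelian_group V by (rule vectorspace_abelian_group) fact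
  interpret V: vectorspace K V by fact
  show "\<lbrakk>x \<in> carrier V; y \<in> carrier V\<rbrakk> \<Longrightarrow> x \<ominus>\<^bsub>V\<^esub> y = \<zero>\<^bsub>V\<^esub> \<longleftrightarrow> x = y"
    by (metis A.minus_equality A.minus_minus A.r_neg A.a_inv_closed A.l_neg a_minus_def)
  show "x \<in> carrier V \<Longrightarrow> x \<ominus>\<^bsub>V\<^esub> \<zero>\<^bsub>V\<^esub> = x" by (simp add: a_minus_def)
  show "c \<in> carrier K \<Longrightarrow> c \<odot>\<^bsub>V\<^esub> \<zero>\<^bsub>V\<^esub> = \<zero>\<^bsub>V\<^esub>"
    "\<lbrakk>c \<in> carrier K; x \<in> carrier V\<rbrakk> \<Longrightarrow> c \<odot>\<^bsub>V\<^esub> x \<in> carrier V"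
    by (simp_all add: V.smult_r_null V.smult_closed)
  show "\<lbrakk>x \<in> carrier V; y \<in> carrier V\<rbrakk> \<Longrightarrow> x \<ominus>\<^bsub>V\<^esub> y \<in> carrier V"
    by (simp add: a_minus_def)
  show "\<zero>\<^bsub>V\<^esub> \<in> carrier V" by (rule A.zero_closed)
  show "\<lbrakk>x \<in> carrier V; y \<in> carrier V\<rbrakk> \<Longrightarrow> x \<oplus>\<^bsub>V\<^esub> y \<in> carrier V" by (rule A.a_closed)
  show "x \<in> carrier V \<Longrightarrow> \<zero>\<^bsub>V\<^esub> \<oplus>\<^bsub>V\<^esub> x = x" by (rule A.l_zero)
  show "x \<in> carrier V \<Longrightarrow> x \<oplus>\<^bsub>V\<^esub> \<zero>\<^bsub>V\<^esub> = x" by (rule A.r_zero)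
qed

context field
begin

lemma vectorspaceI: "module R V \<Longrightarrow> vectorspace R V"
  by (simp add: vectorspace_def field_axioms)

section \<open>Additive structure on linear maps\<close>

lemma Vect_preadditive: "preadditive_category (Vect R :: (('a, 'x) module, 'x \<Rightarrow> 'x) precat)"
proof (intro preadditive_category.intro preadditive_category_axioms.intro cat.intro)
  fix V :: "('a, 'x) module" assume "V \<in> objs (Vect R)"
  then show "ident (Vect R) V \<in> arrs (Vect R) V V" by (auto intro!: Vect_arrI)
next
  fix U V W :: "('a, 'x) module" and f g assume "f \<in> arrs (Vect R) U V" "g \<in> arrs (Vect R) V W"
  then show "cmp (Vect R) U V W g f \<in> arrs (Vect R) U W"
    using Vect_arrD(1-8)[of f R U V] Vect_arrD(1-8)[of g R V W]
    unfolding Vect_simps compose_def by (intro Vect_arrI) auto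
next
  fix U V :: "('a, 'x) module" and f assume "f \<in> arrs (Vect R) U V"
  then show "cmp (Vect R) U U V f (ident (Vect R) U) = f" "cmp (Vect R) U V V (ident (Vect R) V) f = f"
    by (auto simp: Vect_arrs_iff PiE_def intro!: compose_Id Id_compose)
next
  fix U V W Z :: "('a, 'x) module" and f g h assume "f \<in> arrs (Vect R) U V" "g \<in> arrs (Vect R) V W" "h \<in> arrs (Vect R) W Z"
  then show "cmp (Vect R) U W Z h (cmp (Vect R) U V W g f) = cmp (Vect R) U V Z (cmp (Vect R) V W Z h g) f"
    by (auto simp: Vect_arrs_iff compose_def intro!: restrict_ext)
next
  fix V W :: "('a, 'x) module" assume "V \<in> objs (Vect R)" "W \<in> objs (Vect R)"
  then have V: "vectorspace R V" and W: "vectorspace R W" by auto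
  interpret V: vectorspace R V by fact
  interpret WA: abelian_group W by (rule vectorspace_abelian_group) fact
  interpret W: vectorspace R W by fact
  show "comm_group \<lparr>carrier = arrs (Vect R) V W, mult = plus_arr (Vect R) V W, one = zarr (Vect R) V W\<rparr>"
  proof (rule comm_groupI, goal_cases)
    case (1 f g)
    then show ?case using Vect_arrD(4,5,7)[of f R V W] Vect_arrD(4,5,7)[of g R V W]
      by (auto intro!: Vect_arrI[OF V W] simp: WA.a_ac W.smult_r_distr)
  next
    case 2 then show ?case by (auto intro!: Vect_arrI[OF V W])
  next
    case (3 f g h)
    then show ?case using Vect_arrD(4)[of _ R V W] by (auto simp: WA.a_assoc intro!: restrict_ext)
  next
    case (4 f g)
    then show ?case using Vect_arrD(4)[of _ R V W] by (auto simp: WA.a_comm intro!: restrict_ext)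
  next
    case (5 f)
    then show ?case using Vect_arrD(4,9)[of f R V W] by (auto intro!: extensionalityI[of _ "carrier V"])
  next
    case (6 f)
    then have f: "f \<in> arrs (Vect R) V W" by simp
    have "(\<lambda>x\<in>carrier V. \<ominus>\<^bsub>W\<^esub> f x) \<in> arrs (Vect R) V W"
      using Vect_arrD(4,5,7)[OF f]
      by (intro Vect_arrI[OF V W]) (auto simp: WA.minus_add W.smult_r_minus)
    then show ?case using Vect_arrD(4)[OF f]
      by (intro bexI[of _ "\<lambda>x\<in>carrier V. \<ominus>\<^bsub>W\<^esub> f x"]) (auto simp: WA.l_neg intro!: restrict_ext)
  qed
next
  fix U V W :: "('a, 'x) module" and f f' g
  assume "f \<in> arrs (Vect R) U V" "f' \<in> arrs (Vect R) U V" "g \<in> arrs (Vect R) V W"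
  then show "cmp (Vect R) U V W g (plus_arr (Vect R) U V f f') =
      plus_arr (Vect R) U W (cmp (Vect R) U V W g f) (cmp (Vect R) U V W g f')"
    using Vect_arrD(4)[of f R U V] Vect_arrD(4)[of f' R U V] Vect_arrD(5)[of g R V W]
    by (auto simp: compose_def intro!: restrict_ext)
next
  fix U V W :: "('a, 'x) module" and f g g'
  assume "f \<in> arrs (Vect R) U V"
  then show "cmp (Vect R) U V W (plus_arr (Vect R) V W g g') f =
      plus_arr (Vect R) U W (cmp (Vect R) U V W g f) (cmp (Vect R) U V W g' f)"
    using Vect_arrD(4)[of f R U V] by (auto simp: compose_def intro!: restrict_ext)
qed

section \<open>Kernels, quotient spaces and cokernels of linear maps\<close>

lemma Vect_kernel:
  assumes f: "f \<in> arrs (Vect R) V W"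
  defines "N \<equiv> {x \<in> carrier V. f x = \<zero>\<^bsub>W\<^esub>}"
  shows "submodule R N V"
    "is_kernel (Vect R) V W f (V\<lparr>carrier := N\<rparr>) (\<lambda>x\<in>N. x)"
proof -
  interpret f: linear_map R V W f by (rule Vect_arrD(3)[OF f])
  have N: "N = f.ker" by (auto simp: N_def f.ker_def)
  show "submodule R N V" unfolding N by (rule f.ker_is_submodule)
  have sub: "vectorspace R (V\<lparr>carrier := N\<rparr>)"
    unfolding N by (rule f.V.subspace_is_vs[OF f.kerT_is_subspace])
  show "is_kernel (Vect R) V W f (V\<lparr>carrier := N\<rparr>) (\<lambda>x\<in>N. x)"
    unfolding is_kernel_def
  proof (intro conjI ballI impI)
    show "(\<lambda>x\<in>N. x) \<in> arrs (Vect R) (V\<lparr>carrier := N\<rparr>) V"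
      using Vect_arrI[OF sub Vect_arrD(1)[OF f], of "\<lambda>x. x"] by (simp add: N_def)
  next
    fix U g assume U: "U \<in> objs (Vect R)" and g: "g \<in> arrs (Vect R) U V"
      and z: "cmp (Vect R) U V W f g = zarr (Vect R) U W"
    have gN: "g x \<in> N" if "x \<in> carrier U" for x
      using that fun_cong[OF z, of x] Vect_arrD(4)[OF g that] by (simp add: N_def compose_def)
    show "\<exists>!h. h \<in> arrs (Vect R) U (V\<lparr>carrier := N\<rparr>) \<and>
        cmp (Vect R) U (V\<lparr>carrier := N\<rparr>) V (\<lambda>x\<in>N. x) h = g"
    proof (intro ex1I conjI)
      show "g \<in> arrs (Vect R) U (V\<lparr>carrier := N\<rparr>)"
        using g sub gN by (auto simp: Vect_arrs_iff)
      show "cmp (Vect R) U (V\<lparr>carrier := N\<rparr>) V (\<lambda>x\<in>N. x) g = g"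
        using gN Vect_arrD(9)[OF g]
        by (auto simp: compose_def intro!: extensionalityI[of _ "carrier U"])
    next
      fix h assume h: "h \<in> arrs (Vect R) U (V\<lparr>carrier := N\<rparr>) \<and>
        cmp (Vect R) U (V\<lparr>carrier := N\<rparr>) V (\<lambda>x\<in>N. x) h = g"
      then have hN: "\<And>x. x \<in> carrier U \<Longrightarrow> h x \<in> N" using Vect_arrD(4)[of h] by fastforce
      show "h = g"
      proof (rule extensionalityI[of _ "carrier U"])
        fix x assume "x \<in> carrier U"
        then show "h x = g x" using h hN by (auto simp: compose_def)
      qed (use h Vect_arrD(9)[OF g] Vect_arrD(9)[of h R U "V\<lparr>carrier := N\<rparr>"] in simp_all)
    qed
  qed (auto simp: sub[unfolded N_def] N_def compose_def intro!: restrict_ext)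
qed

text \<open>Transport of structure along \<open>\<phi>\<close>, used with \<open>coset_rep\<close>
  for quotients and with a pairing function for direct sums, both times to land in a prescribed
  element type.\<close>

definition image_module :: "('x \<Rightarrow> 'y) \<Rightarrow> ('a, 'x) module \<Rightarrow> ('a, 'y) module" where
  "image_module \<phi> V = \<lparr>carrier = \<phi> ` carrier V, mult = (\<lambda>a b. undefined), one = undefined,
    zero = \<phi> \<zero>\<^bsub>V\<^esub>,
    add = (\<lambda>a b. \<phi> (inv_into (carrier V) \<phi> a \<oplus>\<^bsub>V\<^esub> inv_into (carrier V) \<phi> b)),
    smult = (\<lambda>c a. \<phi> (c \<odot>\<^bsub>V\<^esub> inv_into (carrier V) \<phi> a))\<rparr>"

text \<open>The two compatibility conditions make equality under \<open>\<phi>\<close> a congruence,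
  so the preimages picked by \<open>inv_into\<close> may be replaced by any others. The module
  axioms are then images of those of \<open>V\<close>.\<close>

lemma image_module:
  assumes V: "vectorspace R V"
    and add: "\<And>x x' y y'. \<lbrakk>x \<in> carrier V; x' \<in> carrier V; y \<in> carrier V; y' \<in> carrier V;
      \<phi> x = \<phi> x'; \<phi> y = \<phi> y'\<rbrakk> \<Longrightarrow> \<phi> (x \<oplus>\<^bsub>V\<^esub> y) = \<phi> (x' \<oplus>\<^bsub>V\<^esub> y')"
    and smult: "\<And>c x x'. \<lbrakk>c \<in> carrier R; x \<in> carrier V; x' \<in> carrier V; \<phi> x = \<phi> x'\<rbrakk>
      \<Longrightarrow> \<phi> (c \<odot>\<^bsub>V\<^esub> x) = \<phi> (c \<odot>\<^bsub>V\<^esub> x')"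
  shows "carrier (image_module \<phi> V) = \<phi> ` carrier V" "\<zero>\<^bsub>image_module \<phi> V\<^esub> = \<phi> \<zero>\<^bsub>V\<^esub>"
    "\<And>x y. \<lbrakk>x \<in> carrier V; y \<in> carrier V\<rbrakk> \<Longrightarrow> \<phi> x \<oplus>\<^bsub>image_module \<phi> V\<^esub> \<phi> y = \<phi> (x \<oplus>\<^bsub>V\<^esub> y)"
    "\<And>c x. \<lbrakk>c \<in> carrier R; x \<in> carrier V\<rbrakk> \<Longrightarrow> c \<odot>\<^bsub>image_module \<phi> V\<^esub> \<phi> x = \<phi> (c \<odot>\<^bsub>V\<^esub> x)"
    "vectorspace R (image_module \<phi> V)"
proof -
  interpret VA: abelian_group V by (rule vectorspace_abelian_group) fact
  interpret V: vectorspace R V by fact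
  let ?W = "image_module \<phi> V"
  show c: "carrier ?W = \<phi> ` carrier V" and z: "\<zero>\<^bsub>?W\<^esub> = \<phi> \<zero>\<^bsub>V\<^esub>"
    by (simp_all add: image_module_def)
  have inv: "inv_into (carrier V) \<phi> (\<phi> x) \<in> carrier V" "\<phi> (inv_into (carrier V) \<phi> (\<phi> x)) = \<phi> x"
    if "x \<in> carrier V" for x
    using that by (auto intro: inv_into_into f_inv_into_f)
  show a: "\<phi> x \<oplus>\<^bsub>?W\<^esub> \<phi> y = \<phi> (x \<oplus>\<^bsub>V\<^esub> y)" if "x \<in> carrier V" "y \<in> carrier V" for x y
    using that inv by (auto simp: image_module_def intro!: add)
  show s: "c \<odot>\<^bsub>?W\<^esub> \<phi> x = \<phi> (c \<odot>\<^bsub>V\<^esub> x)" if "c \<in> carrier R" "x \<in> carrier V" for c x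
    using that inv by (auto simp: image_module_def intro!: smult)
  have "module R ?W"
    by (rule module_criteria)
      (auto simp: c z a s VA.a_ac V.smult_l_distr V.smult_r_distr V.smult_assoc1 is_cring
        intro!: bexI[of _ "\<ominus>\<^bsub>V\<^esub> _"] arg_cong[of _ _ \<phi>] VA.r_neg)
  then show "vectorspace R ?W" by (rule vectorspaceI)
qed

text \<open>A choice of coset representatives realises the quotient \<open>W / N\<close> inside the element type
  of \<open>W\<close>.\<close>

definition coset_rep :: "('a, 'x) module \<Rightarrow> 'x set \<Rightarrow> 'x \<Rightarrow> 'x" where
  "coset_rep W N x = (SOME y. y \<in> carrier W \<and> x \<ominus>\<^bsub>W\<^esub> y \<in> N)"

lemma coset_rep_eq_iff:
  assumes "vectorspace R W" and N: "submodule R N W" and x: "x \<in> carrier W" and y: "y \<in> carrier W"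
  shows "coset_rep W N x = coset_rep W N y \<longleftrightarrow> x \<ominus>\<^bsub>W\<^esub> y \<in> N"
proof -
  interpret WA: abelian_group W by (rule vectorspace_abelian_group) fact
  interpret W: vectorspace R W by fact
  interpret N: submodule R N W by fact
  have sub: "N \<subseteq> carrier W" by (rule N.subset)
  have neg: "\<ominus>\<^bsub>W\<^esub> a \<in> N" if "a \<in> N" for a
  proof -
    have "\<ominus> \<one> \<odot>\<^bsub>W\<^esub> a \<in> N" using that by (intro N.smult_closed) simp_all
    moreover have "a \<in> carrier W" using that sub by blast
    ultimately show ?thesis using W.smult_minus_1[of a] by simp
  qed
  have flip: "b \<ominus>\<^bsub>W\<^esub> a \<in> N" if "a \<ominus>\<^bsub>W\<^esub> b \<in> N" "a \<in> carrier W" "b \<in> carrier W" for a b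
    using neg[OF that(1)] that(2,3) by (simp add: a_minus_def WA.minus_add WA.a_comm)
  have tr: "a \<ominus>\<^bsub>W\<^esub> c \<in> N" if "a \<ominus>\<^bsub>W\<^esub> b \<in> N" "b \<ominus>\<^bsub>W\<^esub> c \<in> N"
    "a \<in> carrier W" "b \<in> carrier W" "c \<in> carrier W" for a b c
  proof -
    have "a \<ominus>\<^bsub>W\<^esub> c = (a \<ominus>\<^bsub>W\<^esub> b) \<oplus>\<^bsub>W\<^esub> (b \<ominus>\<^bsub>W\<^esub> c)"
      using that(3-5) by (simp add: a_minus_def WA.a_assoc WA.r_neg1)
    then show ?thesis using N.m_closed that by simp
  qed
  have rep: "coset_rep W N a \<in> carrier W" "a \<ominus>\<^bsub>W\<^esub> coset_rep W N a \<in> N" if "a \<in> carrier W" for a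
    using someI[of "\<lambda>y. y \<in> carrier W \<and> a \<ominus>\<^bsub>W\<^esub> y \<in> N" a] that
    unfolding coset_rep_def by (auto simp: a_minus_def WA.r_neg)
  show ?thesis
  proof
    assume eq: "coset_rep W N x = coset_rep W N y"
    have "coset_rep W N x \<ominus>\<^bsub>W\<^esub> y \<in> N" unfolding eq by (rule flip[OF rep(2)[OF y] y rep(1)[OF y]])
    then show "x \<ominus>\<^bsub>W\<^esub> y \<in> N" by (rule tr[OF rep(2)[OF x] _ x rep(1)[OF x] y])
  next
    assume xy: "x \<ominus>\<^bsub>W\<^esub> y \<in> N"
    \<comment> \<open>Vectors that differ by an element of \<open>N\<close> define the same
      predicate, so \<open>SOME\<close> returns the same representative for both.\<close>
    have "x \<ominus>\<^bsub>W\<^esub> z \<in> N \<longleftrightarrow> y \<ominus>\<^bsub>W\<^esub> z \<in> N" if z: "z \<in> carrier W" for z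
      using tr[OF flip[OF xy x y] _ y x z] tr[OF xy _ x y z] by (rule iffI)
    then have "(\<lambda>z. z \<in> carrier W \<and> x \<ominus>\<^bsub>W\<^esub> z \<in> N) = (\<lambda>z. z \<in> carrier W \<and> y \<ominus>\<^bsub>W\<^esub> z \<in> N)"
      by meson
    then show "coset_rep W N x = coset_rep W N y" unfolding coset_rep_def by simp
  qed
qed

abbreviation quotient_space :: "('a, 'x) module \<Rightarrow> 'x set \<Rightarrow> ('a, 'x) module" where
  "quotient_space W N \<equiv> image_module (coset_rep W N) W"

lemma quotient_space:
  assumes W: "vectorspace R W" and N: "submodule R N W"
  shows "carrier (quotient_space W N) = coset_rep W N ` carrier W"
    "vectorspace R (quotient_space W N)"
    "restrict (coset_rep W N) (carrier W) \<in> arrs (Vect R) W (quotient_space W N)"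
    "\<And>x. x \<in> carrier W \<Longrightarrow> coset_rep W N x = \<zero>\<^bsub>quotient_space W N\<^esub> \<longleftrightarrow> x \<in> N"
proof -
  interpret WA: abelian_group W by (rule vectorspace_abelian_group) fact
  interpret W: vectorspace R W by fact
  interpret N: submodule R N W by fact
  have add: "coset_rep W N (x \<oplus>\<^bsub>W\<^esub> y) = coset_rep W N (x' \<oplus>\<^bsub>W\<^esub> y')"
    if "x \<in> carrier W" "x' \<in> carrier W" "y \<in> carrier W" "y' \<in> carrier W"
      "coset_rep W N x = coset_rep W N x'" "coset_rep W N y = coset_rep W N y'" for x x' y y'
  proof -
    have "(x \<oplus>\<^bsub>W\<^esub> y) \<ominus>\<^bsub>W\<^esub> (x' \<oplus>\<^bsub>W\<^esub> y') = (x \<ominus>\<^bsub>W\<^esub> x') \<oplus>\<^bsub>W\<^esub> (y \<ominus>\<^bsub>W\<^esub> y')"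
      using that(1-4) by (simp add: a_minus_def WA.minus_add WA.a_ac)
    then show ?thesis using that coset_rep_eq_iff[OF W N] N.m_closed by simp
  qed
  have smult: "coset_rep W N (c \<odot>\<^bsub>W\<^esub> x) = coset_rep W N (c \<odot>\<^bsub>W\<^esub> x')"
    if "c \<in> carrier R" "x \<in> carrier W" "x' \<in> carrier W" "coset_rep W N x = coset_rep W N x'" for c x x'
  proof -
    have "(c \<odot>\<^bsub>W\<^esub> x) \<ominus>\<^bsub>W\<^esub> (c \<odot>\<^bsub>W\<^esub> x') = c \<odot>\<^bsub>W\<^esub> (x \<ominus>\<^bsub>W\<^esub> x')"
      using that(1-3) by (simp add: a_minus_def W.smult_r_distr W.smult_r_minus)
    then show ?thesis using that coset_rep_eq_iff[OF W N] N.smult_closed by simp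
  qed
  have im: "carrier (quotient_space W N) = coset_rep W N ` carrier W"
    "\<zero>\<^bsub>quotient_space W N\<^esub> = coset_rep W N \<zero>\<^bsub>W\<^esub>"
    "\<And>x y. \<lbrakk>x \<in> carrier W; y \<in> carrier W\<rbrakk>
      \<Longrightarrow> coset_rep W N x \<oplus>\<^bsub>quotient_space W N\<^esub> coset_rep W N y = coset_rep W N (x \<oplus>\<^bsub>W\<^esub> y)"
    "\<And>c x. \<lbrakk>c \<in> carrier R; x \<in> carrier W\<rbrakk>
      \<Longrightarrow> c \<odot>\<^bsub>quotient_space W N\<^esub> coset_rep W N x = coset_rep W N (c \<odot>\<^bsub>W\<^esub> x)"
    "vectorspace R (quotient_space W N)"
    by (rule image_module[OF W]; (rule add smult)?; assumption)+
  show "carrier (quotient_space W N) = coset_rep W N ` carrier W" by (fact im(1))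
  show "vectorspace R (quotient_space W N)" by (fact im(5))
  show "restrict (coset_rep W N) (carrier W) \<in> arrs (Vect R) W (quotient_space W N)"
    by (rule Vect_arrI[OF W im(5)]) (simp_all add: im(1,3,4))
  show "coset_rep W N x = \<zero>\<^bsub>quotient_space W N\<^esub> \<longleftrightarrow> x \<in> N" if "x \<in> carrier W" for x
    using coset_rep_eq_iff[OF W N that, of "\<zero>\<^bsub>W\<^esub>"] im(2) that
      vectorspace_rules(1)[OF W] vectorspace_rules(6)[OF W that] by simp
qed

text \<open>The homomorphism theorem: \<open>g\<close> is constant on the fibres of
  \<open>e\<close>, so any choice of preimages defines the factor. It yields both the universal
  property of the quotient and the fact that a surjection is the cokernel of its kernel.\<close>

lemma Vect_factor_surj:
  assumes e: "e \<in> arrs (Vect R) V W" "e ` carrier V = carrier W" and g: "g \<in> arrs (Vect R) V U"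
    and ker: "\<And>x. \<lbrakk>x \<in> carrier V; e x = \<zero>\<^bsub>W\<^esub>\<rbrakk> \<Longrightarrow> g x = \<zero>\<^bsub>U\<^esub>"
  shows "\<exists>!h. h \<in> arrs (Vect R) W U \<and> cmp (Vect R) V W U h e = g"
proof -
  note E = Vect_arrD[OF e(1)] and G = Vect_arrD[OF g]
  note VS = vectorspace_rules[OF E(1)] vectorspace_rules[OF E(2)] vectorspace_rules[OF G(2)]
  have eq: "g x = g y" if "x \<in> carrier V" "y \<in> carrier V" "e x = e y" for x y
    using that ker[of "x \<ominus>\<^bsub>V\<^esub> y"] E G VS by simp
  define h where "h w = g (inv_into (carrier V) e w)" for w
  have h: "h (e x) = g x" if "x \<in> carrier V" for x
    unfolding h_def using that by (intro eq) (auto intro: inv_into_into f_inv_into_f)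
  have W: "\<exists>x \<in> carrier V. w = e x" if "w \<in> carrier W" for w using that e(2) by blast
  have hW: "restrict h (carrier W) \<in> arrs (Vect R) W U"
  proof (rule Vect_arrI[OF E(2) G(2)])
    fix w assume "w \<in> carrier W" then show "h w \<in> carrier U" using W[of w] h G by auto
  next
    fix w w' assume "w \<in> carrier W" "w' \<in> carrier W"
    then obtain x x' where x: "x \<in> carrier V" "w = e x" "x' \<in> carrier V" "w' = e x'" using W by metis
    then show "h (w \<oplus>\<^bsub>W\<^esub> w') = h w \<oplus>\<^bsub>U\<^esub> h w'"
      using h[of "x \<oplus>\<^bsub>V\<^esub> x'"] h E(5) G(5) VS by simp
  next
    fix c w assume c: "c \<in> carrier R" "w \<in> carrier W"
    then obtain x where x: "x \<in> carrier V" "w = e x" using W by metis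
    then show "h (c \<odot>\<^bsub>W\<^esub> w) = c \<odot>\<^bsub>U\<^esub> h w"
      using h[of "c \<odot>\<^bsub>V\<^esub> x"] h E(7) G(7) VS c by simp
  qed
  show ?thesis
  proof (intro ex1I conjI)
    show "restrict h (carrier W) \<in> arrs (Vect R) W U" by (rule hW)
    show "cmp (Vect R) V W U (restrict h (carrier W)) e = g"
      using h E(4) G(9) by (auto simp: compose_def intro!: extensionalityI[of _ "carrier V"])
  next
    fix h' assume h': "h' \<in> arrs (Vect R) W U \<and> cmp (Vect R) V W U h' e = g"
    show "h' = restrict h (carrier W)"
    proof (rule extensionalityI[of _ "carrier W"])
      fix w assume w: "w \<in> carrier W"
      then obtain x where x: "x \<in> carrier V" "w = e x" using W by metis
      then show "h' w = restrict h (carrier W) w"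
        using h' h[of x] w by (auto simp: compose_def)
    qed (use h' Vect_arrD(9)[of h' R W U] in simp_all)
  qed
qed

lemma Vect_cokernel:
  assumes f: "f \<in> arrs (Vect R) V W"
  defines "N \<equiv> f ` carrier V"
  shows "submodule R N W"
    "is_cokernel (Vect R) V W f (quotient_space W N) (restrict (coset_rep W N) (carrier W))"
proof -
  interpret f: linear_map R V W f by (rule Vect_arrD(3)[OF f])
  have N: "N = f.im" by (auto simp: N_def f.im_def)
  show S: "submodule R N W" unfolding N by (rule f.im_is_submodule)
  note Q = quotient_space[OF Vect_arrD(2)[OF f] S]
  let ?e = "restrict (coset_rep W N) (carrier W)"
  show "is_cokernel (Vect R) V W f (quotient_space W N) ?e"
    unfolding is_cokernel_def
  proof (intro conjI ballI impI)
    show "cmp (Vect R) V W (quotient_space W N) ?e f = zarr (Vect R) V (quotient_space W N)"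
      using Q(4) Vect_arrD(4)[OF f] by (auto simp: compose_def N_def intro!: restrict_ext)
  next
    fix U g assume g: "g \<in> arrs (Vect R) W U" and z: "cmp (Vect R) V W U g f = zarr (Vect R) V U"
    have "g x = \<zero>\<^bsub>U\<^esub>" if x: "x \<in> N" for x
    proof -
      obtain v where v: "v \<in> carrier V" "x = f v" using x by (auto simp: N_def)
      then show ?thesis using fun_cong[OF z, of v] by (simp add: compose_def)
    qed
    then show "\<exists>!h. h \<in> arrs (Vect R) (quotient_space W N) U \<and>
        cmp (Vect R) W (quotient_space W N) U h ?e = g"
      using Q(1,4) by (intro Vect_factor_surj[OF Q(3) _ g]) auto
  qed (simp_all add: Q(2,3))
qed

section \<open>Monomorphisms and epimorphisms of linear maps\<close>

lemma Vect_mono_inj: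
  assumes "is_mono (Vect R) V W f" and f: "f \<in> arrs (Vect R) V W"
  shows "inj_on f (carrier V)"
proof (rule inj_onI)
  interpret C: preadditive_category "Vect R" by (rule Vect_preadditive)
  fix x y assume x: "x \<in> carrier V" "y \<in> carrier V" "f x = f y"
  note F = Vect_arrD[OF f]
  note VS = vectorspace_rules[OF F(1)] vectorspace_rules[OF F(2)]
  let ?N = "{x \<in> carrier V. f x = \<zero>\<^bsub>W\<^esub>}"
  note k = is_kernelD[OF Vect_kernel(2)[OF f]]
  \<comment> \<open>The inclusion of the kernel is killed by the monic \<open>f\<close>, hence is
    the zero arrow; evaluating it at \<open>x - y\<close> gives injectivity.\<close>
  have m: "(\<lambda>x\<in>?N. x) = zarr (Vect R) (V\<lparr>carrier := ?N\<rparr>) V"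
    by (rule C.mono_zero[OF assms(1) _ _ k]) (simp_all add: F(1,2))
  have "x \<ominus>\<^bsub>V\<^esub> y \<in> ?N" using x F VS by simp
  then have "x \<ominus>\<^bsub>V\<^esub> y = \<zero>\<^bsub>V\<^esub>" using fun_cong[OF m, of "x \<ominus>\<^bsub>V\<^esub> y"] by simp
  then show "x = y" using VS x by simp
qed

lemma Vect_epi_surj:
  assumes "is_epi (Vect R) V W f" and f: "f \<in> arrs (Vect R) V W"
  shows "f ` carrier V = carrier W"
proof -
  interpret C: preadditive_category "op_cat (Vect R)"
    by (rule preadditive_category.preadditive_op[OF Vect_preadditive])
  note F = Vect_arrD[OF f]
  let ?N = "f ` carrier V"
  note Q = quotient_space[OF F(2) Vect_cokernel(1)[OF f]]
  \<comment> \<open>In the opposite category \<open>f\<close> is monic, and the quotient map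
    composes with it to zero. So the quotient map vanishes and \<open>?N\<close> is all of
    \<open>W\<close>.\<close>
  have "restrict (coset_rep W ?N) (carrier W) = zarr (Vect R) W (quotient_space W ?N)"
    using C.mono_zero[of W V f "quotient_space W ?N" "restrict (coset_rep W ?N) (carrier W)"]
      is_cokernelD[OF Vect_cokernel(2)[OF f]] assms(1) F by (simp del: Vect_simps)
  then have "coset_rep W ?N x = \<zero>\<^bsub>quotient_space W ?N\<^esub>" if "x \<in> carrier W" for x
    using that by (metis Vect_simps(3) restrict_apply')
  then show ?thesis using Q(4) F(4) by blast
qed

lemma Vect_mono_is_kernel:
  assumes "is_mono (Vect R) V W f" and f: "f \<in> arrs (Vect R) V W"
  shows "\<exists>Z \<in> objs (Vect R). \<exists>g \<in> arrs (Vect R) W Z. is_kernel (Vect R) W Z g V f"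
proof -
  note F = Vect_arrD[OF f] and inj = Vect_mono_inj[OF assms]
  let ?N = "f ` carrier V"
  let ?Q = "quotient_space W ?N" and ?e = "restrict (coset_rep W ?N) (carrier W)"
  note Q = quotient_space[OF F(2) Vect_cokernel(1)[OF f]]
  note c = is_cokernelD[OF Vect_cokernel(2)[OF f]]
  note VS = vectorspace_rules[OF F(1)]
  have "is_kernel (Vect R) W ?Q ?e V f"
    unfolding is_kernel_def
  proof (intro conjI ballI impI)
    fix U g assume g: "g \<in> arrs (Vect R) U W" and z: "cmp (Vect R) U W ?Q ?e g = zarr (Vect R) U ?Q"
    note G = Vect_arrD[OF g]
    \<comment> \<open>The vectors killed by the quotient map are those in the image of
      \<open>f\<close>, so \<open>g\<close> can be pulled back through \<open>f\<close>; linearity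
      of the result is checked after applying the injective \<open>f\<close>.\<close>
    have gN: "g x \<in> ?N" if x: "x \<in> carrier U" for x
    proof -
      have "coset_rep W ?N (g x) = \<zero>\<^bsub>?Q\<^esub>"
        using fun_cong[OF z, of x] x G(4)[OF x] by (simp add: compose_def)
      then show ?thesis using Q(4)[OF G(4)[OF x]] by blast
    qed
    define h where "h x = inv_into (carrier V) f (g x)" for x
    have h: "h x \<in> carrier V" "f (h x) = g x" if "x \<in> carrier U" for x
      unfolding h_def using gN[OF that] by (auto intro: inv_into_into f_inv_into_f)
    have hU: "restrict h (carrier U) \<in> arrs (Vect R) U V"
    proof (rule Vect_arrI[OF G(1) F(1)])
      show "h x \<in> carrier V" if "x \<in> carrier U" for x using h(1) that .
    next
      fix x y assume x: "x \<in> carrier U" "y \<in> carrier U"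
      show "h (x \<oplus>\<^bsub>U\<^esub> y) = h x \<oplus>\<^bsub>V\<^esub> h y"
      proof (rule inj_onD[OF inj])
        show "f (h (x \<oplus>\<^bsub>U\<^esub> y)) = f (h x \<oplus>\<^bsub>V\<^esub> h y)"
          by (simp add: h F(5) G(5) x vectorspace_rules(2)[OF G(1)])
      qed (simp_all add: h(1) x VS(2) vectorspace_rules(2)[OF G(1)])
    next
      fix c x assume x: "c \<in> carrier R" "x \<in> carrier U"
      show "h (c \<odot>\<^bsub>U\<^esub> x) = c \<odot>\<^bsub>V\<^esub> h x"
      proof (rule inj_onD[OF inj])
        show "f (h (c \<odot>\<^bsub>U\<^esub> x)) = f (c \<odot>\<^bsub>V\<^esub> h x)"
          by (simp add: h F(7) G(7) x vectorspace_rules(4)[OF G(1)])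
      qed (simp_all add: h(1) x VS(4) vectorspace_rules(4)[OF G(1)])
    qed
    show "\<exists>!h. h \<in> arrs (Vect R) U V \<and> cmp (Vect R) U V W f h = g"
    proof (intro ex1I conjI)
      show "restrict h (carrier U) \<in> arrs (Vect R) U V" by (rule hU)
      show "cmp (Vect R) U V W f (restrict h (carrier U)) = g"
        using h G(9) by (auto simp: compose_def intro!: extensionalityI[of _ "carrier U"])
    next
      fix h' assume h': "h' \<in> arrs (Vect R) U V \<and> cmp (Vect R) U V W f h' = g"
      show "h' = restrict h (carrier U)"
      proof (rule extensionalityI[of _ "carrier U"])
        fix x assume x: "x \<in> carrier U"
        have "f (h' x) = g x" using h' x by (auto simp: compose_def)
        then have "f (h' x) = f (h x)" using h(2)[OF x] by simp
        then show "h' x = restrict h (carrier U) x"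
          using inj_onD[OF inj _ Vect_arrD(4)[of h' R U V, OF _ x] h(1)[OF x]] h' x by simp
      qed (use h' Vect_arrD(9)[of h' R U V] in simp_all)
    qed
  qed (simp_all del: Vect_simps add: F(1) f c(3))
  then show ?thesis using c by blast
qed

lemma Vect_epi_is_cokernel:
  assumes "is_epi (Vect R) V W f" and f: "f \<in> arrs (Vect R) V W"
  shows "\<exists>Z \<in> objs (Vect R). \<exists>g \<in> arrs (Vect R) Z V. is_cokernel (Vect R) Z V g W f"
proof -
  note F = Vect_arrD[OF f] and surj = Vect_epi_surj[OF assms]
  let ?N = "{x \<in> carrier V. f x = \<zero>\<^bsub>W\<^esub>}"
  let ?Z = "V\<lparr>carrier := ?N\<rparr>" and ?m = "\<lambda>x\<in>?N. x"
  note k = is_kernelD[OF Vect_kernel(2)[OF f]]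
  have "is_cokernel (Vect R) ?Z V ?m W f"
    unfolding is_cokernel_def
  proof (intro conjI ballI impI)
    fix U g assume g: "g \<in> arrs (Vect R) V U" and z: "cmp (Vect R) ?Z V U g ?m = zarr (Vect R) ?Z U"
    show "\<exists>!h. h \<in> arrs (Vect R) W U \<and> cmp (Vect R) V W U h f = g"
    proof (rule Vect_factor_surj[OF f surj g])
      fix x assume "x \<in> carrier V" "f x = \<zero>\<^bsub>W\<^esub>"
      then show "g x = \<zero>\<^bsub>U\<^esub>" using fun_cong[OF z, of x] by (simp add: compose_def)
    qed
  qed (simp_all del: Vect_simps add: F(2) f k(3))
  then show ?thesis using k by blast
qed

section \<open>The zero space and biproducts\<close>

lemma Vect_zero_object:
  fixes z :: 'x
  defines "Z \<equiv> \<lparr>carrier = {z}, mult = (\<lambda>a b. z), one = z, zero = z, add = (\<lambda>a b. z),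
    smult = (\<lambda>c a. z)\<rparr>"
  shows "vectorspace R Z" "zero_object (Vect R) Z"
proof -
  have "module R Z" by (rule module_criteria) (auto simp: Z_def is_cring)
  then show V: "vectorspace R Z" by (rule vectorspaceI)
  interpret C: preadditive_category "Vect R" by (rule Vect_preadditive)
  have Z: "carrier Z = {\<zero>\<^bsub>Z\<^esub>}" by (simp add: Z_def)
  show "zero_object (Vect R) Z"
    unfolding zero_object_def
  proof (intro conjI ballI)
    fix V :: "('a, 'x) module" assume V': "V \<in> objs (Vect R)"
    show "\<exists>!f. f \<in> arrs (Vect R) V Z"
    proof (rule ex1I[of _ "zarr (Vect R) V Z"])
      show "zarr (Vect R) V Z \<in> arrs (Vect R) V Z" using C.zarr_arr V V' by simp
      fix f assume f: "f \<in> arrs (Vect R) V Z"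
      show "f = zarr (Vect R) V Z"
        using Vect_arrD(4,9)[OF f] Z by (auto intro!: extensionalityI[of _ "carrier V"])
    qed
    show "\<exists>!f. f \<in> arrs (Vect R) Z V"
    proof (rule ex1I[of _ "zarr (Vect R) Z V"])
      show "zarr (Vect R) Z V \<in> arrs (Vect R) Z V" using C.zarr_arr V V' by simp
      fix f assume f: "f \<in> arrs (Vect R) Z V"
      show "f = zarr (Vect R) Z V"
        using Vect_arrD(8,9)[OF f] Z by (auto intro!: extensionalityI[of _ "carrier Z"])
    qed
  qed (use V in simp)
qed

lemma Vect_biproduct:
  fixes V W :: "('a, 'x) module"
  assumes V: "vectorspace R V" and W: "vectorspace R W" and inf: "infinite (UNIV :: 'x set)"
  shows "\<exists>S i j p q. is_biproduct (Vect R) V W S i j p q"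
proof -
  \<comment> \<open>An infinite type is in bijection with its square. Through \<open>\<phi>\<close>
    a pair of vectors becomes a single element, which places the direct sum in the same
    universe.\<close>
  obtain \<phi> :: "'x \<times> 'x \<Rightarrow> 'x" where "inj \<phi>"
    using card_of_Times_same_infinite[OF inf]
    unfolding card_of_ordIso[symmetric] bij_betw_def by auto
  then have \<phi>: "\<phi> a = \<phi> b \<longleftrightarrow> a = b" "inv_into UNIV \<phi> (\<phi> a) = a" for a b by (auto simp: inj_eq)
  note VS = vectorspace_rules[OF V] vectorspace_rules[OF W]
  have D: "vectorspace R (direct_sum V W)"
    using V W direct_sum_is_module by (intro vectorspaceI) (auto simp: vectorspace_def)
  have cD: "carrier (direct_sum V W) = carrier V \<times> carrier W"
    "\<zero>\<^bsub>direct_sum V W\<^esub> = (\<zero>\<^bsub>V\<^esub>, \<zero>\<^bsub>W\<^esub>)"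
    "(a, b) \<oplus>\<^bsub>direct_sum V W\<^esub> (a', b') = (a \<oplus>\<^bsub>V\<^esub> a', b \<oplus>\<^bsub>W\<^esub> b')"
    "c \<odot>\<^bsub>direct_sum V W\<^esub> (a, b) = (c \<odot>\<^bsub>V\<^esub> a, c \<odot>\<^bsub>W\<^esub> b)" for a b a' b' c
    by (auto simp: direct_sum_def)
  define S where "S = image_module \<phi> (direct_sum V W)"
  have S: "carrier S = \<phi> ` (carrier V \<times> carrier W)" "vectorspace R S"
    "\<And>a b a' b'. \<lbrakk>a \<in> carrier V; b \<in> carrier W; a' \<in> carrier V; b' \<in> carrier W\<rbrakk>
      \<Longrightarrow> \<phi> (a, b) \<oplus>\<^bsub>S\<^esub> \<phi> (a', b') = \<phi> (a \<oplus>\<^bsub>V\<^esub> a', b \<oplus>\<^bsub>W\<^esub> b')"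
    "\<And>c a b. \<lbrakk>c \<in> carrier R; a \<in> carrier V; b \<in> carrier W\<rbrakk>
      \<Longrightarrow> c \<odot>\<^bsub>S\<^esub> \<phi> (a, b) = \<phi> (c \<odot>\<^bsub>V\<^esub> a, c \<odot>\<^bsub>W\<^esub> b)"
    using image_module[OF D, of \<phi>] unfolding S_def by (auto simp: cD \<phi>)
  define i where "i = (\<lambda>x\<in>carrier V. \<phi> (x, \<zero>\<^bsub>W\<^esub>))"
  define j where "j = (\<lambda>x\<in>carrier W. \<phi> (\<zero>\<^bsub>V\<^esub>, x))"
  define p where "p = (\<lambda>s\<in>carrier S. fst (inv_into UNIV \<phi> s))"
  define q where "q = (\<lambda>s\<in>carrier S. snd (inv_into UNIV \<phi> s))"
  have S_in: "\<phi> (a, b) \<in> carrier S" if "a \<in> carrier V" "b \<in> carrier W" for a b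
    using that S(1) by blast
  have S_cases: "\<exists>a\<in>carrier V. \<exists>b\<in>carrier W. s = \<phi> (a, b)" if "s \<in> carrier S" for s
    using that S(1) by blast
  have i: "i \<in> arrs (Vect R) V S"
    unfolding i_def by (rule Vect_arrI[OF V S(2)]) (simp_all add: S_in S(3,4) VS(1,10,16,18))
  have j: "j \<in> arrs (Vect R) W S"
    unfolding j_def by (rule Vect_arrI[OF W S(2)]) (simp_all add: S_in S(3,4) VS(1,10,7,9))
  have pq: "p (\<phi> (a, b)) = a" "q (\<phi> (a, b)) = b" if "a \<in> carrier V" "b \<in> carrier W" for a b
    using S_in[OF that] by (simp_all add: p_def q_def \<phi>(2))
  \<comment> \<open>\<open>Vect_arrI\<close> speaks of restricted functions; \<open>p\<close> and
    \<open>q\<close> are extensional already, so restricting them again changes nothing.\<close>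
  have pq': "(\<lambda>s\<in>carrier S. p s) = p" "(\<lambda>s\<in>carrier S. q s) = q"
    by (simp_all add: p_def q_def fun_eq_iff)
  have "(\<lambda>s\<in>carrier S. p s) \<in> arrs (Vect R) S V"
  proof (rule Vect_arrI[OF S(2) V])
    show "p s \<in> carrier V" if "s \<in> carrier S" for s
      using S_cases[OF that] by (auto simp: pq)
    show "p (s \<oplus>\<^bsub>S\<^esub> t) = p s \<oplus>\<^bsub>V\<^esub> p t" if "s \<in> carrier S" "t \<in> carrier S" for s t
      using S_cases[OF that(1)] S_cases[OF that(2)] by (auto simp: pq S(3) VS(2,11))
    show "p (c \<odot>\<^bsub>S\<^esub> s) = c \<odot>\<^bsub>V\<^esub> p s" if "c \<in> carrier R" "s \<in> carrier S" for c s
      using S_cases[OF that(2)] that(1) by (auto simp: pq S(4) VS(4,13))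
  qed
  moreover have "(\<lambda>s\<in>carrier S. q s) \<in> arrs (Vect R) S W"
  proof (rule Vect_arrI[OF S(2) W])
    show "q s \<in> carrier W" if "s \<in> carrier S" for s
      using S_cases[OF that] by (auto simp: pq)
    show "q (s \<oplus>\<^bsub>S\<^esub> t) = q s \<oplus>\<^bsub>W\<^esub> q t" if "s \<in> carrier S" "t \<in> carrier S" for s t
      using S_cases[OF that(1)] S_cases[OF that(2)] by (auto simp: pq S(3) VS(2,11))
    show "q (c \<odot>\<^bsub>S\<^esub> s) = c \<odot>\<^bsub>W\<^esub> q s" if "c \<in> carrier R" "s \<in> carrier S" for c s
      using S_cases[OF that(2)] that(1) by (auto simp: pq S(4) VS(4,13))
  qed
  moreover have "i (p s) \<oplus>\<^bsub>S\<^esub> j (q s) = s" if "s \<in> carrier S" for s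
    using S_cases[OF that] by (auto simp: pq i_def j_def S(3) VS(1,8,10,16))
  ultimately have "is_biproduct (Vect R) V W S i j p q"
    unfolding is_biproduct_def Vect_simps Vect_objs pq' using i j
    by (simp add: S(2) compose_def pq i_def j_def VS(1,10) cong: restrict_cong)
  then show ?thesis by blast
qed

lemma Vect_abelian:
  assumes "infinite (UNIV :: 'x set)"
  shows "abelian_category (Vect R :: (('a, 'x) module, 'x \<Rightarrow> 'x) precat)"
proof -
  interpret C: preadditive_category "Vect R :: (('a, 'x) module, 'x \<Rightarrow> 'x) precat"
    by (rule Vect_preadditive)
  show ?thesis
  proof
    show "\<exists>z :: ('a, 'x) module. zero_object (Vect R) z" by (intro exI) (rule Vect_zero_object(2))
  next
    fix a b :: "('a, 'x) module" assume "a \<in> objs (Vect R)" "b \<in> objs (Vect R)"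
    then show "\<exists>s i j p q. is_biproduct (Vect R) a b s i j p q"
      using Vect_biproduct assms by simp
  next
    fix a b :: "('a, 'x) module" and f assume "f \<in> arrs (Vect R) a b"
    then show "\<exists>k m. is_kernel (Vect R) a b f k m" "\<exists>k m. is_cokernel (Vect R) a b f k m"
      using Vect_kernel(2) Vect_cokernel(2) by blast+
  next
    fix a b :: "('a, 'x) module" and f assume "is_mono (Vect R) a b f"
    then show "\<exists>c \<in> objs (Vect R). \<exists>g \<in> arrs (Vect R) b c. is_kernel (Vect R) b c g a f"
      by (intro Vect_mono_is_kernel) (auto simp: is_mono_def)
  next
    fix a b :: "('a, 'x) module" and f assume "is_epi (Vect R) a b f"
    then show "\<exists>c \<in> objs (Vect R). \<exists>g \<in> arrs (Vect R) c a. is_cokernel (Vect R) c a g b f"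
      by (intro Vect_epi_is_cokernel) (auto simp: is_epi_def)
  qed
qed

end

section \<open>Finite-dimensional vector spaces\<close>

text \<open>Independent subsets of \<open>N\<close> stay independent in \<open>V\<close>, so
  \<open>dim\<close> bounds their size and a maximal one exists. A maximal independent set
  generates.\<close>

lemma (in vectorspace) fin_dim_subspace:
  assumes fd: "fin_dim" and N: "subspace K N V"
  shows "vectorspace.fin_dim K (V\<lparr>carrier := N\<rparr>)"
proof -
  interpret n: vectorspace K "V\<lparr>carrier := N\<rparr>" by (rule subspace_is_vs[OF N])
  have sub: "submodule K N V" using N by simp
  have NV: "N \<subseteq> carrier V" by (rule submodule.subset[OF sub])
  let ?indep = "\<lambda>S. S \<subseteq> carrier (V\<lparr>carrier := N\<rparr>) \<and> n.lin_indpt S"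
  have "\<exists>A. finite A \<and> maximal A ?indep"
  proof (rule maximal_exists)
    fix A assume A: "?indep A"
    then have "A \<subseteq> N" by simp
    moreover have "lin_indpt A" using span_li_not_depend(2)[OF \<open>A \<subseteq> N\<close> sub] A by simp
    ultimately show "finite A \<and> card A \<le> dim" using li_le_dim[OF fd, of A] NV by simp
  next
    show "?indep {}" by (simp add: n.lin_dep_def)
  qed
  then obtain A where A: "finite A" "maximal A ?indep" by blast
  moreover have "A \<subseteq> carrier (V\<lparr>carrier := N\<rparr>)" using A(2) unfolding maximal_def by blast
  ultimately show ?thesis
    unfolding n.fin_dim_def using n.max_li_is_gen[OF A(2)] by blast
qed

lemma (in vectorspace) gen_set_subset_submodule:
  assumes "gen_set A" "A \<subseteq> N" "submodule K N V"
  shows "carrier V \<subseteq> N"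
  using span_is_subset[OF assms(2,3)] assms(1) by simp

text \<open>This lets a property of generators spread: if \<open>T\<close> maps a generating set
  into \<open>U\<close>, it maps the whole space into \<open>U\<close>.\<close>

lemma Vect_preimage_submodule:
  assumes T: "T \<in> arrs (Vect K) V W" and U: "submodule K U W"
  shows "submodule K {x \<in> carrier V. T x \<in> U} V"
proof -
  note TD = Vect_arrD[OF T]
  note VS = vectorspace_rules[OF TD(1)]
  interpret U: submodule K U W by (rule U)
  show ?thesis
    by (rule submodule.intro)
      (use TD(1) in \<open>auto simp: vectorspace_def VS TD(5,7,8)\<close>)
qed

text \<open>The argument rests on the equation \<open>i p + j q = id\<close> and so fits any
  biproduct, however its object is modelled: each \<open>x\<close> equals
  \<open>i (p x) + j (q x)\<close>, hence the images of generators of \<open>V\<close> and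
  \<open>W\<close> generate \<open>S\<close>.\<close>

lemma fin_dim_biproduct:
  assumes bi: "is_biproduct (Vect K) V W S i j p q"
    and V: "vectorspace.fin_dim K V" and W: "vectorspace.fin_dim K W"
  shows "vectorspace.fin_dim K S"
proof -
  have i: "i \<in> arrs (Vect K) V S" and j: "j \<in> arrs (Vect K) W S"
    and p: "p \<in> arrs (Vect K) S V" and q: "q \<in> arrs (Vect K) S W"
    and sum: "plus_arr (Vect K) S S (cmp (Vect K) S V S i p) (cmp (Vect K) S W S j q) = ident (Vect K) S"
    using bi unfolding is_biproduct_def by auto
  interpret V: vectorspace K V by (rule Vect_arrD(1)[OF i])
  interpret W: vectorspace K W by (rule Vect_arrD(1)[OF j])
  interpret S: vectorspace K S by (rule Vect_arrD(2)[OF i])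
  obtain A where A: "finite A" "A \<subseteq> carrier V" "V.gen_set A" using V by (auto simp: V.fin_dim_def)
  obtain B where B: "finite B" "B \<subseteq> carrier W" "W.gen_set B" using W by (auto simp: W.fin_dim_def)
  let ?G = "i ` A \<union> j ` B"
  have G: "?G \<subseteq> carrier S" using A(2) B(2) Vect_arrD(4)[OF i] Vect_arrD(4)[OF j] by blast
  have U: "submodule K (S.span ?G) S" by (rule S.span_is_submodule[OF G])
  have in_span: "?G \<subseteq> S.span ?G" by (rule S.in_own_span[OF G])
  have "A \<subseteq> {x \<in> carrier V. i x \<in> S.span ?G}" "B \<subseteq> {x \<in> carrier W. j x \<in> S.span ?G}"
    using A(2) B(2) in_span by blast+
  then have VW: "carrier V \<subseteq> {x \<in> carrier V. i x \<in> S.span ?G}"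
    "carrier W \<subseteq> {x \<in> carrier W. j x \<in> S.span ?G}"
    using V.gen_set_subset_submodule[OF A(3) _ Vect_preimage_submodule[OF i U]]
      W.gen_set_subset_submodule[OF B(3) _ Vect_preimage_submodule[OF j U]] by blast+
  have "x \<in> S.span ?G" if x: "x \<in> carrier S" for x
  proof -
    have "i (p x) \<in> S.span ?G" "j (q x) \<in> S.span ?G"
      using VW Vect_arrD(4)[OF p x] Vect_arrD(4)[OF q x] by blast+
    then have "i (p x) \<oplus>\<^bsub>S\<^esub> j (q x) \<in> S.span ?G" by (rule submodule.m_closed[OF U])
    then show ?thesis using fun_cong[OF sum, of x] x by (simp add: compose_def)
  qed
  then have "carrier S \<subseteq> S.span ?G" by (rule subsetI)
  then have "S.gen_set ?G" by (rule equalityI[OF submodule.subset[OF U]])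
  moreover have "finite ?G" using A(1) B(1) by simp
  ultimately show ?thesis unfolding S.fin_dim_def using G by (intro exI[of _ ?G] conjI)
qed

context field
begin

lemma fin_dim_Vect_zero_object:
  fixes z :: 'x
  shows "vectorspace.fin_dim R \<lparr>carrier = {z}, mult = (\<lambda>a b. z), one = z, zero = z, add = (\<lambda>a b. z),
    smult = (\<lambda>c a. z)\<rparr>" (is "vectorspace.fin_dim R ?Z")
proof -
  interpret Z: vectorspace R ?Z by (rule Vect_zero_object)
  have "Z.span {} = carrier ?Z" by (simp add: Z.span_empty)
  then show ?thesis unfolding Z.fin_dim_def by blast
qed

lemma fin_dim_Vect_kernel:
  assumes f: "f \<in> arrs (Vect R) V W" and "vectorspace.fin_dim R V"
  shows "\<exists>k m. vectorspace.fin_dim R k \<and> is_kernel (Vect R) V W f k m"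
proof -
  interpret V: vectorspace R V by (rule Vect_arrD(1)[OF f])
  have "subspace R {x \<in> carrier V. f x = \<zero>\<^bsub>W\<^esub>} V"
    using Vect_kernel(1)[OF f] Vect_arrD(1)[OF f] by (simp add: subspace_def)
  then show ?thesis using V.fin_dim_subspace assms(2) Vect_kernel(2)[OF f] by blast
qed

lemma fin_dim_Vect_cokernel:
  assumes f: "f \<in> arrs (Vect R) V W" and W: "vectorspace.fin_dim R W"
  shows "\<exists>k m. vectorspace.fin_dim R k \<and> is_cokernel (Vect R) V W f k m"
proof -
  let ?N = "f ` carrier V"
  note Q = quotient_space[OF Vect_arrD(2)[OF f] Vect_cokernel(1)[OF f]]
  have "vectorspace.fin_dim R (quotient_space W ?N)"
    \<comment> \<open>The quotient is the image of \<open>W\<close> under a linear surjection, and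
      surjections preserve finite dimension.\<close>
    by (rule linear_map.rank_nullity_main(2)[OF Vect_arrD(3)[OF Q(3)] W]) (simp add: Q(1))
  then show ?thesis using Vect_cokernel(2)[OF f] by blast
qed

end

text \<open>That the values of \<open>M'\<close> are vector spaces is already part of
  \<open>is_functor\<close>, so the two conditions on values coincide.\<close>

lemma encodable_iff_encodable_in:
  fixes M :: "('p, 'f, 'v) persistence_module"
  shows "encodable K P r X M \<longleftrightarrow>
    encodable_in (Vect K) {V. vectorspace K V \<and> vectorspace.fin_dim K V} P r X M"
proof -
  have "(\<forall>q\<in>Q. vectorspace.fin_dim K (dobj M' q)) \<longleftrightarrow>
      (\<forall>q\<in>Q. dobj M' q \<in> {V. vectorspace K V \<and> vectorspace.fin_dim K V})"
    if "is_functor Q s (Vect K) M'" for Q s and M' :: "(nat, 'f, 'v) persistence_module"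
    using is_functorD(1)[OF that] by auto
  then show ?thesis
    unfolding encodable_def encodable_in_def Vect_pow_def functor_category_objs by meson
qed

lemma (in field) finite_objects_Vect:
  assumes "infinite (UNIV :: 'x set)"
  shows "finite_objects (Vect R) {V :: ('a, 'x) module. vectorspace R V \<and> vectorspace.fin_dim R V}"
    (is "finite_objects _ ?S")
proof (intro finite_objects.intro finite_objects_axioms.intro Vect_abelian[OF assms])
  show "?S \<subseteq> objs (Vect R)" by auto
  show "\<exists>z\<in>?S. zero_object (Vect R) z"
    by (rule bexI, rule Vect_zero_object(2)[of undefined])
      (simp add: Vect_zero_object(1) fin_dim_Vect_zero_object)
next
  fix V W :: "('a, 'x) module" assume V: "V \<in> ?S" and W: "W \<in> ?S"
  then obtain S i j p q where bi: "is_biproduct (Vect R) V W S i j p q"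
    using Vect_biproduct[OF _ _ assms, of V W] by blast
  then have "S \<in> objs (Vect R)" unfolding is_biproduct_def by blast
  then have "S \<in> ?S" using fin_dim_biproduct[OF bi] V W by simp
  then show "\<exists>s\<in>?S. \<exists>i j p q. is_biproduct (Vect R) V W s i j p q" using bi by blast
next
  fix V W :: "('a, 'x) module" and f
  assume V: "V \<in> ?S" and W: "W \<in> ?S" and f: "f \<in> arrs (Vect R) V W"
  obtain k m where k: "vectorspace.fin_dim R k" "is_kernel (Vect R) V W f k m"
    using fin_dim_Vect_kernel[OF f] V by blast
  moreover have "vectorspace R k" using is_kernelD(1)[OF k(2)] by simp
  ultimately show "\<exists>k\<in>?S. \<exists>m. is_kernel (Vect R) V W f k m" by blast
  obtain k m where k: "vectorspace.fin_dim R k" "is_cokernel (Vect R) V W f k m"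
    using fin_dim_Vect_cokernel[OF f] W by blast
  moreover have "vectorspace R k" using is_cokernelD(1)[OF k(2)] by simp
  ultimately show "\<exists>k\<in>?S. \<exists>m. is_cokernel (Vect R) V W f k m" by blast
qed

theorem theorem3p4:
  fixes K :: "('f, 'k) ring_scheme"
    and P :: "'p set" and r :: "'p rel" and X :: "'p set set"
  assumes "field K"
    and "infinite (UNIV :: 'v set)"
    and "partial_order_on P r"
    and "encoding_structure P r X"
    and "connective P r X"
  shows "full_abelian_subcategory
    (PerM K P r X :: (('p, 'f, 'v) persistence_module, 'p \<Rightarrow> 'v \<Rightarrow> 'v) precat)
    (Vect_pow K P r)"
proof -
  have fin: "finite_objects (Vect K)
      {V :: ('f, 'v) module. vectorspace K V \<and> vectorspace.fin_dim K V}"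
    by (rule field.finite_objects_Vect[OF assms(1,2)])
  have "connective_encoding (Vect K)
      {V :: ('f, 'v) module. vectorspace K V \<and> vectorspace.fin_dim K V} P r X"
    by (intro connective_encoding.intro connective_encoding_axioms.intro abelian_diagrams.intro
        abelian_diagrams_axioms.intro fin finite_objects.axioms(1)[OF fin] assms)
  from connective_encoding.full_abelian_encodable[OF this] show ?thesis
    unfolding PerM_def Vect_pow_def encodable_iff_encodable_in .
qed

end
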